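(* The following list gives, up to rotation, the types of all minimal vanishing sums of roots of unity (sorou) of weight at most $16$. That is, every minimal vanishing sorou of weight $n\le 16$ has (for a suitable rotation in the definition of type) one of the types listed under weight $n$, and every listed type is the type of some minimal vanishing sorou of that weight. All minimal vanishing sorou of weight at most $16$ have height $1$. Each entry has the form: type; weight partition; possible parities. The top prime of each type is the index $p$ of its leading symbol $R_p$. In weight partitions, $a^k$ means that $a$ is repeated $k$ times. The parity of every minimal vanishing sorou of a listed type is among the parities listed for that type, and all listed parities do occur. Weight 2: - $R_2$; $(1^2)$; $(1,1)$. Weight 3: - $R_3$; $(1^3)$; $(3,0)$. Weight 4: none. Weight 5: - $R_5$; $(1^5)$; $(5,0)$. Weight 6: - $(R_5:R_3)$; $(1^4,2)$; $(4,2)$. Weight 7: - $R_7$; $(1^7)$; $(7,0)$. - $(R_5:2R_3)$; $(1^3,2^2)$; $(4,3)$. Weight 8: - $(R_7:R_3)$; $(1^6,2)$; $(6,2)$. - $(R_5:3R_3)$; $(1^2,2^3)$; $(6,2)$. Weight 9: - $(R_7:2R_3)$; $(1^5,2^2)$; $(5,4)$. - $(R_5:4R_3)$; $(1,2^4)$; $(8,1)$. Weight 10: - $(R_7:R_5)$; $(1^6,4)$; $(6,4)$. - $(R_7:3R_3)$; $(1^4,2^3)$; $(6,4)$. Weight 11: - $R_{11}$; $(1^{11})$; $(11,0)$. - $(R_7:(R_5:R_3))$; $(1^6,5)$; $(10,1),(8,3)$. - $(R_7:R_3,R_5)$; $(1^5,2,4)$; $(6,5)$. - $(R_7:4R_3)$;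 $(1^3,2^4)$; $(8,3)$. Weight 12: - $(R_{11}:R_3)$; $(1^{10},2)$; $(10,2)$. - $(R_7:(R_5:2R_3))$; $(1^6,6)$; $(10,2),(9,3)$. - $(R_7:R_3,(R_5:R_3))$; $(1^5,2,5)$; $(9,3),(7,5)$. - $(R_7:2R_3,R_5)$; $(1^4,2^2,4)$; $(8,4)$. - $(R_7:5R_3)$; $(1^2,2^5)$; $(10,2)$. Weight 13: - $R_{13}$; $(1^{13})$; $(13,0)$. - $(R_{11}:2R_3)$; $(1^9,2^2)$; $(9,4)$. - $(R_7:(R_5:3R_3))$; $(1^6,7)$; $(12,1),(8,5)$. - $(R_7:R_3,(R_5:2R_3))$; $(1^5,2,6)$; $(9,4),(8,5)$. - $(R_7:2R_5)$; $(1^5,4^2)$; $(8,5)$. - $(R_7:2R_3,(R_5:R_3))$; $(1^4,2^2,5)$; $(8,5),(7,6)$. - $(R_7:3R_3,R_5)$; $(1^3,2^3,4)$; $(10,3)$. - $(R_7:6R_3)$; $(1,2^6)$; $(12,1)$. Weight 14: - $(R_{13}:R_3)$; $(1^{12},2)$; $(12,2)$. - $(R_{11}:R_5)$; $(1^{10},4)$; $(10,4)$. - $(R_{11}:3R_3)$; $(1^8,2^3)$; $(8,6)$. - $(R_7:(R_5:4R_3))$; $(1^6,8)$; $(14,0),(7,7)$. - $(R_7:R_3,(R_5:3R_3))$; $(1^5,2,7)$; $(11,3),(7,7)$. - $(R_7:R_5,(R_5:R_3))$; $(1^5,4,5)$; $(9,5),(7,7)$. - $(R_7:2R_3,(R_5:2R_3))$;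 $(1^4,2^2,6)$; $(8,6),(7,7)$. - $(R_7:R_3,2R_5)$; $(1^4,2,4^2)$; $(10,4)$. - $(R_7:3R_3,(R_5:R_3))$; $(1^3,2^3,5)$; $(9,5),(7,7)$. - $(R_7:4R_3,R_5)$; $(1^2,2^4,4)$; $(12,2)$. Weight 15: - $(R_{13}:2R_3)$; $(1^{11},2^2)$; $(11,4)$. - $(R_{11}:(R_5:R_3))$; $(1^{10},5)$; $(14,1),(12,3)$. - $(R_{11}:R_3,R_5)$; $(1^9,2,4)$; $(9,6)$. - $(R_{11}:4R_3)$; $(1^7,2^4)$; $(8,7)$. - $(R_7:R_3,(R_5:4R_3))$; $(1^5,2,8)$; $(13,2),(9,6)$. - $(R_7:R_5,(R_5:2R_3))$; $(1^5,4,6)$; $(9,6),(8,7)$. - $(R_7:2(R_5:R_3))$; $(1^5,5^2)$; $(13,2),(11,4),(9,6)$. - $(R_7:2R_3,(R_5:3R_3))$; $(1^4,2^2,7)$; $(10,5),(9,6)$. - $(R_7:R_3,R_5,(R_5:R_3))$; $(1^4,2,4,5)$; $(9,6),(8,7)$. - $(R_7:3R_3,(R_5:2R_3))$; $(1^3,2^3,6)$; $(9,6),(8,7)$. - $(R_7:2R_3,2R_5)$; $(1^3,2^2,4^2)$; $(12,3)$. - $(R_7:4R_3,(R_5:R_3))$; $(1^2,2^4,5)$; $(11,4),(9,6)$. - $(R_7:5R_3,R_5)$; $(1,2^5,4)$; $(14,1)$. - $(R_7:1+\nu_5^y:R_5)$, $y\in\{1,2\}$; $(2^6,3)$; $(12,3)$.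 Weight 16: - $(R_{13}:R_5)$; $(1^{12},4)$; $(12,4)$. - $(R_{13}:3R_3)$; $(1^{10},2^3)$; $(10,6)$. - $(R_{11}:R_7)$; $(1^{10},6)$; $(10,6)$. - $(R_{11}:(R_5:2R_3))$; $(1^{10},6)$; $(14,2),(13,3)$. - $(R_{11}:R_3,(R_5:R_3))$; $(1^9,2,5)$; $(13,3),(11,5)$. - $(R_{11}:2R_3,R_5)$; $(1^8,2^2,4)$; $(8,8)$. - $(R_{11}:5R_3)$; $(1^6,2^5)$; $(10,6)$. - $(R_7:R_5,(R_5:3R_3))$; $(1^5,4,7)$; $(11,5),(9,7)$. - $(R_7:(R_5:R_3),(R_5:2R_3))$; $(1^5,5,6)$; $(13,3),(12,4),(11,5),(10,6)$. - $(R_7:2R_3,(R_5:4R_3))$; $(1^4,2^2,8)$; $(12,4),(11,5)$. - $(R_7:R_3,R_5,(R_5:2R_3))$; $(1^4,2,4,6)$; $(9,7),(8,8)$. - $(R_7:R_3,2(R_5:R_3))$; $(1^4,2,5^2)$; $(12,4),(10,6),(8,8)$. - $(R_7:3R_5)$; $(1^4,4^3)$; $(12,4)$. - $(R_7:3R_3,(R_5:3R_3))$; $(1^3,2^3,7)$; $(11,5),(9,7)$. - $(R_7:2R_3,R_5,(R_5:R_3))$; $(1^3,2^2,4,5)$; $(11,5),(9,7)$. - $(R_7:4R_3,(R_5:2R_3))$; $(1^2,2^4,6)$; $(11,5),(10,6)$. - $(R_7:3R_3,2R_5)$; $(1^2,2^3,4^2)$; $(14,2)$. - $(R_7:5R_3,(R_5:R_3))$;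 $(1,2^5,5)$; $(13,3),(11,5)$. - $(R_7:1+\nu_3:(R_5:R_3))$; $(2^6,4)$; $(16,0)$. - $(R_7:1+\nu_5^y:(R_5:R_3))$, $y\in\{1,2\}$; $(2^6,4)$; $(14,2)$. - $(R_7:1-\nu_3\nu_5^y:(R_5:R_3))$, $y\in\{1,2,3,4\}$; $(2^6,4)$; $(9,7)$. - $(R_7:1+\nu_5^y:R_2\oplus R_3,R_5)$, $y\in\{1,2\}$; $(2^5,3^2)$; $(11,5)$. - $(R_7:1+\nu_5^y:2R_5)$, $y\in\{1,2\}$; $(2^5,3^2)$; $(10,6)$.
   Context: Basic notions. For $n\in\mathbb{N}$, $\nu_n=e^{2\pi i/n}$. A sum of roots of unity (sorou) is an unordered finite nonempty list $h=(\omega_1,\dots,\omega_n)$ of roots of unity (repetitions allowed), written formally $h=\omega_1+\cdots+\omega_n$. Its terms are the $\omega_j$, its weight is $w(h)=n$, its value is the complex number $\mathrm{val}(h)=\sum_j\omega_j$, and its height is the maximum multiplicity with which a root of unity occurs in the list. $f+g$ denotes concatenation of lists, $zh=(z\omega_1,\dots,z\omega_n)$ is the rotation of $h$ by the root of unity $z$, and $f-g$ means $f+(-1)g$ (formal concatenation, no cancellation). A subsorou $g\prec h$ is a sublist (possibly empty); it is proper if $g\ne h$. A sorou vanishes if its value is $0$; it is minimal vanishing if it vanishes and no proper nonempty subsorou of it vanishes. The order of $h$ is the least common multiple of the orders of its terms; the relative order is the least common multiple of the orders of all ratios $\omega_i/\omega_j$ of its terms. A sorou of relative order $d$ can be rotated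 to have order $d$. It is known (Mann) that the relative order of a minimal vanishing sorou is a product $p_1p_2\cdots p_s$ of distinct primes $p_1<\cdots<p_s$; $p=p_s$ is called its top prime. Types. To each vanishing sorou one recursively associates its type (or types; a type need not be unique), invariant under rotation. (a) If a vanishing sorou is a sum of minimal vanishing sorou $v_1,\dots,v_k$ of types $T_1,\dots,T_k$, it has type $T_1\oplus\cdots\oplus T_k$. (b) A minimal vanishing sorou $h$ with relative order $p_1\cdots p_s$ and top prime $p=p_s$ can, after rotation, be written as $h=\sum_{j=0}^{p-1}\nu_p^j f_j$, where each $f_j$ is a sorou all of whose terms have order dividing $p_1\cdots p_{s-1}$, where $w(f_0)\le w(f_j)$ for all $j$, and where $1\prec f_0$. The weights $w(f_0),\dots,w(f_{p-1})$ arranged in increasing order form the weight partition of $h$. (c) If $f_j=f_0$ for all $j$, then $f_0=1$ and $h$ is said to have type $R_p$ (so up to rotation $h=1+\nu_p+\cdots+\nu_p^{p-1}$). (d) Otherwise let $\{j(1),\dots,j(n)\}$ be the nonempty set of $j\in\{1,\dots,p-1\}$ with $f_j\ne f_0$. If the vanishing sorou $f_0-f_{j(i)}$ has type $T_i$ for each $i$, then $h$ has type $(R_p:f_0:T_1,\dots,T_n)$, where the ordering of $T_1,\dots,T_n$ is irrelevant. If $f_0=1$ one writes $(R_p:T_1,\dots,T_n)$. An integer coefficient indicates repetition, e.g. $(R_7:3R_3,2R_5)=(R_7:R_3,R_3,R_3,R_5,R_5)$. Parity. The parity of a minimal vanishing sorou $h$ is the unordered pair of integers consisting of the number of terms of odd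 order and the number of terms of even order, computed after rotating $h$ so that its order equals its (squarefree) relative order; because rotations are allowed the pair is unordered. *)

theory Defs
  imports Complex_Main "HOL-Library.Multiset" "HOL-Library.Uprod"
    "HOL-Computational_Algebra.Primes"
begin

section \<open>Sums of roots of unity\<close>

definition nu :: "nat \<Rightarrow> complex" where
  "nu n = exp (2 * of_real pi * \<i> / of_nat n)"

definition root_of_unity :: "complex \<Rightarrow> bool" where
  "root_of_unity z \<longleftrightarrow> (\<exists>n>0. z ^ n = 1)"

definition root_order :: "complex \<Rightarrow> nat" where
  "root_order z = (LEAST n. n > 0 \<and> z ^ n = 1)"

text \<open>
  A sum of roots of unity (``sorou'') is an unordered formal sum, hence a nonempty multiset.
  Its weight is \<^const>\<open>size\<close>, its value is \<^const>\<open>sum_mset\<close>, the formal sum of two sorou is the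
  multiset sum (without cancellation), and subsorou are submultisets.
\<close>

definition sorou :: "complex multiset \<Rightarrow> bool" where
  "sorou h \<longleftrightarrow> h \<noteq> {#} \<and> (\<forall>w\<in>#h. root_of_unity w)"

definition height :: "complex multiset \<Rightarrow> nat" where
  "height h = Max (count h ` set_mset h)"

definition rot :: "complex \<Rightarrow> complex multiset \<Rightarrow> complex multiset" where
  "rot z h = image_mset (\<lambda>w. z * w) h"

definition vanishing :: "complex multiset \<Rightarrow> bool" where
  "vanishing h \<longleftrightarrow> sorou h \<and> sum_mset h = 0"

definition minimal_vanishing :: "complex multiset \<Rightarrow> bool" where
  "minimal_vanishing h \<longleftrightarrow>
     vanishing h \<and> (\<forall>g. g \<subseteq># h \<and> g \<noteq> h \<and> g \<noteq> {#} \<longrightarrow> \<not> vanishing g)"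

definition sorou_order :: "complex multiset \<Rightarrow> nat" where
  "sorou_order h = Lcm (root_order ` set_mset h)"

definition relative_order :: "complex multiset \<Rightarrow> nat" where
  "relative_order h = Lcm {root_order (v / w) | v w. v \<in># h \<and> w \<in># h}"

definition top_prime :: "complex multiset \<Rightarrow> nat" where
  "top_prime h = Max {p. prime p \<and> p dvd relative_order h}"


section \<open>Types\<close>

text \<open>
  \<open>top_decomp h p f\<close>: after a rotation, \<open>h\<close> is the sum of the \<open>nu p ^ j\<close>-rotations of the \<open>f j\<close>,
  normalised so that \<open>f 0\<close> has least weight and contains the term 1. The order of the terms
  of the \<open>f j\<close> divides the product of the primes other than \<open>p\<close> that divide the relative order;
  as the relative order of a minimal vanishing sorou is squarefree (Mann), that product is
  \<open>relative_order h div p\<close>.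
\<close>

definition top_decomp ::
    "complex multiset \<Rightarrow> nat \<Rightarrow> (nat \<Rightarrow> complex multiset) \<Rightarrow> bool" where
  "top_decomp h p f \<longleftrightarrow>
     p = top_prime h \<and>
     (\<exists>z. root_of_unity z \<and> rot z h = (\<Sum>j<p. rot (nu p ^ j) (f j))) \<and>
     (\<forall>j<p. sorou (f j) \<and> (\<forall>w\<in>#f j. root_order w dvd relative_order h div p)) \<and>
     (\<forall>j<p. size (f 0) \<le> size (f j)) \<and>
     1 \<in># f 0"

definition has_weight_partition :: "complex multiset \<Rightarrow> nat list \<Rightarrow> bool" where
  "has_weight_partition h W \<longleftrightarrow>
     (\<exists>p f. top_decomp h p f \<and> W = sort (map (\<lambda>j. size (f j)) [0..<p]))"

text \<open>
  \<open>Rp p\<close> is the type \<open>R\<^sub>p\<close>, and \<open>Comp p f\<^sub>0 {#T\<^sub>1, \<dots>, T\<^sub>n#}\<close> is the type \<open>(R\<^sub>p : f\<^sub>0 : T\<^sub>1, \<dots>, T\<^sub>n)\<close>.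
  These are types of minimal vanishing sorou. The type \<open>T\<^sub>1 \<oplus> \<dots> \<oplus> T\<^sub>k\<close> of an arbitrary vanishing
  sorou is the multiset \<open>{#T\<^sub>1, \<dots>, T\<^sub>k#}\<close>; the type \<open>T\<close> of a minimal one, when it is regarded
  merely as a vanishing sorou, is the singleton \<open>{#T#}\<close>.
\<close>

datatype mv_type = Rp nat | Comp nat "complex multiset" "mv_type multiset multiset"

inductive has_type :: "complex multiset \<Rightarrow> mv_type \<Rightarrow> bool"
  and has_sum_type :: "complex multiset \<Rightarrow> mv_type multiset \<Rightarrow> bool" where
  Rp: "minimal_vanishing h \<Longrightarrow> top_decomp h p f \<Longrightarrow> \<forall>j<p. f j = f 0 \<Longrightarrow> has_type h (Rp p)"
| Comp: "minimal_vanishing h \<Longrightarrow> top_decomp h p f \<Longrightarrow> J = {j\<in>{1..<p}. f j \<noteq> f 0} \<Longrightarrow> J \<noteq> {} \<Longrightarrow>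
    \<forall>j\<in>J. has_sum_type (f 0 + rot (-1) (f j)) (T j) \<Longrightarrow>
    has_type h (Comp p (f 0) (image_mset T (mset_set J)))"
| single: "has_type v T \<Longrightarrow> has_sum_type v {#T#}"
| add: "has_type v T \<Longrightarrow> has_sum_type h Ts \<Longrightarrow> has_sum_type (v + h) (add_mset T Ts)"

fun leading_index :: "mv_type \<Rightarrow> nat" where
  "leading_index (Rp p) = p"
| "leading_index (Comp p f0 Ts) = p"


section \<open>Parity\<close>

definition has_parity :: "complex multiset \<Rightarrow> nat uprod \<Rightarrow> bool" where
  "has_parity h P \<longleftrightarrow>
     (\<exists>z. root_of_unity z \<and> sorou_order (rot z h) = relative_order h \<and>
        P = Upair (size {#w \<in># rot z h. odd (root_order w)#})
                  (size {#w \<in># rot z h. even (root_order w)#}))"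


section \<open>The classification table\<close>

text \<open>\<open>RC p Ts\<close> is \<open>(R\<^sub>p : Ts)\<close>, i.e. the case \<open>f\<^sub>0 = 1\<close>, and \<open>copies k T\<close> is \<open>kT\<close> inside a type.\<close>

abbreviation RC :: "nat \<Rightarrow> mv_type multiset multiset \<Rightarrow> mv_type" where
  "RC p Ts \<equiv> Comp p {#1#} Ts"

abbreviation copies :: "nat \<Rightarrow> mv_type \<Rightarrow> mv_type multiset multiset" where
  "copies k T \<equiv> replicate_mset k {#T#}"

text \<open>The entries (type, weight partition, possible parities) for each weight.\<close>

definition type_table :: "nat \<Rightarrow> (mv_type \<times> nat list \<times> nat uprod set) set" where
  "type_table = (\<lambda>_. {})(
    2 := {(Rp 2, replicate 2 1, {Upair 1 1})},
    3 := {(Rp 3, replicate 3 1, {Upair 3 0})},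
    5 := {(Rp 5, replicate 5 1, {Upair 5 0})},
    6 := {(RC 5 (copies 1 (Rp 3)), replicate 4 1 @ [2], {Upair 4 2})},
    7 := {(Rp 7, replicate 7 1, {Upair 7 0}),
      (RC 5 (copies 2 (Rp 3)), replicate 3 1 @ replicate 2 2, {Upair 4 3})},
    8 := {(RC 7 (copies 1 (Rp 3)), replicate 6 1 @ [2], {Upair 6 2}),
      (RC 5 (copies 3 (Rp 3)), replicate 2 1 @ replicate 3 2, {Upair 6 2})},
    9 := {(RC 7 (copies 2 (Rp 3)), replicate 5 1 @ replicate 2 2, {Upair 5 4}),
      (RC 5 (copies 4 (Rp 3)), [1] @ replicate 4 2, {Upair 8 1})},
    10 := {(RC 7 (copies 1 (Rp 5)), replicate 6 1 @ [4], {Upair 6 4}),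
      (RC 7 (copies 3 (Rp 3)), replicate 4 1 @ replicate 3 2, {Upair 6 4})},
    11 := {(Rp 11, replicate 11 1, {Upair 11 0}),
      (RC 7 (copies 1 (RC 5 (copies 1 (Rp 3)))), replicate 6 1 @ [5], {Upair 10 1, Upair 8 3}),
      (RC 7 (copies 1 (Rp 3) + copies 1 (Rp 5)), replicate 5 1 @ [2, 4], {Upair 6 5}),
      (RC 7 (copies 4 (Rp 3)), replicate 3 1 @ replicate 4 2, {Upair 8 3})},
    12 := {(RC 11 (copies 1 (Rp 3)), replicate 10 1 @ [2], {Upair 10 2}),
      (RC 7 (copies 1 (RC 5 (copies 2 (Rp 3)))), replicate 6 1 @ [6], {Upair 10 2, Upair 9 3}),
      (RC 7 (copies 1 (Rp 3) + copies 1 (RC 5 (copies 1 (Rp 3)))),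
        replicate 5 1 @ [2, 5], {Upair 9 3, Upair 7 5}),
      (RC 7 (copies 2 (Rp 3) + copies 1 (Rp 5)),
        replicate 4 1 @ replicate 2 2 @ [4], {Upair 8 4}),
      (RC 7 (copies 5 (Rp 3)), replicate 2 1 @ replicate 5 2, {Upair 10 2})},
    13 := {(Rp 13, replicate 13 1, {Upair 13 0}),
      (RC 11 (copies 2 (Rp 3)), replicate 9 1 @ replicate 2 2, {Upair 9 4}),
      (RC 7 (copies 1 (RC 5 (copies 3 (Rp 3)))), replicate 6 1 @ [7], {Upair 12 1, Upair 8 5}),
      (RC 7 (copies 1 (Rp 3) + copies 1 (RC 5 (copies 2 (Rp 3)))),
        replicate 5 1 @ [2, 6], {Upair 9 4, Upair 8 5}),
      (RC 7 (copies 2 (Rp 5)), replicate 5 1 @ replicate 2 4, {Upair 8 5}),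
      (RC 7 (copies 2 (Rp 3) + copies 1 (RC 5 (copies 1 (Rp 3)))),
        replicate 4 1 @ replicate 2 2 @ [5], {Upair 8 5, Upair 7 6}),
      (RC 7 (copies 3 (Rp 3) + copies 1 (Rp 5)),
        replicate 3 1 @ replicate 3 2 @ [4], {Upair 10 3}),
      (RC 7 (copies 6 (Rp 3)), [1] @ replicate 6 2, {Upair 12 1})},
    14 := {(RC 13 (copies 1 (Rp 3)), replicate 12 1 @ [2], {Upair 12 2}),
      (RC 11 (copies 1 (Rp 5)), replicate 10 1 @ [4], {Upair 10 4}),
      (RC 11 (copies 3 (Rp 3)), replicate 8 1 @ replicate 3 2, {Upair 8 6}),
      (RC 7 (copies 1 (RC 5 (copies 4 (Rp 3)))), replicate 6 1 @ [8], {Upair 14 0, Upair 7 7}),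
      (RC 7 (copies 1 (Rp 3) + copies 1 (RC 5 (copies 3 (Rp 3)))),
        replicate 5 1 @ [2, 7], {Upair 11 3, Upair 7 7}),
      (RC 7 (copies 1 (Rp 5) + copies 1 (RC 5 (copies 1 (Rp 3)))),
        replicate 5 1 @ [4, 5], {Upair 9 5, Upair 7 7}),
      (RC 7 (copies 2 (Rp 3) + copies 1 (RC 5 (copies 2 (Rp 3)))),
        replicate 4 1 @ replicate 2 2 @ [6], {Upair 8 6, Upair 7 7}),
      (RC 7 (copies 1 (Rp 3) + copies 2 (Rp 5)),
        replicate 4 1 @ [2] @ replicate 2 4, {Upair 10 4}),
      (RC 7 (copies 3 (Rp 3) + copies 1 (RC 5 (copies 1 (Rp 3)))),
        replicate 3 1 @ replicate 3 2 @ [5], {Upair 9 5, Upair 7 7}),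
      (RC 7 (copies 4 (Rp 3) + copies 1 (Rp 5)),
        replicate 2 1 @ replicate 4 2 @ [4], {Upair 12 2})},
    15 := {(RC 13 (copies 2 (Rp 3)), replicate 11 1 @ replicate 2 2, {Upair 11 4}),
      (RC 11 (copies 1 (RC 5 (copies 1 (Rp 3)))), replicate 10 1 @ [5], {Upair 14 1, Upair 12 3}),
      (RC 11 (copies 1 (Rp 3) + copies 1 (Rp 5)), replicate 9 1 @ [2, 4], {Upair 9 6}),
      (RC 11 (copies 4 (Rp 3)), replicate 7 1 @ replicate 4 2, {Upair 8 7}),
      (RC 7 (copies 1 (Rp 3) + copies 1 (RC 5 (copies 4 (Rp 3)))),
        replicate 5 1 @ [2, 8], {Upair 13 2, Upair 9 6}),
      (RC 7 (copies 1 (Rp 5) + copies 1 (RC 5 (copies 2 (Rp 3)))),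
        replicate 5 1 @ [4, 6], {Upair 9 6, Upair 8 7}),
      (RC 7 (copies 2 (RC 5 (copies 1 (Rp 3)))),
        replicate 5 1 @ replicate 2 5, {Upair 13 2, Upair 11 4, Upair 9 6}),
      (RC 7 (copies 2 (Rp 3) + copies 1 (RC 5 (copies 3 (Rp 3)))),
        replicate 4 1 @ replicate 2 2 @ [7], {Upair 10 5, Upair 9 6}),
      (RC 7 (copies 1 (Rp 3) + copies 1 (Rp 5) + copies 1 (RC 5 (copies 1 (Rp 3)))),
        replicate 4 1 @ [2, 4, 5], {Upair 9 6, Upair 8 7}),
      (RC 7 (copies 3 (Rp 3) + copies 1 (RC 5 (copies 2 (Rp 3)))),
        replicate 3 1 @ replicate 3 2 @ [6], {Upair 9 6, Upair 8 7}),
      (RC 7 (copies 2 (Rp 3) + copies 2 (Rp 5)),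
        replicate 3 1 @ replicate 2 2 @ replicate 2 4, {Upair 12 3}),
      (RC 7 (copies 4 (Rp 3) + copies 1 (RC 5 (copies 1 (Rp 3)))),
        replicate 2 1 @ replicate 4 2 @ [5], {Upair 11 4, Upair 9 6}),
      (RC 7 (copies 5 (Rp 3) + copies 1 (Rp 5)), [1] @ replicate 5 2 @ [4], {Upair 14 1})}
      \<union> {(Comp 7 {#1, nu 5 ^ y#} (copies 1 (Rp 5)),
        replicate 6 2 @ [3], {Upair 12 3}) | y. y \<in> {1, 2}},
    16 := {(RC 13 (copies 1 (Rp 5)), replicate 12 1 @ [4], {Upair 12 4}),
      (RC 13 (copies 3 (Rp 3)), replicate 10 1 @ replicate 3 2, {Upair 10 6}),
      (RC 11 (copies 1 (Rp 7)), replicate 10 1 @ [6], {Upair 10 6}),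
      (RC 11 (copies 1 (RC 5 (copies 2 (Rp 3)))), replicate 10 1 @ [6], {Upair 14 2, Upair 13 3}),
      (RC 11 (copies 1 (Rp 3) + copies 1 (RC 5 (copies 1 (Rp 3)))),
        replicate 9 1 @ [2, 5], {Upair 13 3, Upair 11 5}),
      (RC 11 (copies 2 (Rp 3) + copies 1 (Rp 5)),
        replicate 8 1 @ replicate 2 2 @ [4], {Upair 8 8}),
      (RC 11 (copies 5 (Rp 3)), replicate 6 1 @ replicate 5 2, {Upair 10 6}),
      (RC 7 (copies 1 (Rp 5) + copies 1 (RC 5 (copies 3 (Rp 3)))),
        replicate 5 1 @ [4, 7], {Upair 11 5, Upair 9 7}),
      (RC 7 (copies 1 (RC 5 (copies 1 (Rp 3))) + copies 1 (RC 5 (copies 2 (Rp 3)))),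
        replicate 5 1 @ [5, 6], {Upair 13 3, Upair 12 4, Upair 11 5, Upair 10 6}),
      (RC 7 (copies 2 (Rp 3) + copies 1 (RC 5 (copies 4 (Rp 3)))),
        replicate 4 1 @ replicate 2 2 @ [8], {Upair 12 4, Upair 11 5}),
      (RC 7 (copies 1 (Rp 3) + copies 1 (Rp 5) + copies 1 (RC 5 (copies 2 (Rp 3)))),
        replicate 4 1 @ [2, 4, 6], {Upair 9 7, Upair 8 8}),
      (RC 7 (copies 1 (Rp 3) + copies 2 (RC 5 (copies 1 (Rp 3)))),
        replicate 4 1 @ [2] @ replicate 2 5, {Upair 12 4, Upair 10 6, Upair 8 8}),
      (RC 7 (copies 3 (Rp 5)), replicate 4 1 @ replicate 3 4, {Upair 12 4}),
      (RC 7 (copies 3 (Rp 3) + copies 1 (RC 5 (copies 3 (Rp 3)))),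
        replicate 3 1 @ replicate 3 2 @ [7], {Upair 11 5, Upair 9 7}),
      (RC 7 (copies 2 (Rp 3) + copies 1 (Rp 5) + copies 1 (RC 5 (copies 1 (Rp 3)))),
        replicate 3 1 @ replicate 2 2 @ [4, 5], {Upair 11 5, Upair 9 7}),
      (RC 7 (copies 4 (Rp 3) + copies 1 (RC 5 (copies 2 (Rp 3)))),
        replicate 2 1 @ replicate 4 2 @ [6], {Upair 11 5, Upair 10 6}),
      (RC 7 (copies 3 (Rp 3) + copies 2 (Rp 5)),
        replicate 2 1 @ replicate 3 2 @ replicate 2 4, {Upair 14 2}),
      (RC 7 (copies 5 (Rp 3) + copies 1 (RC 5 (copies 1 (Rp 3)))),
        [1] @ replicate 5 2 @ [5], {Upair 13 3, Upair 11 5}),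
      (Comp 7 {#1, nu 3#} (copies 1 (RC 5 (copies 1 (Rp 3)))), replicate 6 2 @ [4], {Upair 16 0})}
      \<union> {(Comp 7 {#1, nu 5 ^ y#} (copies 1 (RC 5 (copies 1 (Rp 3)))),
        replicate 6 2 @ [4], {Upair 14 2}) | y. y \<in> {1, 2}}
      \<union> {(Comp 7 {#1, - (nu 3 * nu 5 ^ y)#} (copies 1 (RC 5 (copies 1 (Rp 3)))),
        replicate 6 2 @ [4], {Upair 9 7}) | y. y \<in> {1, 2, 3, 4}}
      \<union> {(Comp 7 {#1, nu 5 ^ y#} ({#{#Rp 2, Rp 3#}#} + copies 1 (Rp 5)),
        replicate 5 2 @ replicate 2 3, {Upair 11 5}) | y. y \<in> {1, 2}}
      \<union> {(Comp 7 {#1, nu 5 ^ y#} (copies 2 (Rp 5)),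
        replicate 5 2 @ replicate 2 3, {Upair 10 6}) | y. y \<in> {1, 2}})"

end

theory Submission
  imports Defs "HOL-Computational_Algebra.Computational_Algebra" "HOL-Number_Theory.Cong"
begin

text \<open>
  The conjugations \<open>w \<mapsto> w\<^sup>k\<close> with \<open>k\<close> prime to \<open>n\<close> preserve the vanishing of sums of \<open>n\<close>-th roots
  of unity (\<open>sum_mset_conj\<close>). Averaging over suitable conjugations has two consequences for a
  minimal vanishing sum \<open>h\<close>: its relative order is squarefree (\<open>squarefree_relative_order\<close>), and,
  if \<open>h\<close> is written as \<open>f\<^sub>0 + \<nu>\<^sub>p f\<^sub>1 + \<dots> + \<nu>\<^sub>p\<^sup>p\<^sup>-\<^sup>1 f\<^sub>p\<^sub>-\<^sub>1\<close> along its top prime \<open>p\<close>, all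
  components \<open>f\<^sub>j\<close> have the same value (\<open>equal_components\<close>). Minimality then means that one cannot
  choose subsums of the components with a common value, other than the empty ones or the whole
  components (\<open>equal_subsums_trivial\<close>, with the converse \<open>minimal_vanishing_of_components\<close>).

  This determines the possible components. If the base \<open>f\<^sub>0\<close> is the single term \<open>1\<close>, every
  difference \<open>1 - f\<^sub>j\<close> with \<open>j \<noteq> 0\<close> is again a minimal vanishing sum, for \<open>p > 2\<close> with a smaller
  top prime; this gives a recursion (\<open>unit_base_difference\<close>, \<open>RC_of_unit_base\<close>). For \<open>p \<le> 5\<close> the
  components consist of sixth roots of unity, and comparing their coordinates leaves only \<open>R\<^sub>2\<close>,
  \<open>R\<^sub>3\<close>, \<open>R\<^sub>5\<close> and \<open>(R\<^sub>5 : k R\<^sub>3)\<close> (\<open>common_sixth_root\<close>, \<open>classify_small\<close>). For \<open>p \<ge> 7\<close> and weight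
  at most \<open>16\<close>, the base, a component of least weight, is a single term or, for \<open>p = 7\<close> only, a
  sum of two terms. In the first case the weight bounds the multiplicities of the types of the
  differences, and a finite search compares them with the table (\<open>unit_base_listed\<close>). In the
  second case at most two components exceed the base, by at most two terms in all, and at least
  one of the differences is minimal, hence \<open>R\<^sub>5\<close> or \<open>(R\<^sub>5 : R\<^sub>3)\<close> (\<open>pair_base\<close>). The same analysis
  of the components shows that no term is repeated.

  Conversely, components with the prescribed differences from the base can be put together to a
  minimal sum, if one of the differences is minimal and no component contains a vanishing part
  (\<open>realise_Comp\<close>). The weights of the components are invariants of the sum
  (\<open>component_sizes_unique\<close>) and follow from the type. The parity depends only on the number of
  terms of odd order after a rotation into the group generated by \<open>-1\<close> and the roots of unity of
  odd order (\<open>has_parity_iff\<close>). For odd \<open>p\<close> that number is the sum of the numbers for the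
  components; these can be chosen independently of each other, which gives all parities of a type
  over the base \<open>1\<close> (\<open>type_odds_RC\<close>), while over a base of two terms only one parity is possible
  (\<open>valid_entry_pair\<close>).
\<close>

section \<open>Conjugating integer relations between roots of unity\<close>

definition int_eval :: "int poly \<Rightarrow> complex \<Rightarrow> complex" where
  "int_eval P z = poly (map_poly of_int P) z"

lemma int_eval_0 [simp]: "int_eval 0 z = 0"
  by (simp add: int_eval_def)

lemma int_eval_pCons [simp]: "int_eval (pCons a P) z = of_int a + z * int_eval P z"
  by (simp add: int_eval_def map_poly_pCons)

lemma int_eval_1 [simp]: "int_eval 1 z = 1"
  by (simp add: one_pCons)

lemma int_eval_add [simp]: "int_eval (P + Q) z = int_eval P z + int_eval Q z"
proof -
  have "map_poly of_int (P + Q) = (map_poly of_int P + map_poly of_int Q :: complex poly)"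
    by (rule poly_eqI) (simp add: coeff_map_poly)
  then show ?thesis by (simp add: int_eval_def)
qed

lemma int_eval_smult [simp]: "int_eval (smult c P) z = of_int c * int_eval P z"
  by (simp add: int_eval_def map_poly_smult)

lemma int_eval_mult [simp]: "int_eval (P * Q) z = int_eval P z * int_eval Q z"
  by (induction P) (simp_all add: algebra_simps)

lemma int_eval_minus [simp]: "int_eval (- P) z = - int_eval P z"
proof -
  have "int_eval (smult (- 1) P) z = - int_eval P z" by (simp only: int_eval_smult) simp
  then show ?thesis by simp
qed

lemma int_eval_diff [simp]: "int_eval (P - Q) z = int_eval P z - int_eval Q z"
  using int_eval_add[of P "- Q" z] by simp

lemma int_eval_power [simp]: "int_eval (P ^ n) z = int_eval P z ^ n"
  by (induction n) simp_all

lemma int_eval_monom [simp]: "int_eval (monom c n) z = of_int c * z ^ n"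
  by (simp add: int_eval_def map_poly_monom poly_monom)

lemma int_eval_sum_mset [simp]: "int_eval (\<Sum>w\<in>#g. P w) z = (\<Sum>w\<in>#g. int_eval (P w) z)"
  by (induction g) simp_all

text \<open>
  By Gauss's lemma the content of the cofactor is a multiple of \<open>a\<close>, so that \<open>a\<close> can be cancelled.
\<close>
lemma primitive_dvd_smult_int:
  fixes f P :: "int poly"
  assumes "content f = 1" and "a \<noteq> 0" and "f dvd smult a P"
  shows "f dvd P"
proof -
  obtain q where q: "smult a P = f * q" using assms(3) by (elim dvdE)
  have "content q = normalize a * content P"
    using arg_cong[OF q, of content] assms(1) by (simp add: content_mult)
  then have "[:a:] dvd q"
    by (simp add: const_poly_dvd_iff_dvd_content)
  then obtain q' where "q = [:a:] * q'" by (elim dvdE)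
  then have "smult a P = smult a (f * q')" using q by simp
  then have "P = f * q'" using assms(2) by (metis smult_cancel mult_smult_right smult_eq_iff)
  then show ?thesis by simp
qed

text \<open>
  The polynomial is the primitive part of a nonzero one of least degree with the root \<open>z\<close>.
  Pseudo-division shows that it divides a constant multiple of \<open>P\<close>, and primitivity removes the
  constant, so the divisibility holds over \<open>\<int>\<close> and not merely over \<open>\<rat>\<close>.
\<close>
lemma primitive_minimal_polynomial:
  fixes z :: complex and P\<^sub>0 :: "int poly"
  assumes "P\<^sub>0 \<noteq> 0" and "int_eval P\<^sub>0 z = 0"
  obtains f where "content f = 1" and "int_eval f z = 0"
    and "\<And>P. int_eval P z = 0 \<Longrightarrow> f dvd P"
proof -
  define r where "r = arg_min degree (\<lambda>P. P \<noteq> 0 \<and> int_eval P z = 0)"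
  have r: "r \<noteq> 0" "int_eval r z = 0"
    using arg_min_natI[of "\<lambda>P. P \<noteq> 0 \<and> int_eval P z = 0" P\<^sub>0 degree] assms
    by (auto simp: r_def)
  have least: "degree r \<le> degree P" if "P \<noteq> 0" "int_eval P z = 0" for P
    unfolding r_def by (rule arg_min_nat_le) (use that in auto)
  define f where "f = primitive_part r"
  have rf: "r = smult (content r) f" by (simp add: f_def)
  have "int_eval r z = of_int (content r) * int_eval f z"
    by (subst rf) simp
  then have f0: "int_eval f z = 0" using r by simp
  have fne: "f \<noteq> 0" using r by (simp add: f_def)
  have deg: "degree f = degree r" by (simp add: f_def)
  have "f dvd P" if P: "int_eval P z = 0" for P
  proof -
    obtain q s where qs: "pseudo_divmod P f = (q, s)" by fastforce
    define a where "a = lead_coeff f ^ (Suc (degree P) - degree f)"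
    have *: "smult a P = f * q + s" "s = 0 \<or> degree s < degree f"
      using pseudo_divmod[OF fne qs] by (auto simp: a_def)
    have "int_eval (smult a P) z = 0" using P by simp
    then have "int_eval s z = 0" using f0 by (simp add: *(1))
    then have "s = 0" using *(2) least[of s] deg by force
    then have "f dvd smult a P" using * by simp
    moreover have "a \<noteq> 0" using fne by (simp add: a_def)
    moreover have "content f = 1" using r by (simp add: f_def)
    ultimately show ?thesis using primitive_dvd_smult_int by blast
  qed
  moreover have "content f = 1" using r by (simp add: f_def)
  ultimately show ?thesis using f0 that by blast
qed

lemma freshman_dream:
  fixes a b :: "'a::comm_ring_1"
  assumes "prime q"
  shows "\<exists>c. (a + b) ^ q = a ^ q + b ^ q + of_nat q * c"
proof -
  have q: "q > 0" using assms prime_gt_0_nat by blast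
  have "(a + b) ^ q = (\<Sum>k\<le>q. of_nat (q choose k) * a ^ k * b ^ (q - k))"
    by (rule binomial_ring)
  also have "{..q} = insert 0 (insert q {0<..<q})" using q by auto
  also have "(\<Sum>k\<in>insert 0 (insert q {0<..<q}). of_nat (q choose k) * a ^ k * b ^ (q - k)) =
      a ^ q + b ^ q + (\<Sum>k\<in>{0<..<q}. of_nat (q choose k) * a ^ k * b ^ (q - k))"
    using q by (simp add: algebra_simps)
  also have "(\<Sum>k\<in>{0<..<q}. of_nat (q choose k) * a ^ k * b ^ (q - k)) =
      (\<Sum>k\<in>{0<..<q}. of_nat q * (of_nat ((q choose k) div q) * a ^ k * b ^ (q - k)))"
  proof (rule sum.cong[OF refl])
    fix k assume "k \<in> {0<..<q}"
    then have "q dvd (q choose k)" using assms by (intro dvd_choose_prime) auto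
    then have "of_nat (q choose k) = (of_nat q * of_nat ((q choose k) div q) :: 'a)"
      by (metis dvd_mult_div_cancel of_nat_mult)
    then show "of_nat (q choose k) * a ^ k * b ^ (q - k) =
        of_nat q * (of_nat ((q choose k) div q) * a ^ k * b ^ (q - k))"
      by (simp add: mult.assoc)
  qed
  finally show ?thesis by (metis sum_distrib_left)
qed

lemma int_power_prime:
  assumes "prime q"
  shows "\<exists>c. (a::int) ^ q = a + int q * c"
proof -
  have q: "q > 0" using assms prime_gt_0_nat by blast
  have nat: "\<exists>c. (int n) ^ q = int n + int q * c" for n
  proof (induction n)
    case 0 then show ?case using q by (intro exI[of _ 0]) (simp add: power_0_left)
  next
    case (Suc n)
    then obtain c where c: "int n ^ q = int n + int q * c" by blast
    obtain d where "(int n + 1) ^ q = int n ^ q + 1 ^ q + int q * d"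
      using freshman_dream[OF assms, of "int n" 1] by auto
    then show ?case using c by (intro exI[of _ "c + d"]) (simp add: algebra_simps)
  qed
  show ?thesis
  proof (cases "a \<ge> 0")
    case True then show ?thesis using nat[of "nat a"] by simp
  next
    case False
    then obtain c where c: "(- a) ^ q = - a + int q * c" using nat[of "nat (- a)"] by auto
    obtain d where "(a + - a) ^ q = a ^ q + (- a) ^ q + int q * d"
      using freshman_dream[OF assms, of a "- a"] by auto
    then have "a ^ q = a + int q * (- c - d)" using c q by (simp add: power_0_left algebra_simps)
    then show ?thesis by blast
  qed
qed

text \<open>
  The Frobenius congruence \<open>g(x\<^sup>q) \<equiv> g(x)\<^sup>q\<close>, built up coefficient by coefficient from the
  freshman's dream and Fermat's little theorem.
\<close>
lemma int_poly_power_prime: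
  fixes g :: "int poly"
  assumes "prime q"
  shows "\<exists>r. pcompose g (monom 1 q) = g ^ q + of_nat q * r"
proof (induction g)
  case 0
  have "q > 0" using assms prime_gt_0_nat by blast
  then show ?case by (intro exI[of _ 0]) (simp add: power_0_left)
next
  case (pCons a g)
  obtain r where r: "pcompose g (monom 1 q) = g ^ q + of_nat q * r" using pCons by blast
  obtain c where c: "a ^ q = a + int q * c" using int_power_prime[OF assms] by blast
  have split: "pCons a g = [:a:] + monom 1 1 * g"
    by (simp add: monom_altdef)
  obtain d where d: "([:a:] + monom 1 1 * g) ^ q =
      [:a:] ^ q + (monom 1 1 * g) ^ q + of_nat q * d"
    using freshman_dream[OF assms] by blast
  have "[:a:] ^ q = [:a:] + of_nat q * [:c:]"
    by (simp add: c poly_const_pow of_nat_poly)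
  then have "(pCons a g) ^ q = [:a:] + of_nat q * [:c:] + monom 1 q * g ^ q + of_nat q * d"
    by (simp only: split d power_mult_distrib monom_power) simp
  then have "pcompose (pCons a g) (monom 1 q) = (pCons a g) ^ q + of_nat q * (monom 1 q * r - [:c:] - d)"
    by (simp add: pcompose_pCons r algebra_simps)
  then show ?case by blast
qed

text \<open>
  This is the irreducibility of the cyclotomic polynomials in disguise. Let \<open>f\<close> be the minimal
  polynomial of \<open>z\<close> and \<open>x\<^sup>n - 1 = f g\<close>. If \<open>z\<^sup>q\<close> were not a root of \<open>f\<close>, it would be a root of \<open>g\<close>,
  so \<open>g(z)\<^sup>q \<equiv> g(z\<^sup>q) = 0\<close> modulo \<open>q\<close> in \<open>\<int>[z]\<close>. But \<open>g(z)\<close> divides the derivative \<open>n z\<^sup>n\<^sup>-\<^sup>1\<close> of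
  \<open>x\<^sup>n - 1\<close> at \<open>z\<close>, so \<open>q\<close> would divide \<open>n\<^sup>q\<close> in \<open>\<int>[z]\<close> and hence in \<open>\<int>\<close>.
\<close>
lemma int_eval_conj_prime:
  assumes n: "n > 0" and z: "z ^ n = 1" and q: "prime q" "\<not> q dvd n"
    and P: "int_eval P z = 0"
  shows "int_eval P (z ^ q) = 0"
proof -
  define X :: "int poly" where "X = monom 1 n - 1"
  have "degree X = degree (monom (1::int) n + - 1)" by (simp add: X_def)
  also have "\<dots> = n" using n by (subst degree_add_eq_left) (simp_all add: degree_monom_eq)
  finally have "degree X = n" .
  then have X0: "X \<noteq> 0" using n by auto
  have zX: "int_eval X z = 0" by (simp add: X_def z)
  obtain f where f: "content f = 1" "int_eval f z = 0"
    and fdvd: "\<And>P. int_eval P z = 0 \<Longrightarrow> f dvd P"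
    using primitive_minimal_polynomial[OF X0 zX] by blast
  obtain g where g: "X = f * g" using fdvd[OF zX] by (elim dvdE)
  have "lead_coeff X = 1"
    unfolding \<open>degree X = n\<close> using n by (simp add: X_def)
  \<comment> \<open>So \<open>f\<close> is monic up to sign, and division with remainder by \<open>f\<close> is possible over the integers.\<close>
  then have "lead_coeff f * lead_coeff g = 1" by (simp add: g lead_coeff_mult)
  then have lf: "lead_coeff f * lead_coeff f = 1"
    by (metis mult_cancel_left1 mult_minus1_right zmult_eq_1_iff minus_mult_minus)
  have df: "degree f > 0"
  proof (rule ccontr)
    assume "\<not> degree f > 0"
    then obtain c where "f = [:c:]" using degree_eq_zeroE by blast
    then show False using f by auto
  qed
  have fne: "f \<noteq> 0" using df by auto
  have "int_eval f (z ^ q) = 0"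
  proof (rule ccontr)
    assume "int_eval f (z ^ q) \<noteq> 0"
    moreover have "int_eval X (z ^ q) = 0"
      by (simp add: X_def) (metis z power_mult mult.commute power_one)
    ultimately have g0: "int_eval g (z ^ q) = 0" by (simp add: g)
    obtain r where r: "pcompose g (monom 1 q) = g ^ q + of_nat q * r"
      using int_poly_power_prime[OF q(1)] by blast
    have comp: "int_eval (pcompose g (monom 1 q)) z = int_eval g (z ^ q)" for g
      by (induction g) (simp_all add: pcompose_pCons)
    have ofn: "int_eval (of_nat m) w = of_nat m" for m w
      by (induction m) simp_all
    have gq: "int_eval g z ^ q = - (of_nat q * int_eval r z)"
      using arg_cong[OF r, of "\<lambda>P. int_eval P z"] g0 by (simp add: comp ofn eq_neg_iff_add_eq_0)
    have "pderiv X = pderiv f * g + f * pderiv g" by (simp add: g pderiv_mult algebra_simps)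
    then have "int_eval (pderiv X) z = int_eval (pderiv f) z * int_eval g z" using f by simp
    moreover have "pderiv X = monom (int n) (n - 1)" by (simp add: X_def pderiv_diff pderiv_monom)
    ultimately have "of_nat n * z ^ (n - 1) = int_eval (pderiv f) z * int_eval g z" by simp
    then have "z * (of_nat n * z ^ (n - 1)) = z * (int_eval (pderiv f) z * int_eval g z)"
      by (rule arg_cong)
    moreover have "z * (of_nat n * z ^ (n - 1)) = of_nat n"
      using z n by (metis mult.left_commute mult.right_neutral power_eq_if not_gr_zero)
    ultimately have "of_nat n = z * int_eval (pderiv f) z * int_eval g z"
      by (simp only: mult.assoc)
    then have "(of_nat n :: complex) ^ q = (z * int_eval (pderiv f) z * int_eval g z) ^ q" by simp
    then have nq: "(of_nat n :: complex) ^ q =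
        - (of_nat q * ((z * int_eval (pderiv f) z) ^ q * int_eval r z))"
      by (simp add: power_mult_distrib gq)
    \<comment> \<open>Reducing the cofactor \<open>s\<close> of \<open>q\<close> modulo \<open>f\<close> makes the degree of the relation smaller than that of
      \<open>f\<close>, so that it holds between polynomials.\<close>
    define s where "s = (pCons 0 (pderiv f)) ^ q * r"
    obtain u v where uv: "s = f * u + v" "degree v < degree f"
    proof -
      obtain u v where "pseudo_divmod s f = (u, v)" by fastforce
      moreover define k where "k = Suc (degree s) - degree f"
      ultimately have *: "smult (lead_coeff f ^ k) s = f * u + v" "v = 0 \<or> degree v < degree f"
        using pseudo_divmod[of f s u v] fne by auto
      have one: "lead_coeff f ^ k * lead_coeff f ^ k = 1"
        by (metis lf power_mult_distrib power_one)
      have "s = smult (lead_coeff f ^ k) (f * u + v)"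
        by (simp add: *(1)[symmetric] one)
      then have "s = f * smult (lead_coeff f ^ k) u + smult (lead_coeff f ^ k) v"
        by (simp add: smult_add_right)
      moreover have "degree (smult (lead_coeff f ^ k) v) < degree f"
        using *(2) df by (auto intro: le_less_trans[OF degree_smult_le])
      ultimately show ?thesis by (rule that)
    qed
    have "int_eval ([:int n ^ q:] + smult (int q) v) z = 0"
    proof -
      have "int_eval s z = int_eval v z" using f by (simp add: uv)
      then show ?thesis using nq by (simp add: s_def eq_neg_iff_add_eq_0)
    qed
    then have "f dvd [:int n ^ q:] + smult (int q) v" by (rule fdvd)
    moreover have "degree ([:int n ^ q:] + smult (int q) v) < degree f"
      using uv(2) df by (intro degree_add_less) (auto intro: le_less_trans[OF degree_smult_le])
    ultimately have "[:int n ^ q:] + smult (int q) v = 0"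
      by (metis dvd_imp_degree_le not_less)
    then have "coeff ([:int n ^ q:] + smult (int q) v) 0 = 0" by simp
    then have "int n ^ q = int q * (- coeff v 0)" by simp
    then have "int q dvd int n ^ q" by (metis dvd_triv_left)
    then have "q dvd n ^ q" by (metis of_nat_dvd_iff of_nat_power)
    then show False using q prime_dvd_power by blast
  qed
  moreover have "f dvd P" by (rule fdvd[OF P])
  ultimately show ?thesis by (auto elim!: dvdE)
qed

lemma int_eval_conj:
  assumes n: "n > 0" and "coprime k n" and "z ^ n = 1" and "int_eval P z = 0"
  shows "int_eval P (z ^ k) = 0"
  using assms(2-)
proof (induction k arbitrary: z rule: less_induct)
  case (less k)
  consider "k = 0" | "k = 1" | "k > 1" by linarith
  then show ?case
  proof cases
    case 1
    then have "n = 1" using less.prems(1) by simp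
    then show ?thesis using 1 less.prems by simp
  next
    case 2
    then show ?thesis using less.prems by simp
  next
    case 3
    then obtain q where q: "prime q" "q dvd k" using prime_factor_nat[of k] by auto
    then obtain k' where k': "k = q * k'" by (elim dvdE)
    have cop: "coprime q n" "coprime k' n" using less.prems(1) k' by simp_all
    have "\<not> q dvd n" using cop(1) q(1) by (metis coprime_absorb_left not_prime_unit)
    then have "int_eval P (z ^ q) = 0" using int_eval_conj_prime n less.prems q(1) by blast
    moreover have "(z ^ q) ^ n = 1" by (metis less.prems(2) mult.commute power_mult power_one)
    moreover have "k' < k" using k' 3 q(1) prime_gt_1_nat[OF q(1)] by (cases "k' = 0") auto
    ultimately have "int_eval P ((z ^ q) ^ k') = 0" using less.IH cop(2) by blast
    then show ?thesis by (simp add: k' power_mult)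
  qed
qed

lemma nu_eq_cis: "nu n = cis (2 * pi / real n)"
  by (simp add: nu_def cis_conv_exp field_simps)

lemma nu_power: "nu n ^ k = cis (2 * pi * real k / real n)"
  by (simp add: nu_eq_cis DeMoivre mult.commute)

lemma nu_power_self [simp]: "n > 0 \<Longrightarrow> nu n ^ n = 1"
  by (simp add: nu_power)

lemma root_of_unity_nu_power:
  assumes "n > 0" "w ^ n = 1"
  obtains k where "k < n" "w = nu n ^ k"
proof -
  have "w \<in> (\<lambda>k. cis (2 * pi * real k / real n)) ` {..<n}"
    using bij_betw_roots_unity[OF assms(1)] assms(2) by (auto simp: bij_betw_def)
  then show ?thesis using that by (auto simp: nu_power)
qed

lemma nu_power_eq_1_iff:
  assumes "n > 0"
  shows "nu n ^ k = 1 \<longleftrightarrow> n dvd k"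
proof
  assume *: "nu n ^ k = 1"
  have "nu n ^ k = nu n ^ (n * (k div n) + k mod n)" by simp
  also have "\<dots> = nu n ^ (k mod n)" by (simp only: power_add power_mult) (simp add: assms)
  finally have "nu n ^ (k mod n) = nu n ^ 0" using * by simp
  moreover have "inj_on (\<lambda>k. nu n ^ k) {..<n}"
    using bij_betw_roots_unity[OF assms] by (simp add: bij_betw_def nu_power)
  ultimately have "k mod n = 0" using assms by (intro inj_onD[of "\<lambda>k. nu n ^ k" "{..<n}"]) auto
  then show "n dvd k" by auto
next
  assume "n dvd k"
  then show "nu n ^ k = 1" by (auto elim!: dvdE simp: power_mult assms)
qed

text \<open>
  The Galois group of the \<open>n\<close>-th cyclotomic field acts on the roots of unity by \<open>w \<mapsto> w\<^sup>k\<close>; it is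
  enough to know what this does to vanishing sums.
\<close>
theorem sum_mset_conj:
  fixes g :: "complex multiset"
  assumes n: "n > 0" and g: "\<forall>w\<in>#g. w ^ n = 1" and "coprime k n" and "sum_mset g = 0"
  shows "(\<Sum>w\<in>#g. w ^ k) = 0"
proof -
  have "\<forall>w\<in>#g. \<exists>i. w = nu n ^ i" using g root_of_unity_nu_power[OF n] by metis
  then obtain e where e: "\<And>w. w \<in># g \<Longrightarrow> w = nu n ^ e w" by metis
  define P where "P = (\<Sum>w\<in>#g. monom (1::int) (e w))"
  have ev: "int_eval P (nu n ^ m) = (\<Sum>w\<in>#g. w ^ m)" for m
  proof -
    have "int_eval P (nu n ^ m) = (\<Sum>w\<in>#g. (nu n ^ m) ^ e w)" by (simp add: P_def)
    also have "\<dots> = (\<Sum>w\<in>#g. w ^ m)"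
      by (intro arg_cong[of _ _ sum_mset] image_mset_cong) (metis e mult.commute power_mult)
    finally show ?thesis .
  qed
  have "int_eval P (nu n) = 0" using ev[of 1] assms(4) by simp
  then show ?thesis using int_eval_conj[OF n assms(3), of "nu n" P] n ev by simp
qed

section \<open>Orders and rotations\<close>

lemma root_of_unity_ne_0: "root_of_unity z \<Longrightarrow> z \<noteq> 0"
  by (auto simp: root_of_unity_def power_0_left split: if_splits)

lemma root_of_unityI: "n > 0 \<Longrightarrow> z ^ n = 1 \<Longrightarrow> root_of_unity z"
  by (auto simp: root_of_unity_def)

lemma root_of_unity_1 [simp]: "root_of_unity 1"
  by (rule root_of_unityI[of 1]) auto

lemma root_of_unity_mult: "root_of_unity v \<Longrightarrow> root_of_unity w \<Longrightarrow> root_of_unity (v * w)"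
proof -
  assume "root_of_unity v" "root_of_unity w"
  then obtain m n where "m > 0" "v ^ m = 1" "n > 0" "w ^ n = 1" by (auto simp: root_of_unity_def)
  then have "(v * w) ^ (m * n) = 1"
    by (metis mult.commute mult_1 power_mult power_mult_distrib power_one)
  then show ?thesis using \<open>m > 0\<close> \<open>n > 0\<close> by (intro root_of_unityI[of "m * n"]) auto
qed

lemma root_of_unity_inverse: "root_of_unity w \<Longrightarrow> root_of_unity (1 / w)"
  unfolding root_of_unity_def by (metis div_by_1 power_divide power_one)

lemma root_of_unity_divide: "root_of_unity v \<Longrightarrow> root_of_unity w \<Longrightarrow> root_of_unity (v / w)"
  using root_of_unity_mult[of v "1 / w"] root_of_unity_inverse[of w] by simp

lemma root_of_unity_minus_1 [simp]: "root_of_unity (- 1)"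
  by (rule root_of_unityI[of 2]) auto

lemma root_of_unity_minus: "root_of_unity w \<Longrightarrow> root_of_unity (- w)"
  using root_of_unity_mult[of "-1" w] by simp

lemma root_of_unity_power: "root_of_unity w \<Longrightarrow> root_of_unity (w ^ k)"
  by (induction k) (auto intro: root_of_unity_mult)

lemma root_of_unity_nu: "n > 0 \<Longrightarrow> root_of_unity (nu n)"
  by (rule root_of_unityI) auto

lemma root_order_props:
  assumes "root_of_unity z"
  shows "root_order z > 0" and "z ^ root_order z = 1"
    and "m > 0 \<Longrightarrow> z ^ m = 1 \<Longrightarrow> root_order z \<le> m"
proof -
  have "\<exists>n. n > 0 \<and> z ^ n = 1" using assms by (simp add: root_of_unity_def)
  from LeastI_ex[OF this] show "root_order z > 0" "z ^ root_order z = 1"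
    by (auto simp: root_order_def)
  show "m > 0 \<Longrightarrow> z ^ m = 1 \<Longrightarrow> root_order z \<le> m"
    unfolding root_order_def by (rule Least_le) simp
qed

lemma root_order_dvd_iff:
  assumes "root_of_unity z"
  shows "root_order z dvd n \<longleftrightarrow> z ^ n = 1"
proof
  assume "root_order z dvd n"
  then show "z ^ n = 1" by (auto elim!: dvdE simp: power_mult root_order_props(2)[OF assms])
next
  assume "z ^ n = 1"
  moreover have "z ^ n = (z ^ root_order z) ^ (n div root_order z) * z ^ (n mod root_order z)"
    by (metis mult_div_mod_eq power_add power_mult)
  ultimately have "z ^ (n mod root_order z) = 1" using root_order_props(2)[OF assms] by simp
  then have "n mod root_order z = 0"
    using root_order_props(1,3)[OF assms] mod_less_divisor not_less by (metis not_gr0)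
  then show "root_order z dvd n" by auto
qed

lemma sorou_common_order: "sorou h \<Longrightarrow> \<exists>n>0. \<forall>w\<in>#h. w ^ n = 1"
proof (induction h)
  case empty then show ?case by auto
next
  case (add x h)
  from add.prems obtain m where m: "m > 0" "x ^ m = 1" by (auto simp: sorou_def root_of_unity_def)
  have "\<exists>n>0. \<forall>w\<in>#h. w ^ n = 1"
    using add.IH add.prems by (cases "h = {#}") (auto simp: sorou_def)
  then obtain n where n: "n > 0" "\<forall>w\<in>#h. w ^ n = 1" by blast
  have "w ^ (m * n) = 1" if "w \<in># add_mset x h" for w
  proof (cases "w = x")
    case True then show ?thesis using m by (simp add: power_mult)
  next
    case False
    then have "(w ^ n) ^ m = 1" using that n by simp
    then show ?thesis by (simp only: power_mult[symmetric] mult.commute)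
  qed
  then show ?case using m n by (intro exI[of _ "m * n"]) auto
qed

lemma relative_order_dvd_iff:
  assumes "sorou h"
  shows "relative_order h dvd n \<longleftrightarrow> (\<forall>v\<in>#h. \<forall>w\<in>#h. (v / w) ^ n = 1)"
proof -
  have "root_order (v / w) dvd n \<longleftrightarrow> (v / w) ^ n = 1" if "v \<in># h" "w \<in># h" for v w
    using that assms by (intro root_order_dvd_iff root_of_unity_divide) (auto simp: sorou_def)
  then show ?thesis unfolding relative_order_def Lcm_dvd_iff by blast
qed

lemma relative_order_pos:
  assumes "sorou h" shows "relative_order h > 0"
proof -
  obtain n where "n > 0" "\<forall>w\<in>#h. w ^ n = 1" using sorou_common_order[OF assms] by blast
  then have "relative_order h dvd n" by (simp add: relative_order_dvd_iff[OF assms] power_divide)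
  then show ?thesis using \<open>n > 0\<close> by (meson dvd_pos_nat)
qed

lemma relative_order_ratio:
  "sorou h \<Longrightarrow> v \<in># h \<Longrightarrow> w \<in># h \<Longrightarrow> (v / w) ^ relative_order h = 1"
  using relative_order_dvd_iff[of h "relative_order h"] by auto

lemma set_mset_rot [simp]: "set_mset (rot z h) = (\<lambda>w. z * w) ` set_mset h"
  by (simp add: rot_def)

lemma size_rot [simp]: "size (rot z h) = size h"
  by (simp add: rot_def)

lemma rot_empty [simp]: "rot z {#} = {#}"
  by (simp add: rot_def)

lemma rot_eq_empty [simp]: "rot z h = {#} \<longleftrightarrow> h = {#}"
  by (simp add: rot_def)

lemma rot_add_mset [simp]: "rot z (add_mset w h) = add_mset (z * w) (rot z h)"
  by (simp add: rot_def)

lemma rot_plus [simp]: "rot z (g + h) = rot z g + rot z h"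
  by (simp add: rot_def)

lemma rot_1 [simp]: "rot 1 h = h"
  by (simp add: rot_def)

lemma rot_rot [simp]: "rot z (rot w h) = rot (z * w) h"
  by (simp add: rot_def image_mset.compositionality o_def mult.assoc)

lemma rot_sum: "rot z (\<Sum>j\<in>A. f j) = (\<Sum>j\<in>A. rot z (f j))"
  by (induction A rule: infinite_finite_induct) simp_all

lemma sum_mset_rot [simp]: "sum_mset (rot z h) = z * sum_mset h"
  by (induction h) (simp_all add: distrib_left)

lemma rot_mono: "g \<subseteq># h \<Longrightarrow> rot z g \<subseteq># rot z h"
  by (simp add: rot_def image_mset_subseteq_mono)

lemma rot_eq_iff: "z \<noteq> 0 \<Longrightarrow> rot z g = h \<longleftrightarrow> g = rot (1 / z) h"
  by auto

lemma sorou_rot: "root_of_unity z \<Longrightarrow> sorou (rot z h) \<longleftrightarrow> sorou h"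
proof -
  assume z: "root_of_unity z"
  then have z0: "z \<noteq> 0" using root_of_unity_ne_0 by blast
  have "root_of_unity (z * w) \<longleftrightarrow> root_of_unity w" for w
    using root_of_unity_divide[of "z * w" z] root_of_unity_mult[of z w] z z0 by auto
  then show ?thesis by (simp add: sorou_def)
qed

lemma relative_order_rot: "z \<noteq> 0 \<Longrightarrow> relative_order (rot z h) = relative_order h"
proof -
  assume "z \<noteq> 0"
  have eq: "{root_order (v / w) |v w. v \<in># k \<and> w \<in># k} =
      (\<lambda>(v, w). root_order (v / w)) ` (set_mset k \<times> set_mset k)" for k
    by auto
  have "set_mset (rot z h) \<times> set_mset (rot z h) =
      (\<lambda>(v, w). (z * v, z * w)) ` (set_mset h \<times> set_mset h)"
    by auto
  then have "relative_order (rot z h) = Lcm ((\<lambda>(v, w). root_order (v / w)) `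
      (\<lambda>(v, w). (z * v, z * w)) ` (set_mset h \<times> set_mset h))"
    by (simp only: relative_order_def eq)
  also have "\<dots> = relative_order h"
    using \<open>z \<noteq> 0\<close> by (simp add: relative_order_def eq image_image case_prod_unfold)
  finally show ?thesis .
qed

lemma vanishing_sorou: "minimal_vanishing h \<Longrightarrow> sorou h"
  by (simp add: minimal_vanishing_def vanishing_def)

lemma minimal_vanishing_sum: "minimal_vanishing h \<Longrightarrow> sum_mset h = 0"
  by (simp add: minimal_vanishing_def vanishing_def)

lemma sorou_subset: "sorou h \<Longrightarrow> g \<subseteq># h \<Longrightarrow> g \<noteq> {#} \<Longrightarrow> sorou g"
  by (auto simp: sorou_def dest: mset_subset_eqD)

lemma minimal_vanishing_sub:
  "minimal_vanishing h \<Longrightarrow> g \<subseteq># h \<Longrightarrow> sum_mset g = 0 \<Longrightarrow> g = {#} \<or> g = h"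
  unfolding minimal_vanishing_def vanishing_def using sorou_subset by blast

lemma minimal_vanishingI:
  "sorou h \<Longrightarrow> sum_mset h = 0 \<Longrightarrow>
    (\<And>g. g \<subseteq># h \<Longrightarrow> sum_mset g = 0 \<Longrightarrow> g = {#} \<or> g = h) \<Longrightarrow> minimal_vanishing h"
  by (auto simp: minimal_vanishing_def vanishing_def)

lemma minimal_vanishing_rot:
  assumes "root_of_unity z" "minimal_vanishing h"
  shows "minimal_vanishing (rot z h)"
proof (rule minimal_vanishingI)
  have z: "z \<noteq> 0" using assms root_of_unity_ne_0 by blast
  show "sorou (rot z h)" using assms sorou_rot vanishing_sorou by blast
  show "sum_mset (rot z h) = 0" using assms minimal_vanishing_sum by simp
  fix g assume "g \<subseteq># rot z h" "sum_mset g = 0"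
  then have "rot (1 / z) g \<subseteq># h" "sum_mset (rot (1 / z) g) = 0"
    using rot_mono[of g "rot z h" "1 / z"] z by auto
  then have "rot (1 / z) g = {#} \<or> rot (1 / z) g = h"
    using minimal_vanishing_sub assms by blast
  then show "g = {#} \<or> g = rot z h" using z by auto
qed

lemma size_minimal_vanishing: "minimal_vanishing h \<Longrightarrow> size h \<ge> 2"
proof (rule ccontr)
  assume h: "minimal_vanishing h" and "\<not> size h \<ge> 2"
  moreover have "h \<noteq> {#}" using h vanishing_sorou sorou_def by blast
  ultimately have "size h = 1" using nonempty_has_size[of h] by linarith
  then obtain w where "h = {#w#}" using size_1_singleton_mset by blast
  then show False using h minimal_vanishing_sum[OF h] vanishing_sorou[OF h] root_of_unity_ne_0
    by (auto simp: sorou_def)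
qed

section \<open>The relative order of a minimal vanishing sum is squarefree\<close>

lemma sum_powers_root_of_unity:
  fixes u :: complex
  assumes "u ^ p = 1"
  shows "(\<Sum>t<p. u ^ t) = (if u = 1 then of_nat p else 0)"
  using assms geometric_sum[of u p] by auto

lemma sum_sum_mset_swap: "(\<Sum>t\<in>A. \<Sum>w\<in>#h. F w t) = (\<Sum>w\<in>#h. \<Sum>t\<in>A. F w t)"
  for F :: "'a \<Rightarrow> 'b \<Rightarrow> 'c::comm_monoid_add"
  by (induction h) (simp_all add: sum.distrib)

text \<open>
  The conjugations \<open>w \<mapsto> w\<^sup>1\<^sup>+\<^sup>M\<^sup>t\<close> multiply \<open>w\<close> by the powers of the \<open>p\<close>-th root of unity \<open>w\<^sup>M\<close>.
  Averaging over \<open>t\<close> projects onto the terms with \<open>w\<^sup>M = 1\<close>.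
\<close>
lemma sum_mset_filter_power_eq_0:
  assumes "p dvd M" and pM: "p * M > 0" and g: "\<forall>w\<in>#g. w ^ (p * M) = (1::complex)"
    and "sum_mset g = 0"
  shows "sum_mset {#w \<in># g. w ^ M = 1#} = 0"
proof -
  have "(\<Sum>w\<in>#g. w * (w ^ M) ^ t) = 0" for t
  proof -
    have "coprime (1 + M * t) M"
      by (metis coprime_1_left coprime_iff_gcd_eq_1 gcd.commute gcd_add_mult mult.commute add.commute)
    then have "coprime (1 + M * t) (M * M)" by simp
    moreover have "p * M dvd M * M" using assms(1) by simp
    ultimately have "coprime (1 + M * t) (p * M)" using coprime_divisors dvd_refl by blast
    then have "(\<Sum>w\<in>#g. w ^ (1 + M * t)) = 0"
      by (rule sum_mset_conj[OF pM g _ assms(4)])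
    then show ?thesis by (simp add: power_add power_mult)
  qed
  then have "0 = (\<Sum>t<p. \<Sum>w\<in>#g. w * (w ^ M) ^ t)" by simp
  also have "\<dots> = (\<Sum>w\<in>#g. w * (\<Sum>t<p. (w ^ M) ^ t))"
    by (simp add: sum_sum_mset_swap sum_distrib_left)
  also have "\<dots> = (\<Sum>w\<in>#g. if w ^ M = 1 then of_nat p * w else 0)"
  proof (intro arg_cong[of _ _ sum_mset] image_mset_cong)
    fix w assume "w \<in># g"
    then have "(w ^ M) ^ p = 1" using g by (metis mult.commute power_mult)
    then show "w * (\<Sum>t<p. (w ^ M) ^ t) = (if w ^ M = 1 then of_nat p * w else 0)"
      by (simp add: sum_powers_root_of_unity)
  qed
  also have "\<dots> = of_nat p * sum_mset {#w \<in># g. w ^ M = 1#}"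
    by (induction g) (auto simp: algebra_simps)
  finally show ?thesis using pM by simp
qed

text \<open>
  Let one term be rotated to \<open>1\<close>. If \<open>p\<^sup>2\<close> divided the relative order \<open>N\<close>, then, by the averaging
  above with \<open>M = N / p\<close>, the terms with \<open>w\<^sup>M = 1\<close> would form a vanishing subsum. It contains \<open>1\<close>,
  so it is the whole sum by minimality, and the relative order would divide \<open>M\<close>.
\<close>
theorem squarefree_relative_order:
  assumes h: "minimal_vanishing h"
  shows "squarefree (relative_order h)"
proof (rule ccontr)
  have so: "sorou h" using h vanishing_sorou by blast
  define N where "N = relative_order h"
  have N: "N > 0" using relative_order_pos[OF so] by (simp add: N_def)
  assume "\<not> squarefree (relative_order h)"
  then obtain p where p: "prime p" "p\<^sup>2 dvd N"
    using squarefree_factorial_semiring[of N] N by (auto simp: N_def)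
  then obtain k where k: "N = p\<^sup>2 * k" by (elim dvdE)
  define M where "M = p * k"
  have NM: "N = p * M" by (simp add: k M_def power2_eq_square)
  obtain v where v: "v \<in># h" using so by (auto simp: sorou_def)
  define g where "g = rot (1 / v) h"
  have ru: "root_of_unity v" using so v by (simp add: sorou_def)
  have g: "minimal_vanishing g"
    unfolding g_def by (intro minimal_vanishing_rot root_of_unity_inverse ru h)
  have v0: "v \<noteq> 0" using ru root_of_unity_ne_0 by blast
  have 1: "\<forall>w\<in>#g. w ^ N = 1"
    using relative_order_ratio[OF so _ v] by (auto simp: g_def N_def)
  have "sum_mset {#w \<in># g. w ^ M = 1#} = 0"
    using 1 N minimal_vanishing_sum[OF g] by (intro sum_mset_filter_power_eq_0[of p]) (auto simp: NM M_def)
  moreover have "1 \<in># {#w \<in># g. w ^ M = 1#}" using v v0 by (auto simp: g_def intro!: image_eqI)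
  ultimately have all: "{#w \<in># g. w ^ M = 1#} = g"
    using minimal_vanishing_sub[OF g multiset_filter_subset] by fastforce
  have *: "w ^ M = 1" if "w \<in># g" for w
    using that by (subst (asm) all[symmetric]) simp
  have "\<forall>x\<in>#h. \<forall>y\<in>#h. (x / y) ^ M = 1"
  proof (intro ballI)
    fix x y assume "x \<in># h" "y \<in># h"
    then have "(1 / v * x) ^ M = 1" "(1 / v * y) ^ M = 1" using * by (auto simp: g_def)
    then have "x ^ M / v ^ M = 1" "y ^ M / v ^ M = 1" by (simp_all add: power_divide)
    moreover have "x / y = (x / v) / (y / v)" using v0 by simp
    ultimately show "(x / y) ^ M = 1" by (simp only: power_divide) simp
  qed
  then have "N dvd M" by (simp add: N_def relative_order_dvd_iff[OF so])
  then have "p * M \<le> M" using N by (simp add: NM dvd_imp_le)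
  then show False using p(1) prime_gt_1_nat[of p] N by (simp add: NM)
qed

section \<open>Linear relations between the powers of \<open>\<nu>\<^sub>p\<close>\<close>

lemma sum_mset_sum: "sum_mset (\<Sum>j\<in>A. f j) = (\<Sum>j\<in>A. sum_mset (f j))"
  for f :: "'a \<Rightarrow> 'b::comm_monoid_add multiset"
  by (induction A rule: infinite_finite_induct) simp_all

lemma image_mset_sum: "image_mset F (\<Sum>j\<in>A. f j) = (\<Sum>j\<in>A. image_mset F (f j))"
  by (induction A rule: infinite_finite_induct) simp_all

lemma nu_power_shift_eq_1_iff:
  assumes "p > 0" "k < p" "j < p"
  shows "nu p ^ (j + (p - k)) = 1 \<longleftrightarrow> j = k"
proof -
  have "p dvd j + (p - k) \<longleftrightarrow> j = k"
    using assms
  proof (cases "j < k")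
    case True
    then show ?thesis using assms by (auto dest: dvd_imp_le)
  next
    case False
    then have "j + (p - k) = p + (j - k)" using assms by simp
    then have "p dvd j + (p - k) \<longleftrightarrow> p dvd j - k" by simp
    also have "\<dots> \<longleftrightarrow> j = k" using assms False by (auto dest: dvd_imp_le)
    finally show ?thesis .
  qed
  then show ?thesis using assms by (simp add: nu_power_eq_1_iff)
qed

lemma nu_power_times_root:
  assumes "p > 0" "u ^ M = 1"
  shows "(nu p ^ j * u) ^ (p * M) = 1"
proof -
  have "(nu p ^ j * u) ^ (p * M) = ((nu p ^ p) ^ j) ^ M * (u ^ M) ^ p"
    by (simp only: power_mult_distrib power_mult[symmetric] mult_ac)
  then show ?thesis using assms by simp
qed

text \<open>
  Over the field generated by \<open>\<mu>\<^sub>M\<close>, the only linear relations between \<open>1, \<nu>\<^sub>p, \<dots>, \<nu>\<^sub>p\<^sup>p\<^sup>-\<^sup>1\<close> are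
  the multiples of \<open>1 + \<nu>\<^sub>p + \<dots> + \<nu>\<^sub>p\<^sup>p\<^sup>-\<^sup>1 = 0\<close>. Indeed, for \<open>0 < t < p\<close> the conjugation
  \<open>w \<mapsto> w\<^sup>k\<close> with \<open>k \<equiv> 1\<close> modulo \<open>M\<close> and \<open>k \<equiv> t\<close> modulo \<open>p\<close> fixes the components and sends \<open>\<nu>\<^sub>p\<close> to
  \<open>\<nu>\<^sub>p\<^sup>t\<close>. So the discrete Fourier transform \<open>A\<close> of the values \<open>a j\<close> of the components vanishes at
  every \<open>t \<noteq> 0\<close>, and Fourier inversion shows that \<open>a\<close> is constant.
\<close>
theorem equal_components:
  fixes f :: "nat \<Rightarrow> complex multiset"
  assumes p: "prime p" "\<not> p dvd M" and M: "M > 0"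
    and f: "\<And>j w. j < p \<Longrightarrow> w \<in># f j \<Longrightarrow> w ^ M = 1"
    and s0: "sum_mset (\<Sum>j<p. rot (nu p ^ j) (f j)) = 0"
    and i: "i < p"
  shows "sum_mset (f i) = sum_mset (f 0)"
proof -
  have p0: "p > 0" using p prime_gt_0_nat by blast
  define a where "a j = sum_mset (f j)" for j
  define A where "A t = (\<Sum>j<p. a j * nu p ^ (j * t))" for t
  define g where "g = (\<Sum>j<p. rot (nu p ^ j) (f j))"
  have g: "\<forall>w\<in>#g. w ^ (p * M) = 1"
  proof
    fix w assume "w \<in># g"
    then obtain j u where "j < p" "u \<in># f j" "w = nu p ^ j * u"
      by (auto simp: g_def set_mset_sum)
    then show "w ^ (p * M) = 1" using f[of j u] p0 by (simp add: nu_power_times_root)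
  qed
  have A0: "A t = 0" if t: "0 < t" "t < p" for t
  proof -
    have "coprime p M" using p by (rule prime_imp_coprime)
    then have "coprime M p" by (simp add: coprime_commute)
    then obtain k where k: "[k = 1] (mod M)" "[k = t] (mod p)"
      using binary_chinese_remainder_nat by blast
    have "coprime k M" using k(1) by (metis cong_imp_coprime cong_sym coprime_1_left)
    moreover have "coprime t p" using t p by (metis coprime_commute nat_dvd_not_less prime_imp_coprime)
    then have "coprime k p" using k(2) by (metis cong_imp_coprime cong_sym)
    ultimately have "coprime k (p * M)" by simp
    then have "(\<Sum>w\<in>#g. w ^ k) = 0"
      using p0 M g s0 by (intro sum_mset_conj[of "p * M"]) (auto simp: g_def)
    also have "(\<Sum>w\<in>#g. w ^ k) = (\<Sum>j<p. \<Sum>w\<in>#f j. (nu p ^ j * w) ^ k)"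
      by (simp add: g_def image_mset_sum sum_mset_sum rot_def image_mset.compositionality o_def)
    also have "\<dots> = (\<Sum>j<p. \<Sum>w\<in>#f j. nu p ^ (j * t) * w)"
    proof (intro sum.cong arg_cong[of _ _ sum_mset] image_mset_cong refl)
      fix j w assume j: "j \<in> {..<p}" "w \<in># f j"
      have "w ^ k = w"
      proof -
        obtain a b where ab: "k + M * a = 1 + M * b"
          using k(1) by (metis cong_iff_lin_nat mult.commute)
        have "w ^ M = 1" using f j by auto
        then show ?thesis using arg_cong[OF ab, of "\<lambda>e. w ^ e"] by (simp add: power_add power_mult)
      qed
      moreover have "nu p ^ (j * k) = nu p ^ (j * t)"
      proof -
        have red: "nu p ^ x = nu p ^ (x mod p)" for x
        proof -
          have "nu p ^ x = nu p ^ (p * (x div p) + x mod p)" by simp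
          then show ?thesis by (simp only: power_add power_mult nu_power_self[OF p0]) simp
        qed
        have "(j * k) mod p = (j * t) mod p" using k(2) by (metis cong_def mod_mult_right_eq)
        then show ?thesis by (metis red)
      qed
      ultimately show "(nu p ^ j * w) ^ k = nu p ^ (j * t) * w"
        by (simp add: power_mult_distrib power_mult)
    qed
    also have "\<dots> = A t"
      by (simp add: A_def a_def sum_mset_rot[unfolded rot_def]) (simp only: mult.commute)
    finally show ?thesis .
  qed
  have inv: "of_nat p * a k = A 0" if k: "k < p" for k
  proof -
    have "A 0 = (\<Sum>t<p. A t * nu p ^ ((p - k) * t))"
    proof -
      have "(\<Sum>t<p. A t * nu p ^ ((p - k) * t)) = (\<Sum>t<p. if t = 0 then A 0 else 0)"
        by (intro sum.cong) (auto simp: A0)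
      then show ?thesis using p0 by simp
    qed
    also have "\<dots> = (\<Sum>t<p. \<Sum>j<p. a j * (nu p ^ (j + (p - k))) ^ t)"
      by (simp add: A_def sum_distrib_right power_mult[symmetric] mult.assoc power_add[symmetric]
        distrib_right)
    also have "\<dots> = (\<Sum>j<p. a j * (\<Sum>t<p. (nu p ^ (j + (p - k))) ^ t))"
      by (subst sum.swap) (simp add: sum_distrib_left)
    also have "\<dots> = (\<Sum>j<p. if j = k then of_nat p * a j else 0)"
    proof (intro sum.cong refl)
      fix j assume j: "j \<in> {..<p}"
      have "(nu p ^ (j + (p - k))) ^ p = 1"
        by (metis mult.commute nu_power_self p0 power_mult power_one)
      then show "a j * (\<Sum>t<p. (nu p ^ (j + (p - k))) ^ t) = (if j = k then of_nat p * a j else 0)"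
        using nu_power_shift_eq_1_iff[OF p0 k] j by (simp add: sum_powers_root_of_unity)
    qed
    also have "\<dots> = of_nat p * a k" using k by simp
    finally show ?thesis by simp
  qed
  have "of_nat p * a i = of_nat p * a 0" using inv[OF i] inv[OF p0] by simp
  then show ?thesis using p0 by (simp add: a_def)
qed

section \<open>Decomposing along the top prime\<close>

lemma nu_power_times_inj:
  assumes p: "prime p" "\<not> p dvd M" and "i < p" "j < p"
  shows "nu p ^ (i * M) = nu p ^ (j * M) \<longleftrightarrow> i = j"
proof -
  have *: "i = j" if "i \<le> j" "j < p" and eq: "nu p ^ (i * M) = nu p ^ (j * M)" for i j
  proof -
    have p0: "p > 0" using p prime_gt_0_nat by blast
    have "j * M = i * M + (j - i) * M" using that by (metis add_mult_distrib le_add_diff_inverse)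
    then have "nu p ^ (i * M) * 1 = nu p ^ (i * M) * nu p ^ ((j - i) * M)"
      using eq by (simp add: power_add)
    moreover have "nu p ^ (i * M) \<noteq> 0"
      using root_of_unity_ne_0[OF root_of_unity_nu[OF p0]] by simp
    ultimately have "nu p ^ ((j - i) * M) = 1" by (metis mult_left_cancel)
    then have "p dvd (j - i) * M" by (simp add: nu_power_eq_1_iff p0)
    then have "p dvd j - i" using p by (simp add: prime_dvd_mult_iff)
    then have "j - i = 0" using that
      by (metis dvd_imp_le le_imp_less_Suc less_imp_diff_less not_less not_gr_zero)
    then show ?thesis using that by simp
  qed
  show ?thesis using *[of i j] *[of j i] assms by (metis nat_le_linear)
qed

lemma sum_mset_partition:
  assumes "finite A" and "\<And>w. w \<in># g \<Longrightarrow> \<exists>!j. j \<in> A \<and> P j w"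
  shows "(\<Sum>j\<in>A. filter_mset (P j) g) = g"
proof (rule multiset_eqI)
  fix w
  have "count (\<Sum>j\<in>A. filter_mset (P j) g) w = (\<Sum>j\<in>A. if P j w then count g w else 0)"
    by (simp add: count_sum)
  also have "\<dots> = count g w"
  proof (cases "w \<in># g")
    case True
    then obtain i where i: "i \<in> A" "P i w" "\<And>j. j \<in> A \<Longrightarrow> P j w \<Longrightarrow> j = i"
      using assms(2)[OF True] by (elim ex1E) blast
    have "(\<Sum>j\<in>A. if P j w then count g w else 0) = (\<Sum>j\<in>A. if j = i then count g w else 0)"
    proof (rule sum.cong[OF refl])
      fix j assume "j \<in> A"
      have "P j w \<longleftrightarrow> j = i"
      proof
        show "j = i" if "P j w" by (rule i(3)[OF \<open>j \<in> A\<close> that])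
        show "P j w" if "j = i" unfolding that by (rule i(2))
      qed
      then show "(if P j w then count g w else 0) = (if j = i then count g w else 0)" by simp
    qed
    then show ?thesis using i(1) assms(1) by simp
  next
    case False
    then have 0: "count g w = 0" by (simp add: count_eq_zero_iff)
    show ?thesis by (simp only: 0 if_cancel sum.neutral_const)
  qed
  finally show "count (\<Sum>j\<in>A. filter_mset (P j) g) w = count g w" .
qed

lemma filter_mset_sum: "filter_mset P (\<Sum>j\<in>A. f j) = (\<Sum>j\<in>A. filter_mset P (f j))"
  by (induction A rule: infinite_finite_induct) simp_all

lemma filter_mset_all: "(\<And>w. w \<in># g \<Longrightarrow> P w) \<Longrightarrow> filter_mset P g = g"
  by (induction g) simp_all

lemma filter_mset_none: "(\<And>w. w \<in># g \<Longrightarrow> \<not> P w) \<Longrightarrow> filter_mset P g = {#}"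
  by (induction g) simp_all

lemma size_sum: "size (\<Sum>j\<in>A. f j) = (\<Sum>j\<in>A. size (f j))" for f :: "'a \<Rightarrow> 'b multiset"
  by (induction A rule: infinite_finite_induct) simp_all

lemma sum_subseteq_mset:
  "(\<And>j. j \<in> A \<Longrightarrow> k j \<subseteq># f j) \<Longrightarrow> (\<Sum>j\<in>A. k j) \<subseteq># (\<Sum>j\<in>A. f j)"
  by (induction A rule: infinite_finite_induct) (simp_all add: subset_mset.add_mono)

text \<open>
  The map \<open>w \<mapsto> w\<^sup>M\<close> is constant on \<open>\<nu>\<^sub>p\<^sup>i f\<^sub>i\<close> and takes different values for different \<open>i\<close>, since
  \<open>p\<close> is prime to \<open>M\<close>. So the components can be recovered from the sum.
\<close>
lemma component_eq_filter:
  assumes p: "prime p" "\<not> p dvd M"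
    and f: "\<And>j w. j < p \<Longrightarrow> w \<in># f j \<Longrightarrow> w ^ M = 1" and i: "i < p"
  shows "{#w \<in># \<Sum>j<p. rot (nu p ^ j) (f j). w ^ M = nu p ^ (i * M)#} = rot (nu p ^ i) (f i)"
proof -
  have "{#w \<in># rot (nu p ^ j) (f j). w ^ M = nu p ^ (i * M)#} =
      (if j = i then rot (nu p ^ j) (f j) else {#})" if "j < p" for j
    using that i f[of j] nu_power_times_inj[OF p that i]
    by (auto intro!: filter_mset_all filter_mset_none simp: power_mult_distrib power_mult)
  then have "{#w \<in># \<Sum>j<p. rot (nu p ^ j) (f j). w ^ M = nu p ^ (i * M)#} =
      (\<Sum>j<p. if j = i then rot (nu p ^ j) (f j) else {#})"
    unfolding filter_mset_sum by (intro sum.cong) auto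
  then show ?thesis using i by simp
qed

lemma nu_power_times_image:
  assumes p: "prime p" "\<not> p dvd M"
  shows "(\<lambda>j. nu p ^ (j * M)) ` {..<p} = {u. u ^ p = 1}" and "inj_on (\<lambda>j. nu p ^ (j * M)) {..<p}"
proof -
  have p0: "p > 0" using p prime_gt_0_nat by blast
  show inj: "inj_on (\<lambda>j. nu p ^ (j * M)) {..<p}"
    using nu_power_times_inj[OF p] by (auto simp: inj_on_def)
  moreover have "(\<lambda>j. nu p ^ (j * M)) ` {..<p} \<subseteq> {u. u ^ p = 1}"
    by (auto simp: power_mult[symmetric])
      (metis mult.assoc mult.commute nu_power_self p0 power_mult power_one)
  moreover have "finite {u::complex. u ^ p = 1}" "card {u::complex. u ^ p = 1} = p"
    using card_roots_unity_eq[OF p0] finite_roots_unity[of p] p0 by simp_all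
  ultimately show "(\<lambda>j. nu p ^ (j * M)) ` {..<p} = {u. u ^ p = 1}"
    by (metis card_image card_lessThan card_subset_eq)
qed

lemma ex1_component:
  assumes p: "prime p" "\<not> p dvd M" and w: "w ^ (p * M) = 1"
  shows "\<exists>!j. j \<in> {..<p} \<and> w ^ M = nu p ^ (j * M)"
proof -
  have "w ^ M \<in> {u. u ^ p = 1}" using w by (simp add: power_mult[symmetric] mult.commute)
  then have "\<exists>j. j \<in> {..<p} \<and> w ^ M = nu p ^ (j * M)"
    using nu_power_times_image(1)[OF p] by blast
  then show ?thesis using nu_power_times_inj[OF p] by (metis lessThan_iff)
qed

lemma sum_nu_powers: "p > 1 \<Longrightarrow> (\<Sum>j<p. nu p ^ j) = 0"
  using sum_powers_root_of_unity[of "nu p" p] nu_power_eq_1_iff[of p 1] by auto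

lemma relative_order_gt_1:
  assumes h: "minimal_vanishing h"
  shows "relative_order h > 1"
proof (rule ccontr)
  assume "\<not> relative_order h > 1"
  moreover have so: "sorou h" using h vanishing_sorou by blast
  ultimately have 1: "relative_order h = 1" using relative_order_pos[OF so] by linarith
  obtain v where v: "v \<in># h" using so by (auto simp: sorou_def)
  have v0: "v \<noteq> 0" using so v root_of_unity_ne_0 by (auto simp: sorou_def)
  have "w = v" if "w \<in># h" for w
    using relative_order_ratio[OF so that v] v0 by (simp add: 1)
  then have "h = replicate_mset (size h) v" by (metis set_mset_subset_singletonD singletonI subsetI)
  then have "sum_mset h = of_nat (size h) * v" by (metis sum_mset_replicate_mset)
  then show False using minimal_vanishing_sum[OF h] v0 size_minimal_vanishing[OF h] by auto
qed

lemma top_primeI: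
  assumes "prime p" "p dvd relative_order h" "relative_order h > 0"
    and "\<And>q. prime q \<Longrightarrow> q dvd relative_order h \<Longrightarrow> q \<le> p"
  shows "top_prime h = p"
proof -
  have "finite {q. prime q \<and> q dvd relative_order h}"
    by (rule finite_subset[of _ "{..relative_order h}"]) (use assms(3) in \<open>auto dest: dvd_imp_le\<close>)
  then show ?thesis unfolding top_prime_def using assms by (intro Max_eqI) auto
qed

lemma top_prime_props:
  assumes h: "minimal_vanishing h"
  shows "prime (top_prime h)" and "top_prime h dvd relative_order h"
    and "\<And>q. prime q \<Longrightarrow> q dvd relative_order h \<Longrightarrow> q \<le> top_prime h"
proof -
  let ?A = "{q. prime q \<and> q dvd relative_order h}"
  have fin: "finite ?A"
    by (rule finite_subset[of _ "{..relative_order h}"])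
      (use relative_order_gt_1[OF h] in \<open>auto dest: dvd_imp_le\<close>)
  obtain q where "q \<in> ?A" using relative_order_gt_1[OF h] prime_factor_nat[of "relative_order h"] by auto
  then have "Max ?A \<in> ?A" using fin by (intro Max_in) auto
  then show "prime (top_prime h)" "top_prime h dvd relative_order h" by (auto simp: top_prime_def)
  show "\<And>q. prime q \<Longrightarrow> q dvd relative_order h \<Longrightarrow> q \<le> top_prime h"
    using fin by (simp add: top_prime_def)
qed

text \<open>The modulus \<open>M\<close> is the product \<open>p\<^sub>1 \<cdots> p\<^sub>s\<^sub>-\<^sub>1\<close> of the primes below the top prime.\<close>
lemma top_prime_split:
  assumes h: "minimal_vanishing h" and p: "p = top_prime h" and M: "M = relative_order h div p"
  shows "prime p" and "relative_order h = p * M" and "M > 0" and "\<not> p dvd M" and "squarefree M"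
    and "\<And>q. prime q \<Longrightarrow> q dvd M \<Longrightarrow> q < p"
proof -
  note t = top_prime_props[OF h, folded p]
  show pr: "prime p" by (rule t)
  show N: "relative_order h = p * M" using t by (simp add: M)
  show M0: "M > 0" using relative_order_gt_1[OF h] N by (cases M) auto
  have sq: "squarefree (p * M)" using squarefree_relative_order[OF h] N by simp
  show ndvd: "\<not> p dvd M"
  proof
    assume "p dvd M"
    then have "p\<^sup>2 dvd p * M" by (simp add: power2_eq_square)
    then show False using sq pr by (metis not_prime_unit squarefree_def)
  qed
  show "squarefree M" using sq by (metis dvd_triv_right squarefree_mono)
  show "q < p" if "prime q" "q dvd M" for q
    using t(3)[of q] that ndvd N by (metis dvd_mult le_neq_implies_less)
qed

lemma top_decomp_props:
  assumes h: "minimal_vanishing h" and d: "top_decomp h p f" and M: "M = relative_order h div p"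
  shows "p = top_prime h" and "prime p" and "relative_order h = p * M" and "M > 0" and "\<not> p dvd M"
    and "squarefree M" and "\<And>q. prime q \<Longrightarrow> q dvd M \<Longrightarrow> q < p"
    and "\<And>j. j < p \<Longrightarrow> sorou (f j)" and "\<And>j w. j < p \<Longrightarrow> w \<in># f j \<Longrightarrow> w ^ M = 1"
    and "\<And>j. j < p \<Longrightarrow> sum_mset (f j) = sum_mset (f 0)"
proof -
  show p: "p = top_prime h" using d by (simp add: top_decomp_def)
  note t = top_prime_split[OF h p M]
  show "prime p" "relative_order h = p * M" "M > 0" "\<not> p dvd M" "squarefree M"
    "\<And>q. prime q \<Longrightarrow> q dvd M \<Longrightarrow> q < p" by (rule t)+ assumption+
  show so: "sorou (f j)" if "j < p" for j using d that by (simp add: top_decomp_def)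
  show 1: "w ^ M = 1" if "j < p" "w \<in># f j" for j w
  proof -
    have "root_order w dvd M" using d that unfolding top_decomp_def M by blast
    moreover have "root_of_unity w" using so that by (auto simp: sorou_def)
    ultimately show ?thesis by (simp add: root_order_dvd_iff)
  qed
  obtain z where z: "rot z h = (\<Sum>j<p. rot (nu p ^ j) (f j))"
    using d by (auto simp: top_decomp_def)
  have "sum_mset (\<Sum>j<p. rot (nu p ^ j) (f j)) = 0"
    by (simp add: z[symmetric] minimal_vanishing_sum[OF h])
  then show "sum_mset (f j) = sum_mset (f 0)" if "j < p" for j
    using that t 1 by (intro equal_components[of p M f]) auto
qed

text \<open>
  Subsums of the components with the common value \<open>c\<close> combine to a subsum of value
  \<open>c (1 + \<nu>\<^sub>p + \<dots> + \<nu>\<^sub>p\<^sup>p\<^sup>-\<^sup>1) = 0\<close>, which is empty or everything. The classification below uses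
  minimality mostly in this form.
\<close>
lemma equal_subsums_trivial:
  assumes h: "minimal_vanishing h" and d: "top_decomp h p f"
    and k: "\<And>j. j < p \<Longrightarrow> k j \<subseteq># f j" and c: "\<And>j. j < p \<Longrightarrow> sum_mset (k j) = c"
  shows "(\<forall>j<p. k j = {#}) \<or> (\<forall>j<p. k j = f j)"
proof -
  obtain z where z: "root_of_unity z" "rot z h = (\<Sum>j<p. rot (nu p ^ j) (f j))"
    using d by (auto simp: top_decomp_def)
  have mh: "minimal_vanishing (rot z h)" using h z minimal_vanishing_rot by blast
  have p1: "p > 1" using top_decomp_props(2)[OF h d refl] prime_gt_1_nat by blast
  define K where "K = (\<Sum>j<p. rot (nu p ^ j) (k j))"
  have "K \<subseteq># rot z h"
    unfolding K_def z using k by (intro sum_subseteq_mset rot_mono) auto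
  moreover have "sum_mset K = 0"
    using p1 by (simp add: K_def sum_mset_sum c sum_distrib_right[symmetric] sum_nu_powers)
  ultimately consider "K = {#}" | "K = rot z h" using minimal_vanishing_sub[OF mh] by blast
  then show ?thesis
  proof cases
    case 1
    have "(\<Sum>j<p. size (k j)) = size K" by (simp add: K_def size_sum)
    then show ?thesis using 1 by simp
  next
    case 2
    have le: "size (k j) \<le> size (f j)" if "j < p" for j using k[OF that] by (rule size_mset_mono)
    have "(\<Sum>j<p. size (k j)) = (\<Sum>j<p. size (f j))"
      using arg_cong[OF 2, of size] by (simp add: K_def z size_sum del: size_rot) (simp add: size_sum)
    then have "size (k j) = size (f j)" if "j < p" for j
      using sum_mono_inv[of "\<lambda>j. size (k j)" "{..<p}" "\<lambda>j. size (f j)" j] le that by auto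
    then have "k j = f j" if "j < p" for j
      using k[OF that] that by (metis mset_subset_size nat_neq_iff subset_mset.le_imp_less_or_eq)
    then show ?thesis by blast
  qed
qed

text \<open>
  Together with empty subsums of the other components, a vanishing subsum of \<open>f i\<close> is a choice of
  subsums with the common value \<open>0\<close>. These cannot be all of the components, because no component
  is empty.
\<close>
lemma component_zero_free:
  assumes h: "minimal_vanishing h" and d: "top_decomp h p f" and i: "i < p"
    and k: "k \<subseteq># f i" "sum_mset k = 0"
  shows "k = {#}"
proof -
  define K where "K j = (if j = i then k else {#})" for j
  have p1: "p > 1" using top_decomp_props(2)[OF h d refl] prime_gt_1_nat by blast
  have "(\<forall>j<p. K j = {#}) \<or> (\<forall>j<p. K j = f j)"
    using k by (intro equal_subsums_trivial[OF h d, of K 0]) (auto simp: K_def)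
  then show ?thesis
  proof
    assume "\<forall>j<p. K j = {#}"
    then show ?thesis using i by (auto simp: K_def)
  next
    assume all: "\<forall>j<p. K j = f j"
    define j where "j = (if i = 0 then 1 else 0 :: nat)"
    have "j < p" "j \<noteq> i" using p1 by (auto simp: j_def)
    then have "f j = {#}" using all by (auto simp: K_def)
    then show ?thesis using top_decomp_props(8)[OF h d refl \<open>j < p\<close>] by (simp add: sorou_def)
  qed
qed

text \<open>
  The terms \<open>w\<close> of a rotation of \<open>h\<close> are sorted by the value of \<open>w\<^sup>M\<close>, which is a \<open>p\<close>-th root of
  unity. No class is empty: otherwise all classes would have the value \<open>0\<close>, so one of them would
  be everything by minimality, and \<open>p\<close> would not divide the relative order. The rotation takes a
  term of a smallest class to \<open>1\<close>; this makes the base a component of least weight that contains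
  \<open>1\<close>.
\<close>
lemma top_decomp_exists:
  assumes h: "minimal_vanishing h"
  shows "\<exists>f. top_decomp h (top_prime h) f"
proof -
  have so: "sorou h" using h vanishing_sorou by blast
  define p where "p = top_prime h"
  define M where "M = relative_order h div p"
  note t = top_prime_split[OF h p_def M_def]
  have p0: "p > 0" using t(1) prime_gt_0_nat by blast
  obtain v where v: "v \<in># h" using so by (auto simp: sorou_def)
  \<comment> \<open>The base term is chosen in a class modulo \<open>\<mu>\<^sub>M\<close> of least size.\<close>
  define cls where "cls w = size {#x \<in># h. (x / v) ^ M = (w / v) ^ M#}" for w
  obtain w where w: "w \<in># h" "\<And>x. x \<in># h \<Longrightarrow> cls w \<le> cls x"
    using ex_has_least_nat[of "\<lambda>x. x \<in># h" v cls] v by blast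
  have rv: "root_of_unity x" if "x \<in># h" for x using so that by (simp add: sorou_def)
  have nz: "x \<noteq> 0" if "x \<in># h" for x using rv[OF that] root_of_unity_ne_0 by blast
  have nup: "nu p \<noteq> 0" using root_of_unity_nu[OF p0] root_of_unity_ne_0 by blast
  define z where "z = 1 / w"
  have z: "root_of_unity z" unfolding z_def using rv w by (intro root_of_unity_inverse)
  define g where "g = rot z h"
  have mg: "minimal_vanishing g" unfolding g_def using h z minimal_vanishing_rot by blast
  have gN: "x ^ (p * M) = 1" if "x \<in># g" for x
    using that relative_order_ratio[OF so _ w(1)] t(2) by (auto simp: g_def z_def)
  define f where "f j = rot (1 / nu p ^ j) {#x \<in># g. x ^ M = nu p ^ (j * M)#}" for j
  have sum: "rot z h = (\<Sum>j<p. rot (nu p ^ j) (f j))"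
    using sum_mset_partition[of "{..<p}" g "\<lambda>j x. x ^ M = nu p ^ (j * M)"]
      ex1_component[OF t(1,4)] gN nup by (simp add: f_def g_def)
  have fM: "x ^ M = 1" if "x \<in># f j" for j x
    using that nup by (auto simp: f_def power_divide power_mult)
  have "sum_mset (\<Sum>j<p. rot (nu p ^ j) (f j)) = 0"
    by (simp add: sum[symmetric] minimal_vanishing_sum[OF h])
  then have eq: "sum_mset (f j) = sum_mset (f 0)" if "j < p" for j
    using that t fM by (intro equal_components[of p M f]) auto
  have 1: "1 \<in># f 0"
    using w(1) nz[OF w(1)] by (force simp: f_def g_def z_def)
  have ne: "f j \<noteq> {#}" if j: "j < p" for j
  proof
    assume "f j = {#}"
    then have "sum_mset (f 0) = 0" using eq[OF j] by simp
    then have "f 0 = {#} \<or> f 0 = g"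
      by (intro minimal_vanishing_sub[OF mg]) (simp_all add: f_def)
    then have "f 0 = g" using 1 by auto
    then have *: "(x / w) ^ M = 1" if "x \<in># h" for x
      using fM[of "z * x" 0] that by (auto simp: g_def z_def)
    have "relative_order h dvd M"
      unfolding relative_order_dvd_iff[OF so]
    proof (intro ballI)
      fix x y assume "x \<in># h" "y \<in># h"
      moreover have "x / y = (x / w) / (y / w)" using nz[OF w(1)] by simp
      ultimately show "(x / y) ^ M = 1" using * by (simp only: power_divide) simp
    qed
    then have "p * M \<le> M" using t by (simp add: dvd_imp_le)
    then show False using t prime_gt_1_nat[OF t(1)] by simp
  qed
  have size: "size (f j) = size {#x \<in># h. (x / v) ^ M = (nu p ^ j * w / v) ^ M#}" for j
  proof -
    have "size (f j) = size {#x \<in># g. x ^ M = nu p ^ (j * M)#}" by (simp add: f_def)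
    also have "\<dots> = size {#x \<in># h. (z * x) ^ M = nu p ^ (j * M)#}"
      by (simp add: g_def rot_def filter_mset_image_mset)
    also have "{#x \<in># h. (z * x) ^ M = nu p ^ (j * M)#} = {#x \<in># h. (x / v) ^ M = (nu p ^ j * w / v) ^ M#}"
      using nz[OF w(1)] nz[OF v]
      by (intro filter_mset_cong) (auto simp: z_def power_mult_distrib power_divide power_mult divide_simps)
    finally show ?thesis .
  qed
  have size0: "size (f 0) = cls w" by (simp add: size cls_def)
  have "size (f 0) \<le> size (f j)" if j: "j < p" for j
  proof -
    obtain y where y: "y \<in># f j" using ne[OF j] by auto
    then obtain x where x: "x \<in># h" "(z * x) ^ M = nu p ^ (j * M)" by (auto simp: f_def g_def)
    have "x ^ M / w ^ M = (nu p ^ j) ^ M" using x(2) by (simp add: z_def power_divide power_mult)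
    then have "(nu p ^ j * w / v) ^ M = (x / v) ^ M"
      using nz[OF w(1)] by (simp add: power_divide power_mult_distrib divide_simps)
    then have "size (f j) = cls x" unfolding size cls_def by simp
    then show ?thesis using w(2)[OF x(1)] size0 by simp
  qed
  moreover have "sorou (f j)" if j: "j < p" for j
    using ne[OF j] fM[of _ j] t(3) root_of_unityI[of M] by (auto simp: sorou_def)
  moreover have "root_order x dvd M" if "x \<in># f j" for j x
    using fM[OF that] t(3) root_of_unityI[of M x] by (simp add: root_order_dvd_iff)
  ultimately have "top_decomp h p f"
    unfolding top_decomp_def using z sum 1 by (auto simp: p_def[symmetric] M_def[symmetric])
  then show ?thesis by (auto simp: p_def)
qed

lemma image_mset_roots_of_unity:
  assumes p: "prime p" "\<not> p dvd M"
  shows "image_mset (\<lambda>j. F (nu p ^ (j * M))) (mset_set {..<p}) = image_mset F (mset_set {u. u ^ p = 1})"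
proof -
  have "mset_set {u. u ^ p = 1} = image_mset (\<lambda>j. nu p ^ (j * M)) (mset_set {..<p})"
    using image_mset_mset_set[OF nu_power_times_image(2)[OF p]] nu_power_times_image(1)[OF p] by simp
  then show ?thesis by (simp add: image_mset.compositionality o_def)
qed

lemma image_mset_times_root:
  assumes c: "c ^ p = 1" "p > 0"
  shows "image_mset (\<lambda>u. F (c * u)) (mset_set {u::complex. u ^ p = 1}) =
      image_mset F (mset_set {u. u ^ p = 1})"
proof -
  have c0: "c \<noteq> 0" using c by (auto simp: power_0_left)
  have inj: "inj_on (\<lambda>u. c * u) {u. u ^ p = 1}" using c0 by (auto simp: inj_on_def)
  have "(\<lambda>u. c * u) ` {u. u ^ p = 1} = {u. u ^ p = 1}"
  proof (intro equalityI subsetI)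
    fix u :: complex assume "u \<in> {u. u ^ p = 1}"
    then show "u \<in> (\<lambda>u. c * u) ` {u. u ^ p = 1}"
      using c c0 by (intro image_eqI[of _ _ "u / c"]) (auto simp: power_divide)
  qed (auto simp: power_mult_distrib c)
  then have "mset_set {u. u ^ p = 1} = image_mset (\<lambda>u. c * u) (mset_set {u. u ^ p = 1})"
    using image_mset_mset_set[OF inj] by simp
  from arg_cong[OF this, of "image_mset F"] show ?thesis
    by (simp add: image_mset.compositionality o_def)
qed

text \<open>
  Two decompositions come from rotations that differ by an element of \<open>\<mu>\<^sub>N\<close>, which only permutes
  the classes modulo \<open>\<mu>\<^sub>M\<close>; hence the weights form an invariant of \<open>h\<close>.
\<close>
lemma component_sizes_unique:
  assumes h: "minimal_vanishing h" and d: "top_decomp h p f" and d': "top_decomp h p f'"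
  shows "image_mset (\<lambda>j. size (f j)) (mset_set {..<p}) = image_mset (\<lambda>j. size (f' j)) (mset_set {..<p})"
proof -
  define M where "M = relative_order h div p"
  note t = top_decomp_props[OF h d M_def]
  have so: "sorou h" using h vanishing_sorou by blast
  obtain v where v: "v \<in># h" using so by (auto simp: sorou_def)
  have v0: "v \<noteq> 0" using so v root_of_unity_ne_0 by (auto simp: sorou_def)
  have *: "\<exists>c. c ^ p = 1 \<and> image_mset (\<lambda>j. size (f j)) (mset_set {..<p}) =
      image_mset (\<lambda>u. size {#w \<in># h. (w / v) ^ M = u * c#}) (mset_set {u. u ^ p = 1})"
    if d: "top_decomp h p f" for f
  proof -
    note t' = top_decomp_props[OF h d M_def]
    obtain z where z: "root_of_unity z" "rot z h = (\<Sum>j<p. rot (nu p ^ j) (f j))"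
      using d by (auto simp: top_decomp_def)
    have z0: "z \<noteq> 0" using z root_of_unity_ne_0 by blast
    define c where "c = 1 / (z * v) ^ M"
    have "z * v \<in># rot z h" unfolding set_mset_rot using v by (rule imageI)
    then obtain j u where "j < p" "u \<in># f j" "z * v = nu p ^ j * u"
      unfolding z(2) by (auto simp: set_mset_sum)
    then have "(z * v) ^ (p * M) = 1"
      using t'(9)[of j u] prime_gt_0_nat[OF t(2)] by (simp add: nu_power_times_root)
    then have "c ^ p = 1" by (simp add: c_def power_divide power_mult[symmetric] mult.commute)
    moreover have "size (f j) = size {#w \<in># h. (w / v) ^ M = nu p ^ (j * M) * c#}" if j: "j < p" for j
    proof -
      have "size (f j) = size (rot (nu p ^ j) (f j))" by simp
      also have "rot (nu p ^ j) (f j) = {#w \<in># rot z h. w ^ M = nu p ^ (j * M)#}"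
        unfolding z(2) using component_eq_filter[OF t(2,5) t'(9) j] by simp
      also have "size \<dots> = size {#w \<in># h. (z * w) ^ M = nu p ^ (j * M)#}"
        by (simp add: rot_def filter_mset_image_mset)
      also have "{#w \<in># h. (z * w) ^ M = nu p ^ (j * M)#} = {#w \<in># h. (w / v) ^ M = nu p ^ (j * M) * c#}"
        using v0 z0
        by (intro filter_mset_cong)
          (auto simp: c_def power_mult_distrib power_divide divide_simps mult.commute)
      finally show ?thesis .
    qed
    then have "image_mset (\<lambda>j. size (f j)) (mset_set {..<p}) =
        image_mset (\<lambda>j. size {#w \<in># h. (w / v) ^ M = nu p ^ (j * M) * c#}) (mset_set {..<p})"
      by (intro image_mset_cong) auto
    ultimately show ?thesis
      using image_mset_roots_of_unity[OF t(2,5), of "\<lambda>u. size {#w \<in># h. (w / v) ^ M = u * c#}"] by auto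
  qed
  have shift: "image_mset (\<lambda>u. F (u * c)) (mset_set {u. u ^ p = 1}) =
      image_mset F (mset_set {u. u ^ p = 1})"
    if c: "c ^ p = 1" for c :: complex and F :: "complex \<Rightarrow> nat"
    using image_mset_times_root[OF c prime_gt_0_nat[OF t(2)], of F] by (simp add: mult.commute)
  define F where "F u = size {#w \<in># h. (w / v) ^ M = u#}" for u
  have "image_mset (\<lambda>j. size (f j)) (mset_set {..<p}) = image_mset F (mset_set {u. u ^ p = 1})"
    if "top_decomp h p f" for f
    using *[OF that] shift[of _ F] unfolding F_def by auto
  then show ?thesis using d d' by simp
qed

lemma has_weight_partition_iff:
  assumes h: "minimal_vanishing h" and d: "top_decomp h p f"
  shows "has_weight_partition h W \<longleftrightarrow>
      W = sorted_list_of_multiset (image_mset (\<lambda>j. size (f j)) (mset_set {..<p}))"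
proof -
  have *: "sort (map (\<lambda>j. size (f j)) [0..<p]) =
      sorted_list_of_multiset (image_mset (\<lambda>j. size (f j))
        (mset_set {..<p}))" for f :: "nat \<Rightarrow> complex multiset"
    by (metis lessThan_atLeast0 mset_map mset_upt sorted_list_of_multiset_mset)
  show ?thesis
  proof
    assume "has_weight_partition h W"
    then obtain p' f' where d': "top_decomp h p' f'" "W = sort (map (\<lambda>j. size (f' j)) [0..<p'])"
      by (auto simp: has_weight_partition_def)
    then have "p' = p" using d by (simp add: top_decomp_def)
    then show "W = sorted_list_of_multiset (image_mset (\<lambda>j. size (f j)) (mset_set {..<p}))"
      using d' component_sizes_unique[OF h d, of f'] * by simp
  next
    assume "W = sorted_list_of_multiset (image_mset (\<lambda>j. size (f j)) (mset_set {..<p}))"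
    then show "has_weight_partition h W"
      unfolding has_weight_partition_def using d *[of f] by (intro exI[of _ p] exI[of _ f]) simp
  qed
qed

section \<open>Building minimal vanishing sums\<close>

text \<open>
  The converse of the two facts on equal values: by \<open>equal_components\<close> a vanishing subsum of \<open>h\<close>
  consists of subsums of the components with a common value, so the condition \<open>min\<close> gives
  minimality. As the component \<open>f 1\<close> is nonempty and \<open>h\<close> contains \<open>1\<close>, some ratio of terms has an
  order divisible by \<open>p\<close>; so \<open>p\<close> is the top prime, as the prime factors of \<open>M\<close> are smaller.
\<close>
lemma minimal_vanishing_of_components:
  assumes p: "prime p" "\<not> p dvd M" "M > 0" "\<And>q. prime q \<Longrightarrow> q dvd M \<Longrightarrow> q < p"
    and ne: "\<And>j. j < p \<Longrightarrow> f j \<noteq> {#}"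
    and fM: "\<And>j w. j < p \<Longrightarrow> w \<in># f j \<Longrightarrow> w ^ M = 1"
    and eq: "\<And>j. j < p \<Longrightarrow> sum_mset (f j) = sum_mset (f 0)"
    and le: "\<And>j. j < p \<Longrightarrow> size (f 0) \<le> size (f j)" and one: "1 \<in># f 0"
    and min: "\<And>k c. (\<And>j. j < p \<Longrightarrow> k j \<subseteq># f j \<and> sum_mset (k j) = c) \<Longrightarrow>
      (\<forall>j<p. k j = {#}) \<or> (\<forall>j<p. k j = f j)"
    and h: "h = (\<Sum>j<p. rot (nu p ^ j) (f j))"
  shows "minimal_vanishing h" and "top_decomp h p f"
proof -
  have p1: "p > 1" using p prime_gt_1_nat by blast
  have hM: "w ^ (p * M) = 1" if "w \<in># h" for w
  proof -
    have "w \<in># (\<Sum>j<p. rot (nu p ^ j) (f j))" using that h by simp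
    then obtain j u where "j < p" "u \<in># f j" "w = nu p ^ j * u"
      by (auto simp: set_mset_sum)
    then show "w ^ (p * M) = 1" using fM[of j u] p1 by (simp add: nu_power_times_root)
  qed
  have h1: "1 \<in># h" unfolding h using one p1 by (auto simp: set_mset_sum intro!: bexI[of _ 0])
  have so: "sorou h"
    using h1 hM p1 p(3) by (auto simp: sorou_def intro!: root_of_unityI[of "p * M"])
  have nup: "nu p \<noteq> 0" using root_of_unity_nu[of p] root_of_unity_ne_0 p1 by auto
  show mh: "minimal_vanishing h"
  proof (rule minimal_vanishingI[OF so])
    have "sum_mset h = (\<Sum>j<p. nu p ^ j * sum_mset (f j))" by (simp add: h sum_mset_sum)
    also have "\<dots> = (\<Sum>j<p. nu p ^ j * sum_mset (f 0))"
    proof (rule sum.cong[OF refl])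
      fix j assume "j \<in> {..<p}"
      then show "nu p ^ j * sum_mset (f j) = nu p ^ j * sum_mset (f 0)" using eq[of j] by simp
    qed
    also have "\<dots> = 0" using p1 by (simp add: sum_distrib_right[symmetric] sum_nu_powers)
    finally show "sum_mset h = 0" .
    fix g assume g: "g \<subseteq># h" "sum_mset g = 0"
    define k where "k j = rot (1 / nu p ^ j) {#w \<in># g. w ^ M = nu p ^ (j * M)#}" for j
    have gs: "g = (\<Sum>j<p. rot (nu p ^ j) (k j))"
      using sum_mset_partition[of "{..<p}" g "\<lambda>j x. x ^ M = nu p ^ (j * M)"]
        ex1_component[OF p(1,2)] hM g(1) nup by (simp add: k_def mset_subset_eqD)
    have kf: "k j \<subseteq># f j" if "j < p" for j
    proof -
      have "{#w \<in># g. w ^ M = nu p ^ (j * M)#} \<subseteq># {#w \<in># h. w ^ M = nu p ^ (j * M)#}"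
        using g(1) by (rule multiset_filter_mono)
      also have "\<dots> = rot (nu p ^ j) (f j)"
        unfolding h using component_eq_filter[OF p(1,2) fM that] by simp
      finally show ?thesis using rot_mono[of _ "rot (nu p ^ j) (f j)" "1 / nu p ^ j"] nup
        by (fastforce simp: k_def)
    qed
    have kM: "w ^ M = 1" if "j < p" "w \<in># k j" for j w
      using that kf fM by (meson mset_subset_eqD)
    have "sum_mset (k j) = sum_mset (k 0)" if "j < p" for j
      using g(2) gs p that kM by (intro equal_components[of p M k]) auto
    then have "(\<forall>j<p. k j = {#}) \<or> (\<forall>j<p. k j = f j)" using kf by (intro min) blast
    then show "g = {#} \<or> g = h"
      using gs h by auto
  qed
  define N where "N = relative_order h"
  have N: "N dvd p * M"
    unfolding N_def relative_order_dvd_iff[OF so] using hM by (simp add: power_divide)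
  have hN: "w ^ N = 1" if "w \<in># h" for w
    using relative_order_ratio[OF so that h1] by (simp add: N_def)
  have N0: "N > 0" using relative_order_pos[OF so] by (simp add: N_def)
  have pN: "p dvd N"
  proof -
    obtain w where w: "w \<in># f 1" using ne[OF p1] by auto
    then have "nu p * w \<in># h" unfolding h using p1 by (auto simp: set_mset_sum intro!: bexI[of _ 1])
    then have "((nu p * w) ^ N) ^ M = 1" using hN by simp
    moreover have "((nu p * w) ^ N) ^ M = nu p ^ (N * M) * (w ^ M) ^ N"
      by (simp add: power_mult_distrib power_mult[symmetric] mult.commute)
    ultimately have "nu p ^ (N * M) = 1" using fM[OF p1 w] by simp
    then have "p dvd N * M" using p1 by (simp add: nu_power_eq_1_iff)
    then show ?thesis using p by (simp add: prime_dvd_mult_iff)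
  qed
  have top: "p = top_prime h"
  proof (rule top_primeI[symmetric])
    show "prime p" "p dvd relative_order h" "relative_order h > 0" using p pN N0 by (auto simp: N_def)
    fix q assume q: "prime q" "q dvd relative_order h"
    then have "q dvd p * M" using N by (metis N_def dvd_trans)
    then show "q \<le> p" using p q(1)
      by (metis dvd_imp_le less_imp_le_nat p1 order_less_trans prime_dvd_mult_iff zero_less_one)
  qed
  have ru: "root_of_unity w" if "j < p" "w \<in># f j" for j w
    using fM[OF that] p(3) root_of_unityI by blast
  have "root_order w dvd relative_order h div p" if j: "j < p" and w: "w \<in># f j" for j w
  proof -
    have "nu p ^ j * w \<in># h" unfolding h using j w by (auto simp: set_mset_sum)
    then have "(nu p ^ j * w) ^ N = 1" by (rule hN)
    moreover have "(nu p ^ j) ^ N = 1"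
      using pN p1 by (metis dvd_mult nu_power_eq_1_iff order_less_trans power_mult zero_less_one)
    ultimately have "w ^ N = 1" by (simp add: power_mult_distrib)
    then have "root_order w dvd N" using ru[OF j w] by (simp add: root_order_dvd_iff)
    then have "root_order w dvd p * (N div p)" using pN by simp
    moreover have "root_order w dvd M" using fM[OF j w] ru[OF j w] by (simp add: root_order_dvd_iff)
    then have "coprime (root_order w) p"
      using p by (metis coprime_commute dvd_trans prime_imp_coprime)
    ultimately show ?thesis by (simp add: coprime_dvd_mult_right_iff N_def)
  qed
  moreover have "sorou (f j)" if "j < p" for j
    using ne[OF that] ru[OF that] by (auto simp: sorou_def)
  moreover have "root_of_unity 1 \<and> rot 1 h = (\<Sum>j<p. rot (nu p ^ j) (f j))"
    unfolding rot_1 using h by (intro conjI root_of_unity_1)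
  ultimately show "top_decomp h p f"
    unfolding top_decomp_def using top one le by blast
qed

section \<open>Rotation invariance of types\<close>

lemma top_prime_rot: "z \<noteq> 0 \<Longrightarrow> top_prime (rot z h) = top_prime h"
  by (simp add: top_prime_def relative_order_rot)

lemma top_decomp_rot:
  assumes c: "root_of_unity c" and d: "top_decomp h p f"
  shows "top_decomp (rot c h) p f"
proof -
  have c0: "c \<noteq> 0" using c root_of_unity_ne_0 by blast
  obtain z where z: "root_of_unity z" "rot z h = (\<Sum>j<p. rot (nu p ^ j) (f j))"
    using d by (auto simp: top_decomp_def)
  have "root_of_unity (z / c)" "rot (z / c) (rot c h) = (\<Sum>j<p. rot (nu p ^ j) (f j))"
    using z c c0 root_of_unity_divide by auto
  then show ?thesis using d c0 unfolding top_decomp_def by (auto simp: relative_order_rot top_prime_rot)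
qed

lemma has_type_minimal: "has_type h T \<Longrightarrow> minimal_vanishing h"
  by (erule has_type.cases) auto

lemma has_type_rot:
  assumes "has_type h T" and c: "root_of_unity c"
  shows "has_type (rot c h) T"
  using assms(1)
proof cases
  case (Rp p f)
  show ?thesis unfolding Rp(1)
    by (rule has_type_has_sum_type.Rp[OF minimal_vanishing_rot[OF c Rp(2)] top_decomp_rot[OF c Rp(3)]
      Rp(4)])
next
  case (Comp p f J T)
  show ?thesis unfolding Comp(1)
    by (rule has_type_has_sum_type.Comp[OF minimal_vanishing_rot[OF c Comp(2)] top_decomp_rot[OF c Comp(3)]
      Comp(4-6)])
qed

text \<open>
  Which term of the base is rotated to \<open>1\<close> is a matter of choice. For a base \<open>1 + a\<close> this allows
  to replace \<open>a\<close> by \<open>1 / a\<close>.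
\<close>
lemma top_decomp_rebase:
  assumes h: "minimal_vanishing h" and d: "top_decomp h p f" and c: "c \<in># f 0"
  shows "top_decomp h p (\<lambda>j. rot (1 / c) (f j))"
proof -
  define M where "M = relative_order h div p"
  note t = top_decomp_props[OF h d M_def]
  have p0: "p > 0" using t prime_gt_0_nat by blast
  have rc: "root_of_unity c" using t(8)[OF p0] c by (auto simp: sorou_def)
  have c0: "c \<noteq> 0" using rc root_of_unity_ne_0 by blast
  obtain z where z: "root_of_unity z" "rot z h = (\<Sum>j<p. rot (nu p ^ j) (f j))"
    using d by (auto simp: top_decomp_def)
  have ri: "root_of_unity (1 / c)" using rc root_of_unity_inverse by blast
  have "rot (1 / c * z) h = rot (1 / c) (\<Sum>j<p. rot (nu p ^ j) (f j))" using z(2) by (metis rot_rot)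
  then have "rot (1 / c * z) h = (\<Sum>j<p. rot (nu p ^ j) (rot (1 / c) (f j)))"
    by (simp add: rot_sum mult.commute)
  moreover have "root_of_unity (1 / c * z)" using ri z(1) by (rule root_of_unity_mult)
  moreover have "sorou (rot (1 / c) (f j))" if "j < p" for j using t(8)[OF that] sorou_rot[OF ri] by blast
  moreover have "root_order w dvd M" if j: "j < p" and w: "w \<in># rot (1 / c) (f j)" for j w
  proof -
    obtain u where u: "u \<in># f j" "w = 1 / c * u" using w by auto
    then have "w ^ M = 1" using t(9)[OF j u(1)] t(9)[OF p0 c] by (simp add: power_divide)
    then show ?thesis using root_of_unityI[OF t(4)] by (simp add: root_order_dvd_iff)
  qed
  moreover have "1 \<in># rot (1 / c) (f 0)" using c c0 by force
  ultimately show ?thesis using d unfolding top_decomp_def M_def size_rot by blast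
qed

section \<open>Parity\<close>

text \<open>
  Parity compares the two cosets of the group of roots of unity of odd order in the group
  \<open>{1, -1}\<close> times that group. The larger group contains all roots of unity of squarefree order,
  and the rotation by one of its elements keeps or exchanges the two cosets.
\<close>
definition odd_root :: "complex \<Rightarrow> bool" where
  "odd_root w \<longleftrightarrow> (\<exists>m. odd m \<and> w ^ m = 1)"

definition signed_odd_root :: "complex \<Rightarrow> bool" where
  "signed_odd_root w \<longleftrightarrow> odd_root w \<or> odd_root (- w)"

definition odds :: "complex multiset \<Rightarrow> nat" where
  "odds h = size {#w \<in># h. odd_root w#}"

lemma odd_rootI: "odd m \<Longrightarrow> w ^ m = 1 \<Longrightarrow> odd_root w"
  by (auto simp: odd_root_def)

lemma odd_root_1 [simp]: "odd_root 1"
  by (rule odd_rootI[of 1]) auto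

lemma odd_root_mult:
  assumes "odd_root v" "odd_root w" shows "odd_root (v * w)"
proof -
  obtain m n where "odd m" "v ^ m = 1" "odd n" "w ^ n = 1" using assms by (auto simp: odd_root_def)
  moreover have "(v * w) ^ (m * n) = (v ^ m) ^ n * (w ^ n) ^ m"
    by (simp only: power_mult_distrib power_mult[symmetric] mult.commute)
  ultimately show ?thesis by (intro odd_rootI[of "m * n"]) auto
qed

lemma odd_root_inverse: "odd_root w \<Longrightarrow> odd_root (1 / w)"
  unfolding odd_root_def by (metis div_by_1 power_divide power_one)

lemma odd_root_power: "odd_root w \<Longrightarrow> odd_root (w ^ k)"
  by (induction k) (auto intro: odd_root_mult)

lemma odd_root_nu: "odd p \<Longrightarrow> odd_root (nu p)"
  by (rule odd_rootI[of p]) (auto simp: odd_pos)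

lemma odd_root_ne_0: "odd_root w \<Longrightarrow> w \<noteq> 0"
  by (auto simp: odd_root_def power_0_left split: if_splits)

lemma not_odd_root_minus:
  assumes "odd_root w" shows "\<not> odd_root (- w)"
proof
  assume "odd_root (- w)"
  then obtain m n where *: "odd m" "w ^ m = 1" "odd n" "(- w) ^ n = 1"
    using assms by (auto simp: odd_root_def)
  have "(- w) ^ (n * m) = 1" using * by (simp only: power_mult) simp
  moreover have "(- w) ^ (n * m) = - (w ^ (m * n))" using * by (simp add: mult.commute)
  moreover have "w ^ (m * n) = 1" using * by (simp only: power_mult) simp
  ultimately show False by simp
qed

lemma odd_root_mult_left: "odd_root c \<Longrightarrow> odd_root (c * w) \<longleftrightarrow> odd_root w"
  using odd_root_mult[of c w] odd_root_mult[of "1 / c" "c * w"] odd_root_inverse[of c] odd_root_ne_0[of c]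
  by auto

lemma signed_odd_root_minus: "signed_odd_root w \<Longrightarrow> signed_odd_root (- w)"
  by (auto simp: signed_odd_root_def)

lemma odd_root_minus_iff: "signed_odd_root w \<Longrightarrow> odd_root (- w) \<longleftrightarrow> \<not> odd_root w"
  using not_odd_root_minus by (auto simp: signed_odd_root_def)

lemma signed_odd_root_mult:
  assumes "signed_odd_root v" "signed_odd_root w"
  shows "signed_odd_root (v * w)" and "odd_root (v * w) \<longleftrightarrow> (odd_root v \<longleftrightarrow> odd_root w)"
proof -
  have "signed_odd_root (v * w) \<and> (odd_root (v * w) \<longleftrightarrow> (odd_root v \<longleftrightarrow> odd_root w))"
  proof (cases "odd_root v")
    case True
    then show ?thesis
      using assms odd_root_mult_left[OF True, of w] odd_root_mult_left[OF True, of "- w"]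
      by (auto simp: signed_odd_root_def)
  next
    case False
    then have v: "odd_root (- v)" using assms by (auto simp: signed_odd_root_def)
    show ?thesis
      using assms False odd_root_mult_left[OF v, of w] odd_root_mult_left[OF v, of "- w"]
        not_odd_root_minus[of w] not_odd_root_minus[of "- w"]
      by (auto simp: signed_odd_root_def)
  qed
  then show "signed_odd_root (v * w)" and "odd_root (v * w) \<longleftrightarrow> (odd_root v \<longleftrightarrow> odd_root w)"
    by auto
qed

lemma signed_odd_root_inverse: "signed_odd_root w \<Longrightarrow> signed_odd_root (1 / w)"
  using odd_root_inverse[of w] odd_root_inverse[of "- w"] by (auto simp: signed_odd_root_def)

lemma odd_root_order_iff:
  assumes "root_of_unity w" shows "odd (root_order w) \<longleftrightarrow> odd_root w"
proof
  assume "odd (root_order w)"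
  then show "odd_root w" using root_order_props(2)[OF assms] by (rule odd_rootI)
next
  assume "odd_root w"
  then obtain m where "odd m" "w ^ m = 1" by (auto simp: odd_root_def)
  then have "root_order w dvd m" using root_order_dvd_iff[OF assms] by simp
  then show "odd (root_order w)" using \<open>odd m\<close> by (meson dvd_trans)
qed

lemma signed_odd_root_squarefree:
  assumes N: "squarefree N" and w: "w ^ N = 1"
  shows "signed_odd_root w"
proof (cases "odd N")
  case True
  then show ?thesis using w odd_rootI by (auto simp: signed_odd_root_def)
next
  case False
  then have "even N" by simp
  then obtain m where m: "N = 2 * m" by (elim evenE)
  have "odd m"
  proof
    assume "even m"
    then have "2\<^sup>2 dvd N" unfolding m by (auto elim!: evenE)
    then have "is_unit (2::nat)" using N by (rule squarefreeD[rotated])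
    then show False by simp
  qed
  have "(w ^ m) ^ 2 = 1" using w by (simp add: m power_mult[symmetric] mult.commute)
  then have "w ^ m = 1 \<or> w ^ m = - 1" by (simp add: power2_eq_1_iff)
  then show ?thesis
  proof
    assume "w ^ m = 1"
    then show ?thesis using odd_rootI[OF \<open>odd m\<close>] by (simp add: signed_odd_root_def)
  next
    assume "w ^ m = - 1"
    then have "(- w) ^ m = 1" using \<open>odd m\<close> by simp
    then show ?thesis using odd_rootI[OF \<open>odd m\<close>] by (simp add: signed_odd_root_def)
  qed
qed

lemma odds_empty [simp]: "odds {#} = 0"
  by (simp add: odds_def)

lemma odds_add_mset [simp]: "odds (add_mset w g) = (if odd_root w then 1 else 0) + odds g"
  by (simp add: odds_def)

lemma odds_plus [simp]: "odds (g + h) = odds g + odds h"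
  by (simp add: odds_def)

lemma odds_sum: "odds (\<Sum>j\<in>A. f j) = (\<Sum>j\<in>A. odds (f j))"
  by (induction A rule: infinite_finite_induct) simp_all

lemma odds_le: "odds g \<le> size g"
  by (simp add: odds_def size_filter_mset_lesseq)

lemma odds_rot_odd: "odd_root c \<Longrightarrow> odds (rot c g) = odds g"
  by (induction g) (simp_all add: odd_root_mult_left)

lemma odds_rot_minus_1: "\<forall>w\<in>#g. signed_odd_root w \<Longrightarrow> odds (rot (- 1) g) = size g - odds g"
proof (induction g)
  case (add w g)
  then show ?case using odd_root_minus_iff[of w] odds_le[of g] by auto
qed simp

lemma odds_rot_signed:
  assumes "signed_odd_root c" "\<forall>w\<in>#g. signed_odd_root w"
  shows "odds (rot c g) = odds g \<or> odds (rot c g) = size g - odds g"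
proof (cases "odd_root c")
  case True
  then show ?thesis by (simp add: odds_rot_odd)
next
  case False
  then have c: "odd_root (- c)" using assms by (auto simp: signed_odd_root_def)
  have "rot c g = rot (- c) (rot (- 1) g)" by simp
  then have "odds (rot c g) = odds (rot (- 1) g)" by (simp only: odds_rot_odd[OF c])
  then show ?thesis using odds_rot_minus_1 assms by simp
qed

lemma sorou_order_dvd_iff:
  assumes "sorou h" shows "sorou_order h dvd n \<longleftrightarrow> (\<forall>w\<in>#h. w ^ n = 1)"
  using assms by (auto simp: sorou_order_def Lcm_dvd_iff sorou_def root_order_dvd_iff)

text \<open>
  Any rotation of \<open>h\<close> into the group of signed odd roots can be used to count: two of them differ
  by an element of that group, so at most the two numbers are exchanged, and the pair is
  unordered. A rotation of the order demanded in the definition is obtained by taking some term to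
  \<open>1\<close>.
\<close>
lemma has_parity_iff:
  assumes h: "minimal_vanishing h" and z: "root_of_unity z"
    and s: "\<forall>w\<in>#rot z h. signed_odd_root w"
  shows "has_parity h P \<longleftrightarrow> P = Upair (odds (rot z h)) (size h - odds (rot z h))"
proof -
  have so: "sorou h" using h vanishing_sorou by blast
  have z0: "z \<noteq> 0" using z root_of_unity_ne_0 by blast
  have sq: "squarefree (relative_order h)" using h by (rule squarefree_relative_order)
  obtain v where v: "v \<in># h" using so by (auto simp: sorou_def)
  have rv: "root_of_unity v" using so v by (simp add: sorou_def)
  have v0: "v \<noteq> 0" using rv root_of_unity_ne_0 by blast
  have *: "Upair (size {#w \<in># rot z' h. odd (root_order w)#}) (size {#w \<in># rot z' h. even (root_order w)#})
      =
      Upair (odds (rot z h)) (size h - odds (rot z h))"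
    if z': "root_of_unity z'" "sorou_order (rot z' h) = relative_order h" for z'
  proof -
    have so': "sorou (rot z' h)" using so sorou_rot z' by blast
    then have "\<forall>w\<in>#rot z' h. w ^ relative_order h = 1"
      using sorou_order_dvd_iff[OF so', of "relative_order h"] z' by simp
    then have s': "\<forall>w\<in>#rot z' h. signed_odd_root w" using signed_odd_root_squarefree[OF sq] by blast
    have "size {#w \<in># rot z' h. odd (root_order w)#} = odds (rot z' h)"
      unfolding odds_def using so'
      by (intro arg_cong[of _ _ size] filter_mset_cong refl)
        (auto simp: odd_root_order_iff sorou_def simp del: set_mset_rot)
    moreover have "size {#w \<in># rot z' h. odd (root_order w)#} +
        size {#w \<in># rot z' h. even (root_order w)#} = size h"
      by (metis multiset_partition size_rot size_union add.commute)
    moreover have "odds (rot z' h) = odds (rot z h) \<or> odds (rot z' h) = size h - odds (rot z h)"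
    proof -
      have "signed_odd_root (z' * v)" "signed_odd_root (z * v)" using s s' v by auto
      then have "signed_odd_root (z' * v * (1 / (z * v)))"
        using signed_odd_root_mult(1) signed_odd_root_inverse by blast
      then have "signed_odd_root (z' / z)" using v0 by simp
      moreover have "rot z' h = rot (z' / z) (rot z h)" using z0 by simp
      ultimately show ?thesis using odds_rot_signed[of "z' / z" "rot z h"] s by (metis size_rot)
    qed
    ultimately show ?thesis using odds_le[of "rot z h"] by auto
  qed
  have "\<exists>z'. root_of_unity z' \<and> sorou_order (rot z' h) = relative_order h"
  proof (intro exI conjI)
    show r: "root_of_unity (1 / v)" using rv by (rule root_of_unity_inverse)
    have so': "sorou (rot (1 / v) h)" using so sorou_rot r by blast
    have "sorou_order (rot (1 / v) h) dvd relative_order h"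
      unfolding sorou_order_dvd_iff[OF so'] using relative_order_ratio[OF so _ v] by auto
    moreover have "\<forall>w\<in>#rot (1 / v) h. w ^ sorou_order (rot (1 / v) h) = 1"
      by (rule sorou_order_dvd_iff[OF so', THEN iffD1, OF dvd_refl])
    then have "\<forall>x\<in>#rot (1 / v) h. \<forall>y\<in>#rot (1 / v) h. (x / y) ^ sorou_order (rot (1 / v) h) = 1"
      unfolding power_divide by (intro ballI) (simp del: set_mset_rot)
    then have "relative_order (rot (1 / v) h) dvd sorou_order (rot (1 / v) h)"
      unfolding relative_order_dvd_iff[OF so'] .
    then have "relative_order h dvd sorou_order (rot (1 / v) h)"
      using v0 by (simp add: relative_order_rot)
    ultimately show "sorou_order (rot (1 / v) h) = relative_order h" by (rule dvd_antisym)
  qed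
  then obtain z' where z': "root_of_unity z'" "sorou_order (rot z' h) = relative_order h" by blast
  show ?thesis
  proof
    assume "has_parity h P"
    then show "P = Upair (odds (rot z h)) (size h - odds (rot z h))"
      unfolding has_parity_def by (elim exE conjE) (simp only: *)
  next
    assume P: "P = Upair (odds (rot z h)) (size h - odds (rot z h))"
    show "has_parity h P"
      unfolding has_parity_def P using z' *[OF z', symmetric] by (intro exI[of _ z'] conjI)
  qed
qed

section \<open>Invariants read off from the type\<close>

text \<open>
  If \<open>f\<^sub>0 - f\<^sub>j\<close> has the type \<open>T\<close>, then \<open>f\<^sub>j\<close> has \<open>type_size T - size f\<^sub>0\<close> terms instead of
  \<open>size f\<^sub>0\<close>, which explains the factor \<open>2\<close> in front of the subtracted term.
\<close>
primrec type_size :: "mv_type \<Rightarrow> nat" where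
  "type_size (Rp p) = p"
| "type_size (Comp p f0 Ts) =
    p * size f0 + sum_mset (image_mset sum_mset (image_mset (image_mset type_size) Ts))
      - 2 * size Ts * size f0"

lemma components_split:
  assumes J: "J = {j\<in>{1..<p}. f j \<noteq> f 0}" and p: "p > 0"
  shows "image_mset (\<lambda>j. G (f j)) (mset_set {..<p}) =
    replicate_mset (p - card J) (G (f 0)) + image_mset (\<lambda>j. G (f j)) (mset_set J)"
proof -
  have sub: "J \<subseteq> {..<p}" using J by auto
  have fin: "finite J" using J by simp
  have "mset_set {..<p} = mset_set ({..<p} - J \<union> J)" using sub by (simp add: Un_absorb2)
  also have "\<dots> = mset_set ({..<p} - J) + mset_set J"
    using fin by (intro mset_set_Union) auto
  finally have "image_mset (\<lambda>j. G (f j)) (mset_set {..<p}) =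
      image_mset (\<lambda>j. G (f j)) (mset_set ({..<p} - J)) + image_mset (\<lambda>j. G (f j)) (mset_set J)" by simp
  moreover have "image_mset (\<lambda>j. G (f j)) (mset_set ({..<p} - J)) =
      image_mset (\<lambda>_. G (f 0)) (mset_set ({..<p} - J))"
  proof (rule image_mset_cong)
    fix j assume "j \<in># mset_set ({..<p} - J)"
    then have "f j = f 0" using J by (cases "j = 0") auto
    then show "G (f j) = G (f 0)" by simp
  qed
  moreover have "card ({..<p} - J) = p - card J" using sub fin by (simp add: card_Diff_subset)
  ultimately show ?thesis by (simp add: image_mset_const_eq)
qed

text \<open>
  If all components agree, then the subsums \<open>1\<close> of the components have equal values, so they are
  the whole components.
\<close>
lemma equal_components_singleton:
  assumes h: "minimal_vanishing h" and d: "top_decomp h p f" and eq: "\<forall>j<p. f j = f 0"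
  shows "f 0 = {#1#}"
proof -
  have p0: "p > 0" using top_decomp_props(2)[OF h d refl] prime_gt_0_nat by blast
  have 1: "1 \<in># f 0" using d by (simp add: top_decomp_def)
  have "{#1#} \<subseteq># f j" if "j < p" for j using 1 eq[rule_format, OF that] by simp
  then have "(\<forall>j<p. {#1::complex#} = {#}) \<or> (\<forall>j<p. {#1#} = f j)"
    by (intro equal_subsums_trivial[OF h d, of "\<lambda>_. {#1#}" 1]) simp_all
  then show ?thesis using p0 by auto
qed

lemma size_components:
  assumes "top_decomp h p f" shows "size h = (\<Sum>j<p. size (f j))"
proof -
  obtain z where "rot z h = (\<Sum>j<p. rot (nu p ^ j) (f j))" using assms by (auto simp: top_decomp_def)
  then have "size (rot z h) = size (\<Sum>j<p. rot (nu p ^ j) (f j))" by simp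
  then show ?thesis by (simp add: size_sum)
qed

lemma has_type_size:
  "has_type h T \<Longrightarrow> size h = type_size T"
  "has_sum_type h X \<Longrightarrow> size h = sum_mset (image_mset type_size X)"
proof (induction rule: has_type_has_sum_type.inducts)
  case (Rp h p f)
  have "f 0 = {#1#}" using Rp equal_components_singleton by blast
  then have "size (f j) = 1" if "j < p" for j
    using Rp(3)[rule_format, OF that] by simp
  then show ?case using size_components[OF Rp(2)] by simp
next
  case (Comp h p f J T)
  have p0: "p > 0" using top_decomp_props(2)[OF Comp(1,2) refl] prime_gt_0_nat by blast
  have fin: "finite J" and cJ: "card J \<le> p"
    using Comp(3) card_mono[of "{..<p}" J] by auto
  have "size h = sum_mset (image_mset (\<lambda>j. size (f j)) (mset_set {..<p}))"
    using size_components[OF Comp(2)] by (simp add: sum_unfold_sum_mset)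
  also have "\<dots> = (p - card J) * size (f 0) + (\<Sum>j\<in>J. size (f j))"
    unfolding components_split[OF Comp(3) p0] by (simp add: sum_unfold_sum_mset)
  finally have 1: "size h = (p - card J) * size (f 0) + (\<Sum>j\<in>J. size (f j))" .
  have "(\<Sum>j\<in>J. size (f 0) + size (f j)) = (\<Sum>j\<in>J. sum_mset (image_mset type_size (T j)))"
    using Comp(5) by (intro sum.cong) auto
  then have 2: "card J * size (f 0) + (\<Sum>j\<in>J. size (f j)) = (\<Sum>j\<in>J. sum_mset (image_mset type_size (T j)))"
    by (simp add: sum.distrib)
  have 3: "sum_mset (image_mset sum_mset (image_mset (image_mset type_size) (image_mset T (mset_set J)))) =
      (\<Sum>j\<in>J. sum_mset (image_mset type_size (T j)))"
    by (simp add: sum_unfold_sum_mset image_mset.compositionality o_def)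
  have "card J * size (f 0) \<le> p * size (f 0)" using cJ by simp
  then show ?case using 1 2 3 fin by (simp add: diff_mult_distrib)
qed simp_all

lemma has_sum_type_sum:
  "has_type v T \<Longrightarrow> sum_mset v = 0"
  "has_sum_type v X \<Longrightarrow> sum_mset v = 0"
proof (induction rule: has_type_has_sum_type.inducts)
  case (Rp h p f)
  show ?case using Rp(1) by (rule minimal_vanishing_sum)
next
  case (Comp h p f J T)
  show ?case using Comp(1) by (rule minimal_vanishing_sum)
qed simp_all

lemma has_sum_type_nonempty: "has_sum_type v X \<Longrightarrow> X \<noteq> {#}"
  by (erule has_sum_type.cases) auto

lemma has_sum_type_single [simp]: "has_sum_type v {#T#} \<longleftrightarrow> has_type v T"
proof
  assume "has_sum_type v {#T#}"
  then show "has_type v T"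
    by cases (auto dest: has_sum_type_nonempty)
qed (rule has_type_has_sum_type.single)

lemma has_type_top_prime: "has_type h T \<Longrightarrow> top_prime h = leading_index T"
proof (erule has_type.cases)
  fix h' p f assume *: "h = h'" "T = Rp p" "top_decomp h' p f"
  then have "p = top_prime h'" unfolding top_decomp_def by blast
  with * show ?thesis by simp
next
  fix h' p f J T' assume *: "h = h'" "T = Comp p (f 0) (image_mset T' (mset_set J))" "top_decomp h' p f"
  then have "p = top_prime h'" unfolding top_decomp_def by blast
  with * show ?thesis by simp
qed

text \<open>
  For odd \<open>p\<close> a rotation by a power of \<open>\<nu>\<^sub>p\<close> does not change which terms have odd order, so the
  odd terms of a sum are counted component by component.
\<close>
lemma top_decomp_signed_rotation:
  assumes h: "minimal_vanishing h" and d: "top_decomp h p f" and p: "odd p"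
  obtains z where "root_of_unity z" and "rot z h = (\<Sum>j<p. rot (nu p ^ j) (f j))"
    and "\<forall>w\<in>#rot z h. signed_odd_root w" and "\<And>j w. j < p \<Longrightarrow> w \<in># f j \<Longrightarrow> signed_odd_root w"
    and "odds (rot z h) = (\<Sum>j<p. odds (f j))"
proof -
  define M where "M = relative_order h div p"
  note t = top_decomp_props[OF h d M_def]
  obtain z where z: "root_of_unity z" "rot z h = (\<Sum>j<p. rot (nu p ^ j) (f j))"
    using d by (auto simp: top_decomp_def)
  have s: "signed_odd_root w" if "j < p" "w \<in># f j" for j w
    using signed_odd_root_squarefree[OF t(6) t(9)[OF that]] .
  have nu: "odd_root (nu p ^ j)" for j by (rule odd_root_power[OF odd_root_nu[OF p]])
  have "signed_odd_root w" if w: "w \<in># rot z h" for w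
  proof -
    obtain j u where "j < p" "u \<in># f j" "w = nu p ^ j * u"
      using w unfolding z by (auto simp: set_mset_sum)
    then show ?thesis using s signed_odd_root_mult(1) nu by (auto simp: signed_odd_root_def)
  qed
  moreover have "odds (rot z h) = (\<Sum>j<p. odds (f j))"
    unfolding z by (simp add: odds_sum odds_rot_odd[OF nu])
  ultimately show ?thesis using that z s by blast
qed

text \<open>
  The type of a sum does not determine its parity, because each difference \<open>f\<^sub>0 - f\<^sub>j\<close> of a
  prescribed type can be placed around the base \<open>f\<^sub>0\<close> in several ways. But the numbers of odd
  terms that a component can have depend only on the base and on the type of the difference.
\<close>
definition compl_odds :: "complex multiset \<Rightarrow> mv_type multiset \<Rightarrow> nat set" where
  "compl_odds f0 X = {odds f | f. has_sum_type (f0 + rot (- 1) f) X \<and> (\<forall>w\<in>#f. signed_odd_root w)}"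

text \<open>
  Equal members of \<open>Ts\<close> may be given different elements of \<open>Q X\<close>; this is why the choices form a
  related multiset rather than a function of \<open>X\<close>.
\<close>
definition choice_sums :: "('a \<Rightarrow> nat set) \<Rightarrow> 'a multiset \<Rightarrow> nat set" where
  "choice_sums Q Ts = {sum_mset ms | ms. rel_mset (\<lambda>X q. q \<in> Q X) Ts ms}"

lemma choice_sums_empty [simp]: "choice_sums Q {#} = {0}"
  by (auto simp: choice_sums_def rel_mset_Zero dest: rel_mset_Zero_iff[THEN iffD1] intro!: exI[of _ "{#}"])

lemma choice_sums_add_mset [simp]:
  "choice_sums Q (add_mset X Ts) = (\<Union>q\<in>Q X. (+) q ` choice_sums Q Ts)"
proof (intro equalityI subsetI)
  fix s assume "s \<in> choice_sums Q (add_mset X Ts)"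
  then obtain ms where ms: "rel_mset (\<lambda>X q. q \<in> Q X) (add_mset X Ts) ms" "s = sum_mset ms"
    by (auto simp: choice_sums_def)
  obtain ms' q where "ms = add_mset q ms'" "q \<in> Q X" "rel_mset (\<lambda>X q. q \<in> Q X) Ts ms'"
    using msed_rel_invL[OF ms(1)] by blast
  then have "s = q + sum_mset ms'" "q \<in> Q X" "sum_mset ms' \<in> choice_sums Q Ts"
    using ms(2) by (auto simp: choice_sums_def)
  then show "s \<in> (\<Union>q\<in>Q X. (+) q ` choice_sums Q Ts)" by blast
next
  fix s assume "s \<in> (\<Union>q\<in>Q X. (+) q ` choice_sums Q Ts)"
  then obtain q ms where "q \<in> Q X" "rel_mset (\<lambda>X q. q \<in> Q X) Ts ms" "s = q + sum_mset ms"
    by (auto simp: choice_sums_def)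
  then show "s \<in> choice_sums Q (add_mset X Ts)"
    unfolding choice_sums_def by (intro CollectI exI[of _ "add_mset q ms"]) (auto intro: rel_mset_Plus)
qed

lemma choice_sums_image:
  "finite J \<Longrightarrow> (\<And>j. j \<in> J \<Longrightarrow> g j \<in> Q (T j)) \<Longrightarrow> (\<Sum>j\<in>J. g j) \<in> choice_sums Q (image_mset T (mset_set J))"
  by (induction J rule: finite_induct) auto

text \<open>
  Numbering the members of the multiset turns independent choices for equal members into a
  function on the numbers, which later serve as the positions of the components.
\<close>
lemma choice_sums_obtain:
  assumes "s \<in> choice_sums Q Ts"
  shows "\<exists>T g. Ts = image_mset T (mset_set {1..size Ts}) \<and> (\<forall>j\<in>{1..size Ts}. g j \<in> Q (T j)) \<and>
    s = (\<Sum>j\<in>{1..size Ts}. g j)"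
  using assms
proof (induction Ts arbitrary: s)
  case (add X Ts)
  then obtain q s' where q: "q \<in> Q X" "s' \<in> choice_sums Q Ts" "s = q + s'" by auto
  then obtain T g where Tg: "Ts = image_mset T (mset_set {1..size Ts})"
    "\<forall>j\<in>{1..size Ts}. g j \<in> Q (T j)" "s' = (\<Sum>j\<in>{1..size Ts}. g j)"
    using add.IH by metis
  define n where "n = size Ts"
  define T' where "T' = T(Suc n := X)"
  define g' where "g' = g(Suc n := q)"
  have set: "{1..Suc n} = insert (Suc n) {1..n}" by auto
  have "image_mset T' (mset_set {1..n}) = image_mset T (mset_set {1..n})"
    by (intro image_mset_cong) (auto simp: T'_def)
  then have "add_mset X Ts = image_mset T' (mset_set {1..Suc n})"
    unfolding set using Tg(1) by (simp add: n_def[symmetric]) (simp add: T'_def)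
  moreover have "(\<Sum>j\<in>{1..n}. g' j) = (\<Sum>j\<in>{1..n}. g j)"
    by (intro sum.cong) (auto simp: g'_def)
  then have "s = (\<Sum>j\<in>{1..Suc n}. g' j)"
    unfolding set using Tg(3) q(3) by (simp add: n_def[symmetric]) (simp add: g'_def)
  moreover have "\<forall>j\<in>{1..Suc n}. g' j \<in> Q (T' j)"
    using Tg(2) q(1) by (auto simp: g'_def T'_def n_def[symmetric])
  ultimately show ?case by (auto simp: n_def[symmetric] simp del: mset_set.insert)
qed simp

lemma has_type_Comp_odds:
  assumes ht: "has_type h (Comp p f0 Ts)" and p: "odd p"
  obtains z s where "root_of_unity z" and "\<forall>w\<in>#rot z h. signed_odd_root w"
    and "s \<in> choice_sums (compl_odds f0) Ts" and "odds (rot z h) = (p - size Ts) * odds f0 + s"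
  using ht
proof cases
  case (Comp f J T)
  have h: "minimal_vanishing h" and d: "top_decomp h p f" by (rule Comp)+
  have p0: "p > 0" using p by (simp add: odd_pos)
  obtain z where z: "root_of_unity z" "\<forall>w\<in>#rot z h. signed_odd_root w"
    "\<And>j w. j < p \<Longrightarrow> w \<in># f j \<Longrightarrow> signed_odd_root w" "odds (rot z h) = (\<Sum>j<p. odds (f j))"
    using top_decomp_signed_rotation[OF h d p] by metis
  have "odds (rot z h) = sum_mset (image_mset (\<lambda>j. odds (f j)) (mset_set {..<p}))"
    using z(4) by (simp add: sum_unfold_sum_mset)
  also have "\<dots> = (p - card J) * odds f0 + (\<Sum>j\<in>J. odds (f j))"
    unfolding components_split[OF Comp(5) p0, of odds] using Comp(1) by (simp add: sum_unfold_sum_mset)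
  finally have "odds (rot z h) = (p - size Ts) * odds f0 + (\<Sum>j\<in>J. odds (f j))"
    using Comp(2) by simp
  moreover have "(\<Sum>j\<in>J. odds (f j)) \<in> choice_sums (compl_odds f0) Ts"
    unfolding Comp(2)
  proof (rule choice_sums_image)
    show "finite J" using Comp by simp
    fix j assume j: "j \<in> J"
    then have "j < p" using Comp by simp
    then show "odds (f j) \<in> compl_odds f0 (T j)"
      using j z(3)[of j] Comp by (auto simp: compl_odds_def)
  qed
  ultimately show ?thesis using that z by blast
qed

lemma has_type_Rp_components:
  assumes ht: "has_type h (Rp p)"
  obtains f where "minimal_vanishing h" "top_decomp h p f" "\<And>j. j < p \<Longrightarrow> f j = {#1#}"
  using ht
proof cases
  case (Rp f)
  then show ?thesis using equal_components_singleton[OF Rp(1,2,3)] that by metis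
qed

lemma sorted_list_of_multiset_eqI: "sorted W \<Longrightarrow> mset W = M \<Longrightarrow> sorted_list_of_multiset M = W"
  by (metis sorted_list_of_multiset_mset sorted_sort_id)

lemma has_type_weight_partition:
  assumes ht: "has_type h (Comp p f0 Ts)" and W: "sorted W"
    and mW: "mset W = replicate_mset (p - size Ts) (size f0) +
      image_mset (\<lambda>X. sum_mset (image_mset type_size X) - size f0) Ts"
  shows "has_weight_partition h W' \<longleftrightarrow> W' = W"
  using ht
proof cases
  case (Comp f J T)
  have h: "minimal_vanishing h" and d: "top_decomp h p f" by (rule Comp)+
  have p0: "p > 0" using top_decomp_props(2)[OF h d refl] prime_gt_0_nat by blast
  have "image_mset (\<lambda>j. size (f j)) (mset_set J) =
      image_mset (\<lambda>j. sum_mset (image_mset type_size (T j)) - size f0) (mset_set J)"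
  proof (rule image_mset_cong)
    fix j assume "j \<in># mset_set J"
    then have "j \<in> J" using Comp by (cases "finite J") auto
    then have "has_sum_type (f 0 + rot (- 1) (f j)) (T j)" using Comp by blast
    from has_type_size(2)[OF this]
    show "size (f j) = sum_mset (image_mset type_size (T j)) - size f0" using Comp(1) by simp
  qed
  then have "image_mset (\<lambda>j. size (f j)) (mset_set {..<p}) = mset W"
    unfolding components_split[OF Comp(5) p0, of size] mW using Comp(1,2)
    by (simp add: image_mset.compositionality o_def)
  then show ?thesis
    using has_weight_partition_iff[OF h d] sorted_list_of_multiset_eqI[OF W] by metis
qed

lemma has_type_Rp_weight_partition:
  assumes ht: "has_type h (Rp p)"
  shows "has_weight_partition h W' \<longleftrightarrow> W' = replicate p 1"
proof -
  obtain f where f: "minimal_vanishing h" "top_decomp h p f" "\<And>j. j < p \<Longrightarrow> f j = {#1#}"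
    using has_type_Rp_components[OF ht] by blast
  have "image_mset (\<lambda>j. size (f j)) (mset_set {..<p}) = image_mset (\<lambda>j. 1) (mset_set {..<p})"
    by (intro image_mset_cong) (auto simp: f(3))
  also have "\<dots> = mset (replicate p 1)" by (simp add: image_mset_const_eq)
  finally have "sorted_list_of_multiset (image_mset (\<lambda>j. size (f j)) (mset_set {..<p})) = replicate p 1"
    by (intro sorted_list_of_multiset_eqI) auto
  then show ?thesis using has_weight_partition_iff[OF f(1,2)] by simp
qed

section \<open>Realising types\<close>

text \<open>
  The sum \<open>- k\<close> is a vanishing part of \<open>f0 - g\<close>, and a proper one because \<open>f0\<close> is not empty.
\<close>
lemma zero_free_of_minimal:
  assumes m: "minimal_vanishing (f0 + rot (- 1) g)" and "f0 \<noteq> {#}" and k: "k \<subseteq># g" "sum_mset k = 0"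
  shows "k = {#}"
proof -
  have "rot (- 1) k \<subseteq># f0 + rot (- 1) g"
    using rot_mono[OF k(1), of "- 1"] by (metis mset_subset_eq_add_right subset_mset.order_trans)
  then have "rot (- 1) k = {#} \<or> rot (- 1) k = f0 + rot (- 1) g"
    using k(2) by (intro minimal_vanishing_sub[OF m]) auto
  moreover have "rot (- 1) k \<noteq> f0 + rot (- 1) g"
  proof
    assume "rot (- 1) k = f0 + rot (- 1) g"
    then have "size (rot (- 1) k) = size (f0 + rot (- 1) g)" by (rule arg_cong)
    then have "size k = size f0 + size g" by simp
    then show False using size_mset_mono[OF k(1)] \<open>f0 \<noteq> {#}\<close> by simp
  qed
  ultimately show ?thesis by simp
qed

lemma subset_plus_eq:
  assumes "a + b = a' + b'" "a \<subseteq># a'" "b \<subseteq># b'"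
  shows "a = a'" "b = b'"
  using assms by (auto simp: mset_subset_eq_exists_conv)

text \<open>
  If \<open>f 0 - f i\<close> is minimal for one \<open>i\<close>, then subsums \<open>k j\<close> of the \<open>f j\<close> with a common value have the
  value \<open>0\<close> or the full value already for \<open>j = 0\<close>; zero-freeness settles the other components.
\<close>
lemma realise_Comp:
  assumes p: "prime p" "\<not> p dvd M" "M > 0" "\<And>q. prime q \<Longrightarrow> q dvd M \<Longrightarrow> q < p"
    and J: "J \<subseteq> {1..<p}" and i: "i \<in> J" "minimal_vanishing (f 0 + rot (- 1) (f i))"
    and one: "1 \<in># f 0"
    and fM: "\<And>j w. j < p \<Longrightarrow> w \<in># f j \<Longrightarrow> w ^ M = 1"
    and out: "\<And>j. j < p \<Longrightarrow> j \<notin> J \<Longrightarrow> f j = f 0"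
    and inJ: "\<And>j. j \<in> J \<Longrightarrow> f j \<noteq> f 0" "\<And>j. j \<in> J \<Longrightarrow> has_sum_type (f 0 + rot (- 1) (f j)) (T j)"
      "\<And>j. j \<in> J \<Longrightarrow> size (f 0) \<le> size (f j)"
    and free: "\<And>j k. j \<in> J \<Longrightarrow> k \<subseteq># f j \<Longrightarrow> sum_mset k = 0 \<Longrightarrow> k = {#}"
    and h: "h = (\<Sum>j<p. rot (nu p ^ j) (f j))"
  shows "has_type h (Comp p (f 0) (image_mset T (mset_set J)))" and "top_decomp h p f"
proof -
  have p1: "p > 1" using p prime_gt_1_nat by blast
  have ip: "i < p" using J i by auto
  have eq: "sum_mset (f j) = sum_mset (f 0)" if "j < p" for j
  proof (cases "j \<in> J")
    case True
    then show ?thesis using has_sum_type_sum(2)[OF inJ(2)[OF True]] by simp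
  qed (use out that in simp)
  have le: "size (f 0) \<le> size (f j)" if "j < p" for j
    using inJ(3)[of j] out[OF that] by (cases "j \<in> J") auto
  have ne: "f j \<noteq> {#}" if "j < p" for j using le[OF that] one by auto
  have free0: "k = {#}" if k: "k \<subseteq># f 0" "sum_mset k = 0" for k
  proof -
    have "k = {#} \<or> k = f 0 + rot (- 1) (f i)"
      using k by (intro minimal_vanishing_sub[OF i(2)]) (auto intro: subset_mset.order_trans)
    moreover have "k \<noteq> f 0 + rot (- 1) (f i)"
    proof
      assume "k = f 0 + rot (- 1) (f i)"
      then have "size k = size (f 0) + size (f i)" by simp
      then show False using size_mset_mono[OF k(1)] ne[OF ip] by simp
    qed
    ultimately show ?thesis by blast
  qed
  have free': "k = {#}" if "j < p" "k \<subseteq># f j" "sum_mset k = 0" for j k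
    using free[of j k] free0[of k] out[of j] that by (cases "j \<in> J") auto
  have min: "(\<forall>j<p. k j = {#}) \<or> (\<forall>j<p. k j = f j)"
    if k: "\<And>j. j < p \<Longrightarrow> k j \<subseteq># f j \<and> sum_mset (k j) = c" for k c
  proof -
    have k0: "k 0 \<subseteq># f 0" "sum_mset (k 0) = c" and ki: "k i \<subseteq># f i" "sum_mset (k i) = c"
      using k[of 0] k[OF ip] p1 by auto
    have "k 0 + rot (- 1) (k i) \<subseteq># f 0 + rot (- 1) (f i)"
      using k0 ki rot_mono by (intro subset_mset.add_mono)
    then have "k 0 + rot (- 1) (k i) = {#} \<or> k 0 + rot (- 1) (k i) = f 0 + rot (- 1) (f i)"
      using k0 ki by (intro minimal_vanishing_sub[OF i(2)]) auto
    then show ?thesis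
    proof
      assume "k 0 + rot (- 1) (k i) = {#}"
      then have "c = 0" using k0 by auto
      then show ?thesis using k free' by blast
    next
      assume *: "k 0 + rot (- 1) (k i) = f 0 + rot (- 1) (f i)"
      have "k 0 = f 0" using subset_plus_eq(1)[OF * k0(1) rot_mono[OF ki(1)]] .
      then have c: "c = sum_mset (f 0)" using k0 by simp
      have "k j = f j" if j: "j < p" for j
      proof -
        have kj: "k j \<subseteq># f j" using k[OF j] by blast
        have "f j = k j + (f j - k j)" using kj by simp
        then have "sum_mset (f j) = sum_mset (k j) + sum_mset (f j - k j)" by (metis sum_mset.union)
        then have "sum_mset (f j - k j) = 0" using k[OF j] c eq[OF j] by simp
        then have "f j - k j = {#}" using j by (intro free'[of j]) auto
        then show ?thesis using kj by (metis add.right_neutral subset_mset.add_diff_inverse)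
      qed
      then show ?thesis by blast
    qed
  qed
  note mv = minimal_vanishing_of_components[OF p ne fM eq le one min h]
  show d: "top_decomp h p f" by (rule mv)
  have "J = {j\<in>{1..<p}. f j \<noteq> f 0}" using J inJ(1) out by auto
  then show "has_type h (Comp p (f 0) (image_mset T (mset_set J)))"
    using i(1) inJ(2) by (intro has_type_has_sum_type.Comp[OF mv]) auto
qed

lemma subseteq_single_mset: "k \<subseteq># {#x#} \<Longrightarrow> k = {#} \<or> k = {#x#}"
proof (cases "x \<in># k")
  case True
  moreover assume "k \<subseteq># {#x#}"
  ultimately show ?thesis by (auto intro: subset_mset.antisym)
next
  case False
  moreover assume "k \<subseteq># {#x#}"
  ultimately show ?thesis
    by (metis all_not_in_conv mset_subset_eqD set_mset_eq_empty_iff set_mset_single singletonD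
      set_mset_add_mset_insert set_mset_empty)
qed

lemma realise_Rp:
  assumes p: "prime p"
  shows "\<exists>h. has_type h (Rp p)"
proof -
  define f where "f j = {#1::complex#}" for j :: nat
  define h where "h = (\<Sum>j<p. rot (nu p ^ j) (f j))"
  have p0: "p > 0" using p prime_gt_0_nat by blast
  have min: "(\<forall>j<p. k j = {#}) \<or> (\<forall>j<p. k j = f j)"
    if k: "\<And>j. j < p \<Longrightarrow> k j \<subseteq># f j \<and> sum_mset (k j) = c" for k c
  proof -
    have *: "k j = {#} \<and> c = 0 \<or> k j = f j \<and> c = 1" if "j < p" for j
      using k[OF that] subseteq_single_mset[of "k j" 1] by (auto simp: f_def)
    show ?thesis
    proof (cases "c = 0")
      case True
      have "k j = {#}" if "j < p" for j using *[OF that] True by simp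
      then show ?thesis by blast
    next
      case False
      have "k j = f j" if "j < p" for j using *[OF that] False by simp
      then show ?thesis by blast
    qed
  qed
  have "minimal_vanishing h" "top_decomp h p f"
    using p min
      by (intro minimal_vanishing_of_components[of p 1 f, OF _ _ _ _ _ _ _ _ _ _ h_def]; auto simp: f_def
        not_prime_unit)+
  then have "has_type h (Rp p)" by (rule has_type_has_sum_type.Rp) (simp add: f_def)
  then show ?thesis by blast
qed

section \<open>Parities attained by a type\<close>

definition type_odds :: "mv_type \<Rightarrow> nat set" where
  "type_odds T = {odds v | v. has_type v T \<and> (\<forall>w\<in>#v. signed_odd_root w)}"

lemma type_oddsI: "has_type v T \<Longrightarrow> \<forall>w\<in>#v. signed_odd_root w \<Longrightarrow> odds v \<in> type_odds T"
  by (auto simp: type_odds_def)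

lemma signed_odd_root_minus_1 [simp]: "signed_odd_root (- 1)"
  by (simp add: signed_odd_root_def)

lemma signed_odd_root_1 [simp]: "signed_odd_root 1"
  by (simp add: signed_odd_root_def)

lemma signed_rotation_exists:
  assumes h: "minimal_vanishing h"
  obtains z where "root_of_unity z" "\<forall>w\<in>#rot z h. signed_odd_root w"
proof -
  have so: "sorou h" using h vanishing_sorou by blast
  obtain v where v: "v \<in># h" using so by (auto simp: sorou_def)
  have "root_of_unity v" using so v by (simp add: sorou_def)
  then have "root_of_unity (1 / v)" by (rule root_of_unity_inverse)
  moreover have "signed_odd_root w" if "w \<in># rot (1 / v) h" for w
    using that relative_order_ratio[OF so _ v]
    by (intro signed_odd_root_squarefree[OF squarefree_relative_order[OF h]]) auto
  ultimately show ?thesis using that by blast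
qed

lemma odds_rotations:
  assumes g: "g \<noteq> {#}" "\<forall>w\<in>#g. signed_odd_root w" and z: "z \<noteq> 0" "\<forall>w\<in>#rot z g. signed_odd_root w"
  shows "odds g = odds (rot z g) \<or> odds g = size g - odds (rot z g)"
proof -
  obtain w where w: "w \<in># g" using g by auto
  then have "signed_odd_root w" "signed_odd_root (z * w)" using g z by auto
  then have "signed_odd_root (w * (1 / (z * w)))"
    using signed_odd_root_mult(1) signed_odd_root_inverse by blast
  moreover have "w \<noteq> 0" using \<open>signed_odd_root w\<close> odd_root_ne_0[of w] odd_root_ne_0[of "- w"]
    by (auto simp: signed_odd_root_def)
  ultimately have "signed_odd_root (1 / z)" using z(1) by simp
  from odds_rot_signed[OF this z(2)] show ?thesis using z(1) by simp
qed

text \<open>Rotation by \<open>-1\<close> exchanges the odd and the even terms.\<close>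
lemma type_odds_closed:
  assumes "a \<in> type_odds T" shows "type_size T - a \<in> type_odds T"
proof -
  obtain v where v: "has_type v T" "\<forall>w\<in>#v. signed_odd_root w" "a = odds v"
    using assms by (auto simp: type_odds_def)
  have "has_type (rot (- 1) v) T" using v(1) by (intro has_type_rot) auto
  moreover have "\<forall>w\<in>#rot (- 1) v. signed_odd_root w" using v(2) signed_odd_root_minus by auto
  ultimately have "odds (rot (- 1) v) \<in> type_odds T" by (rule type_oddsI)
  then show ?thesis using v(3) odds_rot_minus_1[OF v(2)] has_type_size(1)[OF v(1)] by simp
qed

lemma type_odds_le: "a \<in> type_odds T \<Longrightarrow> a \<le> type_size T"
proof -
  assume "a \<in> type_odds T"
  then obtain v where "has_type v T" "a = odds v" by (auto simp: type_odds_def)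
  then show ?thesis using odds_le[of v] has_type_size(1)[of v T] by simp
qed

text \<open>
  It is enough to know one rotation of each sum of the type, since any two of them agree up to an
  exchange of the odd and the even terms.
\<close>
lemma type_odds_subset:
  assumes "\<And>h. has_type h T \<Longrightarrow>
    \<exists>z. root_of_unity z \<and> (\<forall>w\<in>#rot z h. signed_odd_root w) \<and> odds (rot z h) \<in> S"
  shows "type_odds T \<subseteq> S \<union> (\<lambda>a. type_size T - a) ` S"
proof
  fix a assume "a \<in> type_odds T"
  then obtain v where v: "has_type v T" "\<forall>w\<in>#v. signed_odd_root w" "a = odds v"
    by (auto simp: type_odds_def)
  obtain z where z: "root_of_unity z" "\<forall>w\<in>#rot z v. signed_odd_root w" "odds (rot z v) \<in> S"
    using assms[OF v(1)] by blast
  have "v \<noteq> {#}" using has_type_minimal[OF v(1)] vanishing_sorou sorou_def by blast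
  then have "odds v = odds (rot z v) \<or> odds v = size v - odds (rot z v)"
    using odds_rotations v(2) z(1,2) root_of_unity_ne_0 by blast
  then show "a \<in> S \<union> (\<lambda>a. type_size T - a) ` S"
    using z(3) v(3) has_type_size(1)[OF v(1)] by auto
qed

text \<open>
  Over the base \<open>1\<close>, a sum \<open>1 - f\<close> of type \<open>T\<close> has the odd term \<open>1\<close>. Conversely, in a sum of type
  \<open>T\<close> any odd term can be rotated to \<open>1\<close> without changing the numbers of odd and even terms, so
  that every nonzero element of \<open>type_odds T\<close> occurs. The odd terms of \<open>f\<close> are the negatives of
  the even terms of \<open>1 - f\<close>.
\<close>
lemma compl_odds_single:
  "compl_odds {#1#} {#T#} = {type_size T - a | a. a \<in> type_odds T \<and> a \<ge> 1}"
proof (intro equalityI subsetI)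
  fix b assume "b \<in> compl_odds {#1#} {#T#}"
  then obtain f where f: "has_type ({#1#} + rot (- 1) f) T" "\<forall>w\<in>#f. signed_odd_root w" "b = odds f"
    unfolding compl_odds_def has_sum_type_single by blast
  have "odds ({#1#} + rot (- 1) f) = 1 + (size f - odds f)"
    using odds_rot_minus_1[OF f(2)] by simp
  moreover have "type_size T = 1 + size f" using has_type_size(1)[OF f(1)] by simp
  moreover have "odds ({#1#} + rot (- 1) f) \<in> type_odds T"
    by (rule type_oddsI[OF f(1)]) (use f(2) signed_odd_root_minus in auto)
  ultimately show "b \<in> {type_size T - a | a. a \<in> type_odds T \<and> a \<ge> 1}"
    using f(3) odds_le[of f] by (intro CollectI exI[of _ "odds ({#1#} + rot (- 1) f)"]) auto
next
  fix b assume "b \<in> {type_size T - a | a. a \<in> type_odds T \<and> a \<ge> 1}"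
  then obtain v where v: "has_type v T" "\<forall>w\<in>#v. signed_odd_root w" "odds v \<ge> 1" "b = type_size T - odds v"
    by (auto simp: type_odds_def)
  have "{#w \<in># v. odd_root w#} \<noteq> {#}"
    using v(3) unfolding odds_def by (metis size_empty not_one_le_zero)
  then obtain w where "w \<in># {#w \<in># v. odd_root w#}" by blast
  then have w: "w \<in># v" "odd_root w" by simp_all
  have w0: "w \<noteq> 0" using w(2) odd_root_ne_0 by blast
  have rw: "root_of_unity w"
    using w(1) has_type_minimal[OF v(1)] vanishing_sorou by (auto simp: sorou_def)
  have ow: "odd_root (1 / w)" using w(2) by (rule odd_root_inverse)
  define g where "g = rot (1 / w) (v - {#w#})"
  define f where "f = rot (- 1) g"
  have "v = {#w#} + (v - {#w#})" using w(1) by simp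
  then have "rot (1 / w) v = rot (1 / w) ({#w#} + (v - {#w#}))" by simp
  then have rv: "rot (1 / w) v = {#1#} + g" using w0 by (simp add: g_def)
  have sg: "\<forall>x\<in>#rot (1 / w) v. signed_odd_root x"
    using v(2) ow signed_odd_root_mult(1)[of "1 / w"] by (auto simp: signed_odd_root_def[of "1 / w"])
  have eq: "{#1#} + rot (- 1) f = rot (1 / w) v" by (simp add: f_def rv)
  have "has_sum_type ({#1#} + rot (- 1) f) {#T#}"
    unfolding has_sum_type_single eq by (intro has_type_rot v(1) root_of_unity_inverse rw)
  moreover have sg': "\<forall>x\<in>#g. signed_odd_root x" using sg rv by simp
  then have "\<forall>x\<in>#f. signed_odd_root x" using signed_odd_root_minus by (auto simp: f_def)
  moreover have "odds f = b"
  proof -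
    have "odds v = 1 + odds g" using arg_cong[OF rv, of odds] odds_rot_odd[OF ow] by simp
    moreover have "type_size T = 1 + size g" using arg_cong[OF rv, of size] has_type_size(1)[OF v(1)]
      by simp
    ultimately show ?thesis using v(4) odds_rot_minus_1[OF sg'] by (simp add: f_def)
  qed
  ultimately show "b \<in> compl_odds {#1#} {#T#}" unfolding compl_odds_def by blast
qed

lemma type_odds_Rp:
  assumes p: "prime p" "odd p" shows "type_odds (Rp p) = {0, p}"
proof -
  have "type_odds (Rp p) \<subseteq> {p} \<union> (\<lambda>a. type_size (Rp p) - a) ` {p}"
  proof (rule type_odds_subset)
    fix h assume "has_type h (Rp p)"
    then obtain f where f: "minimal_vanishing h" "top_decomp h p f" "\<And>j. j < p \<Longrightarrow> f j = {#1#}"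
      using has_type_Rp_components by blast
    obtain z where z: "root_of_unity z" "\<forall>w\<in>#rot z h. signed_odd_root w" "odds (rot z h) =
        (\<Sum>j<p. odds (f j))"
      using top_decomp_signed_rotation[OF f(1,2) p(2)] by metis
    have "(\<Sum>j<p. odds (f j)) = p" by (simp add: f(3))
    then show "\<exists>z. root_of_unity z \<and> (\<forall>w\<in>#rot z h. signed_odd_root w) \<and> odds (rot z h) \<in> {p}"
      using z by auto
  qed
  then have sub: "type_odds (Rp p) \<subseteq> {0, p}" by auto
  obtain h where h: "has_type h (Rp p)" using realise_Rp[OF p(1)] by blast
  obtain z where z: "root_of_unity z" "\<forall>w\<in>#rot z h. signed_odd_root w"
    using signed_rotation_exists[OF has_type_minimal[OF h]] by blast
  have a: "odds (rot z h) \<in> type_odds (Rp p)" using z has_type_rot[OF h z(1)] by (intro type_oddsI)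
  then have "type_size (Rp p) - odds (rot z h) \<in> type_odds (Rp p)" by (rule type_odds_closed)
  then show ?thesis using a sub by auto
qed

text \<open>
  The types of the differences \<open>1 - f\<close> that can occur in \<open>(R\<^sub>p : Ts)\<close>. The leading index \<open>2\<close> is
  excluded, as \<open>1 - f\<close> has type \<open>R\<^sub>2\<close> only if \<open>f\<close> equals the base \<open>1\<close>; an index below \<open>p\<close> makes
  the orders of the terms of \<open>f\<close> prime to \<open>p\<close>.
\<close>
definition attachable :: "nat \<Rightarrow> mv_type multiset \<Rightarrow> bool" where
  "attachable p X \<longleftrightarrow> (\<exists>T. X = {#T#} \<and> 2 < leading_index T \<and> leading_index T < p)"

text \<open>
  Every choice of numbers of odd terms for the single components is attained by one sum: the
  components can be selected independently of each other. A common modulus \<open>M\<close> for their terms is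
  twice the product of the relative orders of the sums \<open>1 - F j\<close>. The terms of such a sum have
  orders dividing its relative order because \<open>1\<close> is one of them, and the factor \<open>2\<close> takes care of
  the sign of \<open>F j\<close>.
\<close>
lemma realise_RC:
  assumes p: "prime p" and Ts: "Ts \<noteq> {#}" "size Ts < p" "\<forall>X\<in>#Ts. attachable p X"
    and s: "s \<in> choice_sums (compl_odds {#1#}) Ts"
  shows "p - size Ts + s \<in> type_odds (RC p Ts)"
proof -
  define n where "n = size Ts"
  define J where "J = {1..n}"
  obtain T g where Tg: "Ts = image_mset T (mset_set J)" "\<forall>j\<in>J. g j \<in> compl_odds {#1#} (T j)"
    "s = (\<Sum>j\<in>J. g j)"
    using choice_sums_obtain[OF s] by (auto simp: J_def n_def)
  have n1: "n \<ge> 1" using Ts(1) by (simp add: n_def Suc_le_eq nonempty_has_size[symmetric])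
  have finJ: "finite J" "card J = n" "1 \<in> J" using n1 by (auto simp: J_def)
  have "\<forall>j\<in>J. \<exists>T'. T j = {#T'#} \<and> 2 < leading_index T' \<and> leading_index T' < p"
    using Ts(3) finJ(1) by (auto simp: Tg(1) attachable_def)
  then obtain T'
    where T': "\<And>j. j \<in> J \<Longrightarrow> T j = {#T' j#} \<and> 2 < leading_index (T' j) \<and> leading_index (T' j) < p"
    by metis
  have "\<forall>j\<in>J. \<exists>f. has_sum_type ({#1#} + rot (- 1) f) (T j) \<and> (\<forall>w\<in>#f. signed_odd_root w) \<and> g j = odds f"
    using Tg(2) by (auto simp: compl_odds_def)
  then obtain F where F: "\<And>j. j \<in> J \<Longrightarrow> has_sum_type ({#1#} + rot (- 1) (F j)) (T j) \<and>
      (\<forall>w\<in>#F j. signed_odd_root w) \<and> g j = odds (F j)"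
    by metis
  define f where "f j = (if j \<in> J then F j else {#1#})" for j
  define v where "v j = {#1#} + rot (- 1) (F j)" for j
  have f0: "f 0 = {#1#}" by (simp add: f_def J_def)
  have vt: "has_type (v j) (T' j)" if "j \<in> J" for j
    using F[OF that] T'[OF that] by (simp add: v_def)
  have vm: "minimal_vanishing (v j)" if "j \<in> J" for j using vt[OF that] has_type_minimal by blast
  have vso: "sorou (v j)" if "j \<in> J" for j using vm[OF that] vanishing_sorou by blast
  define N where "N j = relative_order (v j)" for j
  define M where "M = 2 * (\<Prod>j\<in>J. N j)"
  have N0: "N j > 0" if "j \<in> J" for j using relative_order_pos[OF vso[OF that]] by (simp add: N_def)
  have M0: "M > 0" using N0 by (simp add: M_def prod_pos)
  have p2: "2 < p" using T'[OF finJ(3)] by simp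
  have podd: "odd p" using p p2 by (simp add: prime_odd_nat)
  have primes: "q < p" if q: "prime q" "q dvd M" for q
  proof -
    have "q dvd 2 \<or> (\<exists>j\<in>J. q dvd N j)"
      using q finJ(1) by (auto simp: M_def prime_dvd_mult_iff prime_dvd_prod_iff)
    then show ?thesis
    proof
      assume "q dvd 2" then show ?thesis using p2 by (auto dest: dvd_imp_le)
    next
      assume "\<exists>j\<in>J. q dvd N j"
      then obtain j where j: "j \<in> J" "q dvd N j" by blast
      then have "q \<le> top_prime (v j)" using top_prime_props(3)[OF vm q(1)] by (simp add: N_def)
      also have "\<dots> = leading_index (T' j)" using has_type_top_prime[OF vt] j by blast
      also have "\<dots> < p" using T' j by blast
      finally show ?thesis .
    qed
  qed
  have FM: "w ^ M = 1" if j: "j \<in> J" and w: "w \<in># F j" for j w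
  proof -
    have "- w \<in># v j" using w by (auto simp: v_def)
    then have "(- w / 1) ^ N j = 1"
      unfolding N_def by (intro relative_order_ratio[OF vso[OF j]]) (auto simp: v_def)
    then have "((- w) ^ 2) ^ N j = 1"
      by (simp only: power_mult[symmetric] mult.commute[of 2]) (simp add: power_mult)
    then have *: "w ^ (2 * N j) = 1" by (simp add: power_mult)
    have "2 * N j dvd M" using finJ(1) j by (auto simp: M_def intro!: mult_dvd_mono dvd_prodI)
    then obtain c where "M = 2 * N j * c" by (elim dvdE)
    then show ?thesis using * by (simp only: power_mult power_one)
  qed
  have fM: "w ^ M = 1" if "w \<in># f j" for j w
    using that FM by (auto simp: f_def split: if_splits)
  have Fne: "F j \<noteq> {#1#}" if j: "j \<in> J" for j
  proof
    assume "F j = {#1#}"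
    then have "v j = {#1, - 1#}" by (simp add: v_def)
    then have "relative_order (v j) dvd 2" by (subst relative_order_dvd_iff[OF vso[OF j]]) auto
    then have "top_prime (v j) dvd 2" using top_prime_props(2)[OF vm[OF j]] dvd_trans by blast
    then have "top_prime (v j) \<le> 2" by (auto dest: dvd_imp_le)
    then show False using has_type_top_prime[OF vt[OF j]] T'[OF j] by simp
  qed
  have Fsize: "size (F j) \<ge> 1" if "j \<in> J" for j
    using size_minimal_vanishing[OF vm[OF that]] by (simp add: v_def)
  have nd: "\<not> p dvd M" using primes[of p] p by auto
  define h where "h = (\<Sum>j<p. rot (nu p ^ j) (f j))"
  have "has_type h (Comp p (f 0) (image_mset T (mset_set J)))"
  proof (rule realise_Comp[OF p nd M0 primes, where i = 1 and f = f])
    show "J \<subseteq> {1..<p}" using Ts(2) by (auto simp: J_def n_def)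
    show "minimal_vanishing (f 0 + rot (- 1) (f 1))" using vm[OF finJ(3)] finJ(3)
      by (simp only: f0) (simp add: f_def v_def)
    show "k = {#}" if "j \<in> J" "k \<subseteq># f j" "sum_mset k = 0" for j k
      using that vm[OF that(1)]
        by (intro zero_free_of_minimal[of "{#1#}" "F j" k]) (simp_all add: f_def v_def)
    show "has_sum_type (f 0 + rot (- 1) (f j)) (T j)" if "j \<in> J" for j
      using F[OF that] that by (simp only: f0) (simp add: f_def)
    show "f j \<noteq> f 0" if "j \<in> J" for j using Fne[OF that] that by (simp only: f0) (simp add: f_def)
    show "size (f 0) \<le> size (f j)" if "j \<in> J" for j using Fsize[OF that] that
      by (simp only: f0) (simp add: f_def)
    show "f j = f 0" if "j \<notin> J" for j using that by (simp only: f0) (simp add: f_def)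
    show "w ^ M = 1" if "w \<in># f j" for j w using fM[OF that] .
    show "1 \<in># f 0" by (simp add: f0)
  qed (use finJ(3) h_def in auto)
  then have ht: "has_type h (RC p Ts)" using Tg(1) f0 by simp
  have nu: "odd_root (nu p ^ j)" for j by (rule odd_root_power[OF odd_root_nu[OF podd]])
  have "signed_odd_root w" if w: "w \<in># h" for w
  proof -
    obtain j u where "j < p" "u \<in># f j" "w = nu p ^ j * u"
      using w unfolding h_def by (auto simp: set_mset_sum)
    moreover have "signed_odd_root u" using \<open>u \<in># f j\<close> F[of j] by (auto simp: f_def split: if_splits)
    ultimately show ?thesis using signed_odd_root_mult(1) nu by (auto simp: signed_odd_root_def)
  qed
  then have "odds h \<in> type_odds (RC p Ts)" using ht by (intro type_oddsI) auto
  also have "odds h = (\<Sum>j<p. odds (f j))"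
    unfolding h_def by (simp add: odds_sum odds_rot_odd[OF nu])
  also have "\<dots> = (\<Sum>j\<in>{..<p} - J. odds (f j)) + (\<Sum>j\<in>J. odds (f j))"
    using Ts(2) by (intro sum.subset_diff) (auto simp: J_def n_def)
  also have "(\<Sum>j\<in>{..<p} - J. odds (f j)) = card ({..<p} - J)" by (simp add: f_def)
  also have "card ({..<p} - J) = p - n"
    using Ts(2) finJ by (subst card_Diff_subset) (auto simp: J_def n_def)
  also have "(\<Sum>j\<in>J. odds (f j)) = s" using F Tg(3) by (auto simp: f_def)
  finally show ?thesis by (simp add: n_def)
qed

lemma type_odds_RC:
  assumes p: "prime p" and Ts: "Ts \<noteq> {#}" "size Ts < p" "\<forall>X\<in>#Ts. attachable p X"
  defines "S \<equiv> (\<lambda>s. p - size Ts + s) ` choice_sums (compl_odds {#1#}) Ts"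
  shows "type_odds (RC p Ts) = S \<union> (\<lambda>a. type_size (RC p Ts) - a) ` S"
proof
  have "\<exists>X. X \<in># Ts" using Ts(1) by auto
  then have "2 < p" using Ts(3) by (auto simp: attachable_def)
  then have podd: "odd p" using p by (simp add: prime_odd_nat)
  show "type_odds (RC p Ts) \<subseteq> S \<union> (\<lambda>a. type_size (RC p Ts) - a) ` S"
  proof (rule type_odds_subset)
    fix h assume "has_type h (RC p Ts)"
    then obtain z s where "root_of_unity z" "\<forall>w\<in>#rot z h. signed_odd_root w"
      "s \<in> choice_sums (compl_odds {#1#}) Ts" "odds (rot z h) = (p - size Ts) * odds {#1#} + s"
      using has_type_Comp_odds[OF _ podd] by blast
    then show "\<exists>z. root_of_unity z \<and> (\<forall>w\<in>#rot z h. signed_odd_root w) \<and> odds (rot z h) \<in> S"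
      by (auto simp: S_def)
  qed
  have "S \<subseteq> type_odds (RC p Ts)" using realise_RC[OF p Ts] by (auto simp: S_def)
  then show "S \<union> (\<lambda>a. type_size (RC p Ts) - a) ` S \<subseteq> type_odds (RC p Ts)"
    using type_odds_closed by blast
qed

lemma compl_odds_Rp [simp]:
  "prime p \<Longrightarrow> odd p \<Longrightarrow> compl_odds {#1#} {#Rp p#} = {0}"
  by (auto simp: compl_odds_single type_odds_Rp odd_pos Suc_le_eq)

lemma choice_sums_replicate_zero:
  "Q X = {0} \<Longrightarrow> choice_sums Q (replicate_mset k X) = {0}"
  by (induction k) auto

lemma type_size_RC5 [simp]: "k \<le> 4 \<Longrightarrow> type_size (RC 5 (copies k (Rp 3))) = 5 + k"
  by simp

lemma type_odds_RC5:
  assumes "1 \<le> k" "k \<le> 4"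
  shows "type_odds (RC 5 (copies k (Rp 3))) = {5 - k, 2 * k}"
proof -
  have "k \<noteq> 0" using assms by simp
  then have "type_odds (RC 5 (copies k (Rp 3))) =
      {5 - k} \<union> (\<lambda>a. type_size (RC 5 (copies k (Rp 3))) - a) ` {5 - k}"
    using assms by (subst type_odds_RC)
      (auto simp: attachable_def choice_sums_replicate_zero split: if_splits simp del: type_size.simps)
  then show ?thesis using assms by (auto simp del: type_size.simps)
qed

lemma compl_odds_RC5 [simp]:
  assumes "1 \<le> k" "k \<le> 4"
  shows "compl_odds {#1#} {#RC 5 (copies k (Rp 3))#} = {2 * k, 5 - k}"
proof (rule set_eqI)
  fix x
  have "(\<exists>a. x = 5 + k - a \<and> (a = 5 - k \<or> a = 2 * k) \<and> 1 \<le> a) \<longleftrightarrow> x = 2 * k \<or> x = 5 - k"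
    using assms by presburger
  then show "x \<in> compl_odds {#1#} {#RC 5 (copies k (Rp 3))#} \<longleftrightarrow> x \<in> {2 * k, 5 - k}"
    unfolding compl_odds_single type_odds_RC5[OF assms] type_size_RC5[OF assms(2)] by simp
qed

section \<open>Entries over the base \<open>1\<close>\<close>

definition valid_entry :: "nat \<Rightarrow> mv_type \<Rightarrow> nat list \<Rightarrow> nat uprod set \<Rightarrow> bool" where
  "valid_entry n T W Ps \<longleftrightarrow>
     (\<exists>h. minimal_vanishing h \<and> size h = n \<and> has_type h T) \<and>
     (\<forall>h. minimal_vanishing h \<and> has_type h T \<longrightarrow>
        top_prime h = leading_index T \<and>
        (\<forall>W'. has_weight_partition h W' \<longleftrightarrow> W' = W) \<and>
        (\<exists>P\<in>Ps. \<forall>P'. has_parity h P' \<longleftrightarrow> P' = P)) \<and>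
     (\<forall>P\<in>Ps. \<exists>h. minimal_vanishing h \<and> has_type h T \<and> has_parity h P)"

text \<open>
  Every sum has a rotation into the group of signed odd roots, and any such rotation gives the
  parity. So the parities of a type are read off from \<open>type_odds\<close>.
\<close>
lemma valid_entryI:
  assumes ex: "\<exists>h. has_type h T" and n: "type_size T = n"
    and W: "\<And>h W'. has_type h T \<Longrightarrow> has_weight_partition h W' \<longleftrightarrow> W' = W"
    and Ps: "Ps = (\<lambda>a. Upair a (n - a)) ` type_odds T"
  shows "valid_entry n T W Ps"
  unfolding valid_entry_def
proof (intro conjI allI ballI impI)
  obtain h where "has_type h T" using ex by blast
  then show "\<exists>h. minimal_vanishing h \<and> size h = n \<and> has_type h T"
    using has_type_minimal has_type_size(1) n by blast
next
  fix h assume "minimal_vanishing h \<and> has_type h T"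
  then show "top_prime h = leading_index T" using has_type_top_prime by blast
next
  fix h W' assume "minimal_vanishing h \<and> has_type h T"
  then show "has_weight_partition h W' \<longleftrightarrow> W' = W" using W by blast
next
  fix h assume h: "minimal_vanishing h \<and> has_type h T"
  then obtain z where z: "root_of_unity z" "\<forall>w\<in>#rot z h. signed_odd_root w"
    using signed_rotation_exists by blast
  have "odds (rot z h) \<in> type_odds T" using h z has_type_rot type_oddsI by blast
  then have "Upair (odds (rot z h)) (size h - odds (rot z h)) \<in> Ps"
    using h n has_type_size(1) Ps by auto
  then show "\<exists>P\<in>Ps. \<forall>P'. has_parity h P' \<longleftrightarrow> P' = P"
    using has_parity_iff[OF _ z] h by blast
next
  fix P assume "P \<in> Ps"
  then obtain v where v: "has_type v T" "\<forall>w\<in>#v. signed_odd_root w" "P = Upair (odds v) (n - odds v)"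
    by (auto simp: Ps type_odds_def)
  have "has_parity v P"
    using has_parity_iff[OF has_type_minimal[OF v(1)] root_of_unity_1] v has_type_size(1)[OF v(1)] n by simp
  then show "\<exists>h. minimal_vanishing h \<and> has_type h T \<and> has_parity h P"
    using v(1) has_type_minimal by blast
qed

lemma valid_entry_Rp:
  assumes p: "prime p" "odd p"
  shows "valid_entry p (Rp p) (replicate p 1) {Upair p 0}"
  using realise_Rp[OF p(1)] has_type_Rp_weight_partition
  by (intro valid_entryI) (auto simp: type_odds_Rp[OF p])

lemma Upair_image_symmetric:
  fixes n :: nat
  assumes "\<And>a. a \<in> S \<Longrightarrow> a \<le> n"
  shows "(\<lambda>a. Upair a (n - a)) ` (S \<union> (\<lambda>a. n - a) ` S) = (\<lambda>a. Upair a (n - a)) ` S"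
proof -
  have "Upair (n - a) (n - (n - a)) = Upair a (n - a)" if "a \<in> S" for a
  proof -
    have "n - (n - a) = a" using assms[OF that] by (rule diff_diff_cancel)
    then show ?thesis by simp
  qed
  then have "(\<lambda>a. Upair a (n - a)) ` (\<lambda>a. n - a) ` S = (\<lambda>a. Upair a (n - a)) ` S"
    unfolding image_image by (intro image_cong refl)
  then show ?thesis by (simp only: image_Un Un_absorb)
qed

lemma valid_entry_RC:
  assumes p: "prime p" and Ts: "Ts \<noteq> {#}" "size Ts < p" "\<forall>X\<in>#Ts. attachable p X"
    and n: "type_size (RC p Ts) = n" and W: "sorted W"
    and mW: "mset W = replicate_mset (p - size Ts) 1 +
      image_mset (\<lambda>X. sum_mset (image_mset type_size X) - 1) Ts"
    and Ps: "Ps = (\<lambda>s. Upair (p - size Ts + s) (n - (p - size Ts + s))) ` choice_sums (compl_odds {#1#}) Ts"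
    and ne: "Ps \<noteq> {}"
  shows "valid_entry n (RC p Ts) W Ps"
proof (rule valid_entryI)
  define S where "S = (\<lambda>s. p - size Ts + s) ` choice_sums (compl_odds {#1#}) Ts"
  have S: "S \<subseteq> type_odds (RC p Ts)" using realise_RC[OF p Ts] by (auto simp: S_def)
  have "S \<noteq> {}" using ne by (auto simp: S_def Ps)
  then show "\<exists>h. has_type h (RC p Ts)" using S by (auto simp: type_odds_def)
  show "type_size (RC p Ts) = n" by (rule n)
  show "has_weight_partition h W' \<longleftrightarrow> W' = W" if "has_type h (RC p Ts)" for h W'
    using mW by (intro has_type_weight_partition[OF that W]) simp
  have le: "\<And>a. a \<in> S \<Longrightarrow> a \<le> n" using S type_odds_le n by blast
  from Upair_image_symmetric[of S n, OF le]
  show "Ps = (\<lambda>a. Upair a (n - a)) ` type_odds (RC p Ts)"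
    unfolding type_odds_RC[OF p Ts] S_def[symmetric] n by (simp add: Ps S_def image_image)
qed

section \<open>Sums of type \<open>R\<^sub>p\<close> and \<open>(R\<^sub>5 : R\<^sub>3)\<close>\<close>

definition mu :: "nat \<Rightarrow> complex multiset" where
  "mu p = mset_set {u. u ^ p = 1}"

text \<open>A sum of type \<open>(R\<^sub>5 : R\<^sub>3)\<close>: in \<open>R\<^sub>5\<close> the term \<open>1\<close> is replaced by \<open>- \<nu>\<^sub>3 - \<nu>\<^sub>3\<^sup>2 = 1\<close>.\<close>
definition six_sum :: "complex multiset" where
  "six_sum = {#nu 5, nu 5 ^ 2, nu 5 ^ 3, nu 5 ^ 4, - nu 3, - (nu 3 ^ 2)#}"

lemma in_mu_iff [simp]: "p > 0 \<Longrightarrow> u \<in># mu p \<longleftrightarrow> u ^ p = 1"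
  by (simp add: mu_def finite_roots_unity)

lemma count_mu: "count (mu p) u \<le> 1"
  by (cases "u ^ p = 1"; cases "finite {u::complex. u ^ p = 1}") (simp_all add: mu_def)

lemma size_mu [simp]: "p > 0 \<Longrightarrow> size (mu p) = p"
  by (simp add: mu_def card_roots_unity_eq)

lemma mu_prime: "prime p \<Longrightarrow> mu p = image_mset (\<lambda>j. nu p ^ j) (mset_set {..<p})"
  using image_mset_roots_of_unity[of p 1 "\<lambda>u. u"] prime_gt_1_nat[of p] by (auto simp: mu_def)

lemma image_mset_eq_sum: "finite A \<Longrightarrow> image_mset g (mset_set A) = (\<Sum>j\<in>A. {#g j#})"
  by (induction A rule: finite_induct) auto

lemma rot_mu: "c ^ p = 1 \<Longrightarrow> p > 0 \<Longrightarrow> rot c (mu p) = mu p"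
  using image_mset_times_root[of c p "\<lambda>u. u"] by (simp add: rot_def mu_def)

lemma has_type_Rp_shape:
  assumes "has_type h (Rp p)"
  obtains z where "root_of_unity z" "h = rot z (mu p)"
proof -
  obtain f where f: "minimal_vanishing h" "top_decomp h p f" "\<And>j. j < p \<Longrightarrow> f j = {#1#}"
    using has_type_Rp_components[OF assms] by blast
  obtain z where z: "root_of_unity z" "rot z h = (\<Sum>j<p. rot (nu p ^ j) (f j))"
    using f(2) by (auto simp: top_decomp_def)
  have "rot z h = (\<Sum>j<p. {#nu p ^ j#})" unfolding z(2) by (intro sum.cong) (auto simp: f(3))
  also have "\<dots> = mu p"
    using mu_prime[OF top_decomp_props(2)[OF f(1,2) refl]] by (simp add: image_mset_eq_sum)
  finally have "h = rot (1 / z) (mu p)"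
    using rot_eq_iff[OF root_of_unity_ne_0[OF z(1)]] by blast
  then show ?thesis using that root_of_unity_inverse[OF z(1)] by blast
qed

lemma has_type_mu: "prime p \<Longrightarrow> has_type (mu p) (Rp p)"
proof -
  assume "prime p"
  then obtain h where h: "has_type h (Rp p)" using realise_Rp by blast
  then obtain z where z: "root_of_unity z" "h = rot z (mu p)" using has_type_Rp_shape by blast
  then have "mu p = rot (1 / z) h" using root_of_unity_ne_0 by simp
  then show ?thesis using has_type_rot[OF h root_of_unity_inverse[OF z(1)]] by simp
qed

lemma has_type_Rp_containing_1:
  assumes "has_type h (Rp p)" "1 \<in># h" shows "h = mu p"
proof -
  have p: "p > 0"
    using has_type_Rp_components[OF assms(1)] top_decomp_props(2) prime_gt_0_nat by metis
  obtain z where z: "root_of_unity z" "h = rot z (mu p)" using has_type_Rp_shape[OF assms(1)] .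
  then obtain u where u: "u ^ p = 1" "1 = z * u" using assms(2) p by auto
  then have "(z * u) ^ p = 1" by simp
  then have "z ^ p = 1" using u(1) by (simp add: power_mult_distrib)
  then show ?thesis using z(2) rot_mu p by simp
qed

lemma nu_3_cube: "nu 3 ^ 3 = 1" and nu_5_fifth: "nu 5 ^ 5 = 1"
  by simp_all

lemma nu_ne_0 [simp]: "n > 0 \<Longrightarrow> nu n \<noteq> 0"
  using root_of_unity_nu root_of_unity_ne_0 by blast

lemma mu_3: "mu 3 = {#1, nu 3, nu 3 ^ 2#}"
proof -
  have set: "{..<3} = {0, 1, 2::nat}" by auto
  show ?thesis by (simp add: mu_prime set)
qed

lemma mu_2: "mu 2 = {#1, - 1#}"
proof -
  have "{u::complex. u ^ 2 = 1} = {1, - 1}" by (auto simp: power2_eq_1_iff)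
  then show ?thesis by (simp add: mu_def)
qed

lemma nu_3_relation: "1 + nu 3 + nu 3 ^ 2 = 0"
  using has_sum_type_sum(1)[OF has_type_mu[of 3]] by (simp add: mu_3 add.assoc)

lemma nu_5_reduce:
  "nu 5 ^ 6 = nu 5" "nu 5 ^ 7 = nu 5 ^ 2" "nu 5 ^ 8 = nu 5 ^ 3"
proof -
  have "nu 5 ^ (5 + k) = nu 5 ^ k" for k by (simp only: power_add nu_5_fifth mult_1)
  from this[of 1] this[of 2] this[of 3]
  show "nu 5 ^ 6 = nu 5" "nu 5 ^ 7 = nu 5 ^ 2" "nu 5 ^ 8 = nu 5 ^ 3" by simp_all
qed

text \<open>
  The position \<open>i\<close> of the component that differs from the base can be changed by a rotation.
\<close>
lemma rot_six_sum:
  assumes i: "i \<in> {1..<5}"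
    and f: "f i = {#- nu 3, - (nu 3 ^ 2)#}" "\<And>j. j < 5 \<Longrightarrow> j \<noteq> i \<Longrightarrow> f j = {#1#}"
  shows "(\<Sum>j<5. rot (nu 5 ^ j) (f j)) = rot (nu 5 ^ i) six_sum"
proof -
  have set: "{..<5} = {0, 1, 2, 3, 4::nat}" by auto
  have f': "f 0 = {#1#}" "i \<noteq> 1 \<Longrightarrow> f 1 = {#1#}" "i \<noteq> 2 \<Longrightarrow> f 2 = {#1#}" "i \<noteq> 3 \<Longrightarrow> f 3 = {#1#}"
    "i \<noteq> 4 \<Longrightarrow> f 4 = {#1#}"
    using i f(2) by auto
  have "i = 1 \<or> i = 2 \<or> i = 3 \<or> i = 4" using i by auto
  moreover have p: "nu 5 * nu 5 = nu 5 ^ 2" "nu 5 * nu 5 ^ 2 = nu 5 ^ 3" "nu 5 * nu 5 ^ 3 = nu 5 ^ 4"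
    "nu 5 * nu 5 ^ 4 = 1" "nu 5 ^ 2 * nu 5 = nu 5 ^ 3" "nu 5 ^ 2 * nu 5 ^ 2 = nu 5 ^ 4"
    "nu 5 ^ 2 * nu 5 ^ 3 = 1" "nu 5 ^ 2 * nu 5 ^ 4 = nu 5" "nu 5 ^ 3 * nu 5 = nu 5 ^ 4"
    "nu 5 ^ 3 * nu 5 ^ 2 = 1" "nu 5 ^ 3 * nu 5 ^ 3 = nu 5" "nu 5 ^ 3 * nu 5 ^ 4 = nu 5 ^ 2"
    "nu 5 ^ 4 * nu 5 = 1" "nu 5 ^ 4 * nu 5 ^ 2 = nu 5" "nu 5 ^ 4 * nu 5 ^ 3 = nu 5 ^ 2"
    "nu 5 ^ 4 * nu 5 ^ 4 = nu 5 ^ 3"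
    using nu_5_reduce nu_5_fifth
    by (simp_all flip: power_add power_Suc power_Suc2 add: power2_eq_square[symmetric])
  ultimately show ?thesis
    by (elim disjE; use f f' in \<open>simp add: set six_sum_def p ac_simps\<close>)
qed

lemma six_sum_shape:
  assumes ht: "has_type h (RC 5 (copies 1 (Rp 3)))"
  obtains z where "root_of_unity z" "h = rot z six_sum"
  using ht
proof cases
  case (Comp f J T)
  have h: "minimal_vanishing h" and d: "top_decomp h 5 f" by (rule Comp)+
  have f0: "f 0 = {#1#}" using Comp(1) by simp
  have finJ: "finite J" using Comp by simp
  have "size (image_mset T (mset_set J)) = 1" using Comp(2) by (metis size_replicate_mset)
  then have "card J = 1" by simp
  then obtain i where i: "J = {i}" using card_1_singletonE by blast
  have Ti: "T i = {#Rp 3#}" using Comp(2) by (simp add: i)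
  have "has_sum_type (f 0 + rot (- 1) (f i)) {#Rp 3#}" using Comp i Ti by auto
  then have "has_type ({#1#} + rot (- 1) (f i)) (Rp 3)" by (simp add: f0)
  then have "{#1#} + rot (- 1) (f i) = mu 3" by (rule has_type_Rp_containing_1) simp
  then have "rot (- 1) (f i) = {#nu 3, nu 3 ^ 2#}" by (simp add: mu_3)
  then have "rot (- 1) (rot (- 1) (f i)) = {#- nu 3, - (nu 3 ^ 2)#}" by simp
  then have fi: "f i = {#- nu 3, - (nu 3 ^ 2)#}" by simp
  obtain z where z: "root_of_unity z" "rot z h = (\<Sum>j<5. rot (nu 5 ^ j) (f j))"
    using d by (auto simp: top_decomp_def)
  have i5: "i \<in> {1..<5}" using Comp i by auto
  have fj: "f j = {#1#}" if "j < 5" "j \<noteq> i" for j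
  proof (cases "j = 0")
    case False
    then have "j \<notin> J" "j \<in> {1..<5}" using that i by auto
    then show ?thesis using Comp(5) f0 by auto
  qed (simp add: f0)
  have "rot z h = rot (nu 5 ^ i) six_sum" unfolding z(2) by (rule rot_six_sum[where f = f, OF i5 fi fj])
  then have "h = rot (nu 5 ^ i / z) six_sum" using root_of_unity_ne_0[OF z(1)] by (simp add: rot_eq_iff)
  moreover have "root_of_unity (nu 5 ^ i / z)"
    using z(1) by (intro root_of_unity_divide root_of_unity_power root_of_unity_nu) auto
  ultimately show ?thesis using that by blast
qed

lemma has_type_six_sum: "has_type six_sum (RC 5 (copies 1 (Rp 3)))"
proof -
  have "4 \<in> type_odds (RC 5 (copies 1 (Rp 3)))" using type_odds_RC5[of 1] by simp
  then obtain h where h: "has_type h (RC 5 (copies 1 (Rp 3)))" by (auto simp: type_odds_def)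
  obtain z where z: "root_of_unity z" "h = rot z six_sum" using six_sum_shape[OF h] .
  then have "six_sum = rot (1 / z) h" using root_of_unity_ne_0 by simp
  then show ?thesis using has_type_rot[OF h root_of_unity_inverse[OF z(1)]] by simp
qed

lemma odd_root_nu_powers [simp]:
  "odd_root (nu 3)" "odd_root (nu 5)" "odd_root (nu 3 ^ k)" "odd_root (nu 5 ^ k)"
  by (auto intro!: odd_root_power odd_root_nu)

lemma not_odd_root_minus_nu [simp]:
  "\<not> odd_root (- nu 3)" "\<not> odd_root (- (nu 3 ^ k))"
  by (auto intro!: not_odd_root_minus)

lemma odds_six_sum: "odds six_sum = 4" "size six_sum = 6"
  by (simp_all add: six_sum_def)

lemma six_sum_signed: "w \<in># six_sum \<Longrightarrow> signed_odd_root w"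
  by (auto simp: six_sum_def signed_odd_root_def)

lemma pair_subset_members: "{#x, y#} \<subseteq># A \<Longrightarrow> x \<in># A \<and> y \<in># A"
  using mset_subset_eqD[of "{#x, y#}" A] by simp

lemma six_sum_members:
  assumes "w \<in># six_sum"
  shows "w = nu 5 ^ 1 \<or> w = nu 5 ^ 2 \<or> w = nu 5 ^ 3 \<or> w = nu 5 ^ 4 \<or>
    w = - (nu 3 ^ 1) \<or> w = - (nu 3 ^ 2)"
  using assms by (auto simp: six_sum_def)

lemma six_sum_order: "w \<in># six_sum \<Longrightarrow> w ^ 30 = 1"
proof -
  have five: "(nu 5 ^ k) ^ 30 = 1" for k
  proof -
    have "(nu 5 ^ k) ^ 30 = (nu 5 ^ 5) ^ (6 * k)" by (simp only: power_mult[symmetric] mult_ac) simp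
    then show ?thesis by simp
  qed
  have three: "(- (nu 3 ^ k)) ^ 30 = 1" for k
  proof -
    have "(- (nu 3 ^ k)) ^ 30 = (nu 3 ^ k) ^ 30" by simp
    also have "\<dots> = (nu 3 ^ 3) ^ (10 * k)" by (simp only: power_mult[symmetric] mult_ac) simp
    finally show ?thesis by simp
  qed
  assume "w \<in># six_sum"
  from six_sum_members[OF this] show ?thesis by (elim disjE) (simp_all only: five three)
qed

lemma six_sum_cases:
  assumes "w \<in># six_sum"
  obtains "odd_root w" "w ^ 5 = 1" | "odd_root (- w)" "(- w) ^ 3 = 1"
proof -
  have "(nu 5 ^ k) ^ 5 = 1" for k by (metis nu_5_fifth power_mult mult.commute power_one)
  then have five: thesis if "w = nu 5 ^ k" for k using \<open>odd_root w \<Longrightarrow> w ^ 5 = 1 \<Longrightarrow> thesis\<close> that by simp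
  have "(nu 3 ^ k) ^ 3 = 1" for k by (metis nu_3_cube power_mult mult.commute power_one)
  then have three: thesis if "w = - (nu 3 ^ k)" for k
    using \<open>odd_root (- w) \<Longrightarrow> (- w) ^ 3 = 1 \<Longrightarrow> thesis\<close> that by simp
  from six_sum_members[OF assms] show thesis by (elim disjE) (fact five three)+
qed

lemma nu_5_power_cube: "(nu 5 ^ y) ^ 3 = 1 \<longleftrightarrow> 5 dvd y"
proof -
  have "(nu 5 ^ y) ^ 3 = nu 5 ^ (y * 3)" by (simp add: power_mult)
  also have "\<dots> = 1 \<longleftrightarrow> 5 dvd y * 3" by (rule nu_power_eq_1_iff) simp
  also have "\<dots> \<longleftrightarrow> 5 dvd y" by presburger
  finally show ?thesis .
qed

lemma nu_3_fifth: "nu 3 ^ 5 \<noteq> 1"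
  by (subst nu_power_eq_1_iff) auto

section \<open>Entries over a base of two terms\<close>

lemma replicate_mset_numeral:
  "replicate_mset (numeral k) x = add_mset x (replicate_mset (pred_numeral k) x)"
  by (simp add: numeral_eq_Suc)

text \<open>
  Since \<open>30 = 2 \<cdot> 3 \<cdot> 5\<close> is prime to \<open>7\<close>, components with terms in \<open>\<mu>\<^sub>3\<^sub>0\<close> can be placed freely at
  the positions \<open>1, \<dots>, m\<close>. One of them has to differ from the base by a minimal sum; for the
  others it suffices that they contain no vanishing part.
\<close>
lemma realise_pair:
  fixes m i :: nat
  assumes a: "a ^ 30 = 1" and m: "1 \<le> m" "m \<le> 6" and i: "i \<in> {1..m}"
    and mini: "minimal_vanishing ({#1, a#} + rot (- 1) (F i))"
    and F: "\<And>j. j \<in> {1..m} \<Longrightarrow> has_sum_type ({#1, a#} + rot (- 1) (F j)) (X j)"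
      "\<And>j w. j \<in> {1..m} \<Longrightarrow> w \<in># F j \<Longrightarrow> w ^ 30 = 1" "\<And>j. j \<in> {1..m} \<Longrightarrow> size (F j) \<ge> 3"
      "\<And>j k. j \<in> {1..m} \<Longrightarrow> k \<subseteq># F j \<Longrightarrow> sum_mset k = 0 \<Longrightarrow> k = {#}"
  shows "\<exists>h. has_type h (Comp 7 {#1, a#} (image_mset X (mset_set {1..m})))"
proof -
  define f where "f j = (if j \<in> {1..m} then F j else {#1, a#})" for j
  have f0: "f 0 = {#1, a#}" by (simp add: f_def)
  have primes: "q < 7" if "prime q" "q dvd 30" for q :: nat
  proof -
    have "q dvd 2 * 3 * 5" using that(2) by simp
    then have "q dvd 2 \<or> q dvd 3 \<or> q dvd 5" using that(1) by (simp only: prime_dvd_mult_iff) blast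
    then show ?thesis by (auto dest: dvd_imp_le)
  qed
  have "has_type (\<Sum>j<7. rot (nu 7 ^ j) (f j)) (Comp 7 (f 0) (image_mset X (mset_set {1..m})))"
  proof (rule realise_Comp[where M = 30 and i = i and f = f and p = 7])
    show "minimal_vanishing (f 0 + rot (- 1) (f i))" using mini i by (simp only: f0) (simp add: f_def)
    show "f j \<noteq> f 0" if "j \<in> {1..m}" for j
      using F(3)[OF that] that by (simp only: f0) (auto simp: f_def)
    show "has_sum_type (f 0 + rot (- 1) (f j)) (X j)" if "j \<in> {1..m}" for j
      using F(1)[OF that] that by (simp only: f0) (simp add: f_def)
    show "size (f 0) \<le> size (f j)" if "j \<in> {1..m}" for j
      using F(3)[OF that] that by (simp only: f0) (simp add: f_def)
    show "f j = f 0" if "j \<notin> {1..m}" for j unfolding f0 unfolding f_def using that by (rule if_not_P)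
    show "w ^ 30 = 1" if "w \<in># f j" for j w using that a F(2)[of j w] by (auto simp: f_def split: if_splits)
    show "k = {#}" if "j \<in> {1..m}" "k \<subseteq># f j" "sum_mset k = 0" for j k
      using F(4)[OF that(1)] that by (simp add: f_def)
    show "1 \<in># f 0" by (simp add: f0)
  qed (use primes i m in auto)
  then show ?thesis using f0 by metis
qed

lemma complement_in_minimal:
  assumes "{#1, a#} \<subseteq># v" "F = rot (- 1) (v - {#1, a#})"
  shows "{#1, a#} + rot (- 1) F = v" and "size F = size v - 2" and "w \<in># F \<Longrightarrow> - w \<in># v"
  using assms subset_mset.add_diff_inverse[OF assms(1)] by (auto simp: size_Diff_submset dest: in_diffD)

text \<open>
  For the types over a two-term base all choices of the components lead to the same parity \<open>P\<close>, so
  that \<open>P\<close> is attained as soon as there is a sum of the type.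
\<close>
lemma valid_entry_pair:
  assumes ex: "\<exists>h. has_type h (Comp 7 f0 Ts)" and n: "type_size (Comp 7 f0 Ts) = n"
    and W: "sorted W" "mset W = replicate_mset (7 - size Ts) (size f0) +
      image_mset (\<lambda>X. sum_mset (image_mset type_size X) - size f0) Ts"
    and P: "\<And>s. s \<in> choice_sums (compl_odds f0) Ts \<Longrightarrow>
      Upair ((7 - size Ts) * odds f0 + s) (n - ((7 - size Ts) * odds f0 + s)) = P"
  shows "valid_entry n (Comp 7 f0 Ts) W {P}"
proof (rule valid_entryI[OF ex n])
  let ?T = "Comp 7 f0 Ts"
  show "has_weight_partition h W' \<longleftrightarrow> W' = W" if "has_type h ?T" for h W'
    using has_type_weight_partition[OF that W] .
  define S where "S = {a. a \<le> n \<and> Upair a (n - a) = P}"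
  have "type_odds ?T \<subseteq> S \<union> (\<lambda>a. type_size ?T - a) ` S"
  proof (rule type_odds_subset)
    fix h assume h: "has_type h ?T"
    obtain z s where z: "root_of_unity z" "\<forall>w\<in>#rot z h. signed_odd_root w"
      and s: "s \<in> choice_sums (compl_odds f0) Ts" "odds (rot z h) = (7 - size Ts) * odds f0 + s"
      using has_type_Comp_odds[OF h] by auto
    have "odds (rot z h) \<le> n" using odds_le[of "rot z h"] has_type_size(1)[OF h] n by simp
    then have "odds (rot z h) \<in> S" using P[OF s(1)] s(2) by (simp add: S_def)
    then show "\<exists>z. root_of_unity z \<and> (\<forall>w\<in>#rot z h. signed_odd_root w) \<and> odds (rot z h) \<in> S"
      using z by blast
  qed
  also have "\<dots> \<subseteq> S" unfolding n by (auto simp: S_def)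
  finally have sub: "type_odds ?T \<subseteq> S" .
  obtain h where h: "has_type h ?T" using ex by blast
  obtain z where z: "root_of_unity z" "\<forall>w\<in>#rot z h. signed_odd_root w"
    using signed_rotation_exists[OF has_type_minimal[OF h]] by blast
  have "odds (rot z h) \<in> type_odds ?T" using z has_type_rot[OF h z(1)] by (intro type_oddsI)
  then show "{P} = (\<lambda>a. Upair a (n - a)) ` type_odds ?T" using sub by (fastforce simp: S_def)
qed

text \<open>
  In terms of \<open>v = f0 - f\<close>, the odd terms of \<open>f\<close> are the negatives of the even terms of \<open>v\<close>
  outside the base.
\<close>
lemma compl_odds_obtain:
  assumes b: "b \<in> compl_odds f0 X" and f0: "\<forall>w\<in>#f0. signed_odd_root w"
  obtains v where "has_sum_type v X" "\<forall>w\<in>#v. signed_odd_root w" "f0 \<subseteq># v" "odds f0 \<le> odds v"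
    "b = size v - size f0 - (odds v - odds f0)"
proof -
  obtain f where f: "has_sum_type (f0 + rot (- 1) f) X" "\<forall>w\<in>#f. signed_odd_root w" "b = odds f"
    using b by (auto simp: compl_odds_def)
  define v where "v = f0 + rot (- 1) f"
  have "odds v = odds f0 + (size f - odds f)" "size v = size f0 + size f"
    using odds_rot_minus_1[OF f(2)] by (simp_all add: v_def)
  then have "b = size v - size f0 - (odds v - odds f0)" "odds f0 \<le> odds v"
    using f(3) odds_le[of f] by simp_all
  moreover have "\<forall>w\<in>#v. signed_odd_root w" using f0 f(2) signed_odd_root_minus by (auto simp: v_def)
  ultimately show ?thesis using that[of v] f(1) by (simp add: v_def)
qed

lemma odds_of_type: "has_type v T \<Longrightarrow> \<forall>w\<in>#v. signed_odd_root w \<Longrightarrow> odds v \<in> type_odds T \<and> size v = type_size T"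
  using type_oddsI has_type_size(1) by blast

lemma signed_pair:
  "signed_odd_root a \<Longrightarrow> \<forall>w\<in>#{#1, a#}. signed_odd_root w"
  by simp

text \<open>
  The terms of a sum of type \<open>R\<^sub>5\<close> differ by fifth roots of unity. As those of the base are odd,
  so are the other three, and their negatives are even.
\<close>
lemma compl_odds_pair_R5:
  assumes b: "b \<in> compl_odds {#1, nu 5 ^ y#} {#Rp 5#}" shows "b = 0"
proof -
  obtain v where v: "has_sum_type v {#Rp 5#}" "\<forall>w\<in>#v. signed_odd_root w"
    "odds {#1, nu 5 ^ y#} \<le> odds v" "b = size v - size {#1, nu 5 ^ y#} - (odds v - odds {#1, nu 5 ^ y#})"
    using compl_odds_obtain[OF b] by (auto simp: signed_odd_root_def)
  then show ?thesis using odds_of_type[of v "Rp 5"] type_odds_Rp[of 5] by auto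
qed

text \<open>
  A sum of type \<open>R\<^sub>2\<close> contains one odd term, one of type \<open>R\<^sub>3\<close> none or three. As both terms of the
  base are odd, it is three, and the only even term is that of \<open>R\<^sub>2\<close>.
\<close>
lemma compl_odds_pair_R2_R3:
  assumes b: "b \<in> compl_odds {#1, nu 5 ^ y#} {#Rp 2, Rp 3#}" shows "b = 1"
proof -
  obtain v where v: "has_sum_type v {#Rp 2, Rp 3#}" "\<forall>w\<in>#v. signed_odd_root w"
    "odds {#1, nu 5 ^ y#} \<le> odds v" "b = size v - size {#1, nu 5 ^ y#} - (odds v - odds {#1, nu 5 ^ y#})"
    using compl_odds_obtain[OF b] by (auto simp: signed_odd_root_def)
  have "\<exists>v2 v3. v = v2 + v3 \<and> has_type v2 (Rp 2) \<and> has_type v3 (Rp 3)"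
    using v(1)
  proof cases
    case (add v' T h Ts)
    then consider "T = Rp 2" "Ts = {#Rp 3#}" | "T = Rp 3" "Ts = {#Rp 2#}"
      by (auto simp: add_eq_conv_ex)
    then show ?thesis
      by cases (use add has_sum_type_single add.commute in metis)+
  qed simp
  then obtain v2 v3 where v23: "v = v2 + v3" "has_type v2 (Rp 2)" "has_type v3 (Rp 3)" by blast
  have "odds v2 = 1"
  proof -
    obtain z where z: "root_of_unity z" "v2 = rot z (mu 2)" using has_type_Rp_shape[OF v23(2)] .
    then have "v2 = {#z, - z#}" by (simp add: mu_2)
    moreover have "signed_odd_root z" using v(2) v23(1) calculation by auto
    ultimately show ?thesis using odd_root_minus_iff by auto
  qed
  moreover have "odds v3 \<in> {0, 3}" "size v3 = 3"
    using odds_of_type[OF v23(3)] v(2) v23(1) type_odds_Rp[of 3] by auto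
  moreover have "size v2 = 2" using has_type_size(1)[OF v23(2)] by simp
  ultimately show ?thesis using v(3,4) v23(1) by auto
qed

lemma pair_in_six_sum:
  assumes "has_type v (RC 5 (copies 1 (Rp 3)))" "{#1, a#} \<subseteq># v"
  obtains z x y where "root_of_unity z" "v = rot z six_sum" "{#x, y#} \<subseteq># six_sum" "1 = z * x" "a = y / x"
proof -
  obtain z where z: "root_of_unity z" "v = rot z six_sum" using six_sum_shape[OF assms(1)] .
  have z0: "z \<noteq> 0" using z root_of_unity_ne_0 by blast
  have "rot (1 / z) {#1, a#} \<subseteq># rot (1 / z) v" using assms(2) by (rule rot_mono)
  then have "{#1 / z, a / z#} \<subseteq># six_sum" using z0 z(2) by simp
  then show ?thesis using that[of z "1 / z" "a / z"] z z0 by simp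
qed

text \<open>
  The sum around the base is the rotation of \<open>six_sum\<close> that takes some term \<open>x\<close> to \<open>1\<close>. It has the
  four odd and two even terms of \<open>six_sum\<close> if \<open>x\<close> is odd, and they are exchanged if \<open>x\<close> is even.
\<close>
lemma compl_odds_pair_six_sum:
  assumes b: "b \<in> compl_odds {#1, a#} {#RC 5 (copies 1 (Rp 3))#}" and a: "signed_odd_root a"
  obtains z x y where "{#x, y#} \<subseteq># six_sum" "a = y / x"
    "odd_root x \<and> b = 4 - (4 - odds {#1, a#}) \<or> \<not> odd_root x \<and> b = 4 - (2 - odds {#1, a#})"
proof -
  obtain v where v: "has_sum_type v {#RC 5 (copies 1 (Rp 3))#}" "\<forall>w\<in>#v. signed_odd_root w"
    "{#1, a#} \<subseteq># v" "b = size v - size {#1, a#} - (odds v - odds {#1, a#})"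
    using compl_odds_obtain[OF b signed_pair[OF a]] by metis
  obtain z x y where z: "root_of_unity z" "v = rot z six_sum" "{#x, y#} \<subseteq># six_sum" "1 = z * x" "a = y / x"
    using pair_in_six_sum[OF v(1)[unfolded has_sum_type_single] v(3)] .
  have x0: "x \<noteq> 0" using z(4) by auto
  have zx: "z = 1 / x" using z(4) x0 by (simp add: field_simps)
  have sx: "signed_odd_root x" using six_sum_signed z(3) by (meson insert_subset_eq_iff)
  have "odd_root x \<and> odds v = 4 \<or> \<not> odd_root x \<and> odds v = 2"
  proof (cases "odd_root x")
    case True
    then show ?thesis unfolding z(2) zx by (simp add: odds_rot_odd odd_root_inverse odds_six_sum)
  next
    case False
    then have "odd_root (- x)" using sx by (simp add: signed_odd_root_def)
    then have "odd_root (1 / - x)" by (rule odd_root_inverse)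
    moreover have "v = rot (1 / - x) (rot (- 1) six_sum)" unfolding z(2) zx by simp
    ultimately have "odds v = odds (rot (- 1) six_sum)" by (simp only: odds_rot_odd)
    then show ?thesis using False six_sum_signed odds_rot_minus_1[of six_sum] by (simp add: odds_six_sum)
  qed
  moreover have "size v = 6" using z(2) by (simp add: odds_six_sum)
  ultimately show ?thesis using that[OF z(3) z(5)] v(4) by auto
qed

text \<open>
  The base \<open>1 + a\<close> consists of two fifth roots of unity. The component \<open>F\<close> complements it to
  \<open>R\<^sub>5\<close>. For the component \<open>G\<close> the difference from the base is \<open>(1 - 1) + a (1 + \<nu>\<^sub>3 + \<nu>\<^sub>3\<^sup>2)\<close>, of
  type \<open>R\<^sub>2 \<oplus> R\<^sub>3\<close>. This difference is not minimal, but \<open>G\<close> contains no vanishing part since it is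
  a proper part of the rotation of \<open>six_sum\<close> by \<open>a\<close>.
\<close>
lemma valid_entry_pair_R5:
  assumes y: "y \<in> {1, 2::nat}"
  shows "valid_entry 15 (Comp 7 {#1, nu 5 ^ y#} (copies 1 (Rp 5))) (replicate 6 2 @ [3]) {Upair 12 3}"
    and "valid_entry 16 (Comp 7 {#1, nu 5 ^ y#} (copies 2 (Rp 5))) (replicate 5 2 @ replicate 2 3)
        {Upair 10 6}"
    and "valid_entry 16 (Comp 7 {#1, nu 5 ^ y#} ({#{#Rp 2, Rp 3#}#} + copies 1 (Rp 5)))
      (replicate 5 2 @ replicate 2 3) {Upair 11 5}"
proof -
  define a where "a = nu 5 ^ y"
  have a5: "a ^ 5 = 1" unfolding a_def by (metis nu_5_fifth power_mult mult.commute power_one)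
  have a1: "a \<noteq> 1" using y by (auto simp: a_def nu_power_eq_1_iff[of 5])
  have "a ^ (5 * 6) = 1" by (simp only: power_mult a5 power_one)
  then have a30: "a ^ 30 = 1" by simp
  have sub: "{#1, a#} \<subseteq># mu 5" using a5 a1
    by (simp add: insert_subset_eq_iff in_diff_count mu_def finite_roots_unity)
  define F where "F = rot (- 1) (mu 5 - {#1, a#})"
  note F = complement_in_minimal[OF sub F_def]
  have m5: "has_type (mu 5) (Rp 5)" by (rule has_type_mu) simp
  have mv: "minimal_vanishing ({#1, a#} + rot (- 1) F)" using F(1) has_type_minimal[OF m5] by simp
  have F30: "w ^ 30 = 1" if "w \<in># F" for w
  proof -
    have "(- w) ^ 5 = 1" using F(3)[OF that] by simp
    then have "((- w) ^ 5) ^ 6 = 1" by simp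
    then show ?thesis by (simp only: power_mult[symmetric]) simp
  qed
  have Ff: "k = {#}" if "k \<subseteq># F" "sum_mset k = 0" for k
    using zero_free_of_minimal[OF mv _ that] by simp
  define G where "G = {#1, - (a * nu 3), - (a * nu 3 ^ 2)#}"
  have sixa: "minimal_vanishing (rot a six_sum)"
    using has_type_minimal[OF has_type_six_sum] a30
      by (intro minimal_vanishing_rot root_of_unityI[of 30]) auto
  have Gsub: "G \<subseteq># rot a six_sum"
  proof -
    have "\<exists>x. x \<in># {#nu 5, nu 5 ^ 2, nu 5 ^ 3, nu 5 ^ 4#} \<and> a * x = 1"
      using y nu_5_fifth
        by (auto simp: a_def intro: exI[of _ "nu 5 ^ 4"] exI[of _ "nu 5 ^ 3"] simp flip: power_add
          power_Suc)
    then obtain x where x: "x \<in># {#nu 5, nu 5 ^ 2, nu 5 ^ 3, nu 5 ^ 4#}" "a * x = 1" by blast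
    have "six_sum = {#nu 5, nu 5 ^ 2, nu 5 ^ 3, nu 5 ^ 4#} + {#- nu 3, - (nu 3 ^ 2)#}"
      by (simp add: six_sum_def)
    then have "{#x#} + {#- nu 3, - (nu 3 ^ 2)#} \<subseteq># six_sum"
      using x(1) by (metis mset_subset_eq_mono_add mset_subset_eq_single subset_mset.order_refl)
    then have "rot a ({#x#} + {#- nu 3, - (nu 3 ^ 2)#}) \<subseteq># rot a six_sum" by (rule rot_mono)
    then show ?thesis using x(2) by (simp add: G_def add_mset_commute)
  qed
  have Gf: "k = {#}" if "k \<subseteq># G" "sum_mset k = 0" for k
  proof -
    have "k = {#} \<or> k = rot a six_sum"
      using that Gsub by (intro minimal_vanishing_sub[OF sixa]) auto
    moreover have "size k \<le> 3" using size_mset_mono[OF that(1)] by (simp add: G_def)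
    ultimately show ?thesis by (auto simp: odds_six_sum)
  qed
  have G30: "w ^ 30 = 1" if w: "w \<in># G" for w
  proof -
    obtain u where "u \<in># six_sum" "w = a * u" using mset_subset_eqD[OF Gsub w] by auto
    then show ?thesis using a30 six_sum_order by (simp add: power_mult_distrib)
  qed
  have Gs: "has_sum_type ({#1, a#} + rot (- 1) G) {#Rp 2, Rp 3#}"
  proof -
    have "has_sum_type (rot a (mu 3)) {#Rp 3#}"
      using has_type_mu[of 3] a30 by (simp add: has_type_rot root_of_unityI[of 30])
    then have "has_sum_type (mu 2 + rot a (mu 3)) {#Rp 2, Rp 3#}"
      using has_type_mu[of 2] by (intro has_type_has_sum_type.add) auto
    moreover have "{#1, a#} + rot (- 1) G = mu 2 + rot a (mu 3)"
      by (simp add: G_def mu_2 mu_3)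
    ultimately show ?thesis by simp
  qed
  have ex1: "\<exists>h. has_type h (Comp 7 {#1, a#} (copies 1 (Rp 5)))"
    using realise_pair[OF a30, of 1 1 "\<lambda>_. F" "\<lambda>_. {#Rp 5#}"] mv F F30 Ff m5 by auto
  have ex2: "\<exists>h. has_type h (Comp 7 {#1, a#} (copies 2 (Rp 5)))"
    using realise_pair[OF a30, of 2 1 "\<lambda>_. F" "\<lambda>_. {#Rp 5#}"] mv F F30 Ff m5
    by (simp add: numeral_2_eq_2 image_mset_const_eq)
  have ex3: "\<exists>h. has_type h (Comp 7 {#1, a#} ({#{#Rp 2, Rp 3#}#} + copies 1 (Rp 5)))"
  proof -
    define H where "H j = (if j = 1 then G else F)" for j :: nat
    define X where "X j = (if j = 1 then {#Rp 2, Rp 3#} else {#Rp 5#})" for j :: nat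
    have "\<exists>h. has_type h (Comp 7 {#1, a#} (image_mset X (mset_set {1..2})))"
    proof (rule realise_pair[OF a30, of 2 2 H X])
      show "minimal_vanishing ({#1, a#} + rot (- 1) (H 2))" using mv by (simp add: H_def)
      show "has_sum_type ({#1, a#} + rot (- 1) (H j)) (X j)" for j
        using Gs F(1) m5 by (simp add: H_def X_def)
      show "w ^ 30 = 1" if "w \<in># H j" for j w using that G30 F30 by (simp add: H_def split: if_splits)
      show "3 \<le> size (H j)" for j using F(2) by (simp add: H_def G_def)
      show "k = {#}" if "k \<subseteq># H j" "sum_mset k = 0" for j k
        using that Gf Ff by (simp add: H_def split: if_splits)
    qed auto
    moreover have "{1..2} = {1, 2::nat}" by auto
    ultimately show ?thesis by (simp add: X_def add_mset_commute)
  qed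
  have o: "odd_root a" by (simp add: a_def)
  note c5 = compl_odds_pair_R5[of _ y, folded a_def] and c23 = compl_odds_pair_R2_R3[of _ y, folded a_def]
  show "valid_entry 15 (Comp 7 {#1, nu 5 ^ y#} (copies 1 (Rp 5))) (replicate 6 2 @ [3]) {Upair 12 3}"
    unfolding a_def[symmetric]
    by (rule valid_entry_pair[OF ex1]) (auto simp: o replicate_mset_numeral sorted_append numeral_2_eq_2
      dest!: c5)
  show "valid_entry 16 (Comp 7 {#1, nu 5 ^ y#} (copies 2 (Rp 5))) (replicate 5 2 @ replicate 2 3)
      {Upair 10 6}"
    unfolding a_def[symmetric]
    by (rule valid_entry_pair[OF ex2]) (auto simp: o replicate_mset_numeral sorted_append numeral_2_eq_2
      dest!: c5)
  show "valid_entry 16 (Comp 7 {#1, nu 5 ^ y#} ({#{#Rp 2, Rp 3#}#} + copies 1 (Rp 5)))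
      (replicate 5 2 @ replicate 2 3) {Upair 11 5}"
    unfolding a_def[symmetric]
    by (rule valid_entry_pair[OF ex3]) (auto simp: o replicate_mset_numeral sorted_append numeral_2_eq_2
      dest!: c5 c23[unfolded numeral_2_eq_2])
qed

text \<open>
  The rotation of \<open>six_sum\<close> by \<open>1 / x\<close> contains \<open>1\<close> and \<open>a\<close>; the negatives of its other four terms
  form the component that differs from the base.
\<close>
lemma realise_pair_six_sum:
  assumes xy: "{#x, y#} \<subseteq># six_sum" and a: "a = y / x"
  shows "\<exists>h. has_type h (Comp 7 {#1, a#} (copies 1 (RC 5 (copies 1 (Rp 3)))))"
proof -
  have x: "x \<in># six_sum" "y \<in># six_sum" using pair_subset_members[OF xy] by blast+
  have x30: "x ^ 30 = 1" "y ^ 30 = 1" using six_sum_order x by blast+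
  then have x0: "x \<noteq> 0" by auto
  have rx: "root_of_unity (1 / x)" using x30 by (intro root_of_unity_inverse root_of_unityI[of 30]) auto
  define v where "v = rot (1 / x) six_sum"
  have sub: "{#1, a#} \<subseteq># v" using rot_mono[OF xy, of "1 / x"] x0 by (simp add: v_def a)
  define F where "F = rot (- 1) (v - {#1, a#})"
  note F = complement_in_minimal[OF sub F_def]
  have vt: "has_type v (RC 5 (copies 1 (Rp 3)))" unfolding v_def
    by (rule has_type_rot[OF has_type_six_sum rx])
  have mv: "minimal_vanishing ({#1, a#} + rot (- 1) F)" using F(1) has_type_minimal[OF vt] by simp
  have F30: "w ^ 30 = 1" if w: "w \<in># F" for w
  proof -
    obtain u where "u \<in># six_sum" "- w = 1 / x * u" using F(3)[OF w] by (auto simp: v_def)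
    then have "(- w) ^ 30 = 1" using x30 six_sum_order by (simp add: power_divide)
    then show ?thesis by simp
  qed
  have Ff: "k = {#}" if "k \<subseteq># F" "sum_mset k = 0" for k
    using zero_free_of_minimal[OF mv _ that] by simp
  have "a ^ 30 = 1" using x30 by (simp add: a power_divide)
  then show ?thesis
    using realise_pair[of a 1 1 "\<lambda>_. F" "\<lambda>_. {#RC 5 (copies 1 (Rp 3))#}"] mv F F30 Ff vt
    by (auto simp: v_def odds_six_sum)
qed

text \<open>
  The order of \<open>a = y / x\<close> tells from which terms of \<open>six_sum\<close> the base comes: the cube root \<open>\<nu>\<^sub>3\<close>
  from the two even ones, a fifth root from two of the odd ones, and \<open>- \<nu>\<^sub>3 \<nu>\<^sub>5\<^sup>y\<close> from an odd and
  an even one. In the last case either of them can be \<open>x\<close>, with the same parity.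
\<close>
lemma valid_entry_pair_six_sum:
  shows "valid_entry 16 (Comp 7 {#1, nu 3#} (copies 1 (RC 5 (copies 1 (Rp 3))))) (replicate 6 2 @ [4])
      {Upair 16 0}"
    and "y \<in> {1, 2} \<Longrightarrow>
      valid_entry 16 (Comp 7 {#1, nu 5 ^ y#} (copies 1 (RC 5 (copies 1 (Rp 3)))))
        (replicate 6 2 @ [4]) {Upair 14 2}"
    and "y \<in> {1, 2, 3, 4} \<Longrightarrow>
      valid_entry 16 (Comp 7 {#1, - (nu 3 * nu 5 ^ y)#} (copies 1 (RC 5 (copies 1 (Rp 3)))))
        (replicate 6 2 @ [4]) {Upair 9 7}"
proof -
  note six_sum_member = insert_subset_eq_iff six_sum_def
  have ex1: "\<exists>h. has_type h (Comp 7 {#1, nu 3#} (copies 1 (RC 5 (copies 1 (Rp 3)))))"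
    by (rule realise_pair_six_sum[of "- nu 3" "- (nu 3 ^ 2)"]) (auto simp: six_sum_def power2_eq_square)
  have c1: "b = 4" if b: "b \<in> compl_odds {#1, nu 3#} {#RC 5 (copies 1 (Rp 3))#}" for b
  proof -
    obtain x y where xy: "{#x, y#} \<subseteq># six_sum" "nu 3 = y / x"
      "odd_root x \<and> b = 4 - (4 - odds {#1, nu 3#}) \<or> \<not> odd_root x \<and> b = 4 - (2 - odds {#1, nu 3#})"
      using compl_odds_pair_six_sum[OF b] by (auto simp: signed_odd_root_def)
    have in6: "x \<in># six_sum" "y \<in># six_sum"
      using pair_subset_members[OF xy(1)] by blast+
    have "\<not> odd_root x"
    proof
      assume "odd_root x"
      then have "x ^ 5 = 1" using in6(1) not_odd_root_minus[of x] by (elim six_sum_cases) auto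
      then have "x \<noteq> 0" by auto
      then have "y = nu 3 * x" using xy(2) by (simp add: field_simps)
      then have "odd_root y" using \<open>odd_root x\<close> odd_root_mult by simp
      then have "y ^ 5 = 1" using in6(2) not_odd_root_minus[of y] by (elim six_sum_cases) auto
      then have "nu 3 ^ 5 = 1" using \<open>x ^ 5 = 1\<close> xy(2) by (simp add: power_divide)
      then show False using nu_3_fifth by blast
    qed
    then show ?thesis using xy(3) by simp
  qed
  show "valid_entry 16 (Comp 7 {#1, nu 3#} (copies 1 (RC 5 (copies 1 (Rp 3))))) (replicate 6 2 @ [4])
      {Upair 16 0}"
    by (rule valid_entry_pair[OF ex1]) (auto simp: replicate_mset_numeral sorted_append numeral_2_eq_2
      dest!: c1[simplified])
  show "valid_entry 16 (Comp 7 {#1, nu 5 ^ y#} (copies 1 (RC 5 (copies 1 (Rp 3))))) (replicate 6 2 @ [4])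
      {Upair 14 2}"
    if y: "y \<in> {1, 2}"
  proof -
    have ex: "\<exists>h. has_type h (Comp 7 {#1, nu 5 ^ y#} (copies 1 (RC 5 (copies 1 (Rp 3)))))"
    proof (rule realise_pair_six_sum)
      have "y + 1 = 2 \<or> y + 1 = 3" using y by auto
      then show "{#nu 5, nu 5 ^ (y + 1)#} \<subseteq># six_sum"
        by (elim disjE; simp only:) (simp_all add: six_sum_def add_mset_commute)
    qed simp
    have c: "b = 2" if b: "b \<in> compl_odds {#1, nu 5 ^ y#} {#RC 5 (copies 1 (Rp 3))#}" for b
    proof -
      obtain x x' where xy: "{#x, x'#} \<subseteq># six_sum" "nu 5 ^ y = x' / x"
        "odd_root x \<and> b = 4 - (4 - odds {#1, nu 5 ^ y#}) \<or> \<not> odd_root x \<and>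
            b = 4 - (2 - odds {#1, nu 5 ^ y#})"
        using compl_odds_pair_six_sum[OF b] by (auto simp: signed_odd_root_def)
      have in6: "x \<in># six_sum" "x' \<in># six_sum"
        using pair_subset_members[OF xy(1)] by blast+
      have "odd_root x"
      proof (rule ccontr)
        assume "\<not> odd_root x"
        then have *: "(- x) ^ 3 = 1" "odd_root (- x)" using in6(1) by (auto elim: six_sum_cases)
        then have "x \<noteq> 0" by auto
        then have "- x' = nu 5 ^ y * (- x)" using xy(2) by (simp add: field_simps)
        then have "odd_root (- x')" using odd_root_mult[OF _ *(2)] by (metis odd_root_nu_powers(4))
        then have "(- x') ^ 3 = 1" using in6(2) not_odd_root_minus[of x'] by (elim six_sum_cases) auto
        moreover have "nu 5 ^ y = (- x') / (- x)" using xy(2) by simp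
        ultimately have "(nu 5 ^ y) ^ 3 = 1" using *(1) by (simp only: power_divide) simp
        then have "5 dvd y" by (simp add: nu_5_power_cube)
        then show False using y by auto
      qed
      then show ?thesis using xy(3) by simp
    qed
    show ?thesis
      by (rule valid_entry_pair[OF ex]) (auto simp: replicate_mset_numeral sorted_append numeral_2_eq_2
        dest!: c[simplified])
  qed
  show "valid_entry 16 (Comp 7 {#1, - (nu 3 * nu 5 ^ y)#} (copies 1 (RC 5 (copies 1 (Rp 3)))))
        (replicate 6 2 @ [4]) {Upair 9 7}" if y: "y \<in> {1, 2, 3, 4}"
  proof -
    have "- (nu 3 * nu 5 ^ y) * nu 5 ^ (5 - y) = - nu 3"
    proof -
      have "nu 5 ^ y * nu 5 ^ (5 - y) = 1" using y nu_5_fifth by (simp flip: power_add) auto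
      then show ?thesis by (simp add: mult.assoc)
    qed
    then have ratio: "- (nu 3 * nu 5 ^ y) = - nu 3 / nu 5 ^ (5 - y)" by (simp add: field_simps)
    have ex: "\<exists>h. has_type h (Comp 7 {#1, - (nu 3 * nu 5 ^ y)#} (copies 1 (RC 5 (copies 1 (Rp 3)))))"
      by (rule realise_pair_six_sum[OF _ ratio]) (use y in \<open>auto simp: six_sum_def add_mset_commute\<close>)
    have odd: "odd_root (nu 3 * nu 5 ^ y)" by (intro odd_root_mult) auto
    have s: "signed_odd_root (- (nu 3 * nu 5 ^ y))" using odd by (simp add: signed_odd_root_def)
    have o: "odds {#1, - (nu 3 * nu 5 ^ y)#} = 1" using not_odd_root_minus[OF odd] by simp
    have c: "b = 1 \<or> b = 3" if b: "b \<in> compl_odds {#1, - (nu 3 * nu 5 ^ y)#} {#RC 5 (copies 1 (Rp 3))#}"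
      for b
      using compl_odds_pair_six_sum[OF b s] unfolding o by fastforce
    show ?thesis
      by (rule valid_entry_pair[OF ex])
        (auto simp: not_odd_root_minus[OF odd] replicate_mset_numeral sorted_append numeral_2_eq_2
          dest!: c[simplified])
  qed
qed

section \<open>Top prime at most five\<close>

lemma squarefree_dvd_prod:
  assumes "finite S" "\<And>q. q \<in> S \<Longrightarrow> prime q"
    and "squarefree (M::nat)" "M > 0" "\<And>q. prime q \<Longrightarrow> q dvd M \<Longrightarrow> q \<in> S"
  shows "M dvd \<Prod>S"
  using assms
proof (induction S arbitrary: M rule: finite_induct)
  case empty
  then have "M = 1" using prime_factor_nat by blast
  then show ?case by simp
next
  case (insert q S)
  show ?case
  proof (cases "q dvd M")
    case True
    then obtain m where m: "M = q * m" by (elim dvdE)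
    have "prime q" using insert.prems(1) by blast
    have "\<not> q dvd m"
    proof
      assume "q dvd m"
      then have "q\<^sup>2 dvd M" by (simp add: m power2_eq_square)
      then show False using insert.prems(2) \<open>prime q\<close> by (metis not_prime_unit squarefree_def)
    qed
    have "m dvd \<Prod>S"
    proof (rule insert.IH)
      show "squarefree m" using insert.prems(2) m by (metis dvd_triv_right squarefree_mono)
      show "m > 0" using insert.prems(3) m by simp
      show "r \<in> S" if "prime r" "r dvd m" for r
        using insert.prems(4)[OF that(1)] that(2) \<open>\<not> q dvd m\<close> m by auto
    qed (use insert.prems(1) in blast)
    then show ?thesis using insert.hyps by (simp add: m)
  next
    case False
    then have "M dvd \<Prod>S" using insert.prems by (intro insert.IH) blast+
    then show ?thesis using insert.hyps by simp
  qed
qed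

lemma primes_below:
  assumes "prime (q::nat)"
  shows "q < 2 \<Longrightarrow> q \<in> {}" and "q < 3 \<Longrightarrow> q \<in> {2}" and "q < 5 \<Longrightarrow> q \<in> {2, 3}"
    and "q < 7 \<Longrightarrow> q \<in> {2, 3, 5}" and "q < 17 \<Longrightarrow> q \<in> {2, 3, 5, 7, 11, 13}"
proof -
  have q: "q \<ge> 2" using assms by (rule prime_ge_2_nat)
  have c: "\<not> prime (4::nat)" "\<not> prime (6::nat)" "\<not> prime (8::nat)" "\<not> prime (9::nat)" "\<not> prime (10::nat)"
    "\<not> prime (12::nat)" "\<not> prime (14::nat)" "\<not> prime (15::nat)" "\<not> prime (16::nat)"
    by simp_all
  have *: "q \<in> {2, 3, 5, 7, 11, 13}" if "q < 17"
  proof -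
    have "q \<in> set [2..<17]" using that q by (simp only: set_upt atLeastLessThan_iff)
    then show ?thesis using c assms by (auto simp: upt_rec simp del: set_upt)
  qed
  then show "q < 17 \<Longrightarrow> q \<in> {2, 3, 5, 7, 11, 13}" .
  show "q < 2 \<Longrightarrow> q \<in> {}" using q by simp
  show "q < 3 \<Longrightarrow> q \<in> {2}" "q < 5 \<Longrightarrow> q \<in> {2, 3}" "q < 7 \<Longrightarrow> q \<in> {2, 3, 5}" using * by auto
qed

lemma power_dvd_1: "w ^ m = 1 \<Longrightarrow> m dvd n \<Longrightarrow> w ^ n = 1" for w :: complex
  by (auto elim!: dvdE simp: power_mult)

lemma component_power:
  assumes h: "minimal_vanishing h" and d: "top_decomp h p f" and j: "j < p" and w: "w \<in># f j"
  shows "p = 2 \<Longrightarrow> w = 1" and "p = 3 \<Longrightarrow> w ^ 2 = 1" and "p = 5 \<Longrightarrow> w ^ 6 = 1" and "p = 7 \<Longrightarrow> w ^ 30 = 1"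
proof -
  note t = top_decomp_props[OF h d refl]
  have *: "w ^ \<Prod>S = 1" if "finite S" "\<And>q. q \<in> S \<Longrightarrow> prime q" "\<And>q. prime q \<Longrightarrow> q < p \<Longrightarrow> q \<in> S" for S :: "nat set"
    by (rule power_dvd_1[OF t(9)[OF j w] squarefree_dvd_prod[OF that(1,2) t(6,4)]])
      (use t(7) that(3) in auto)
  show "w = 1" if "p = 2"
  proof -
    have "w ^ \<Prod>{} = 1" by (rule *) (use primes_below(1) that in auto)
    then show ?thesis by simp
  qed
  show "w ^ 2 = 1" if "p = 3"
  proof -
    have "w ^ \<Prod>{2} = 1" by (rule *) (use primes_below(2) that in auto)
    then show ?thesis by simp
  qed
  show "w ^ 6 = 1" if "p = 5"
  proof -
    have "w ^ \<Prod>{2, 3} = 1" by (rule *) (use primes_below(3) that in auto)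
    then show ?thesis by simp
  qed
  show "w ^ 30 = 1" if "p = 7"
  proof -
    have "w ^ \<Prod>{2, 3, 5} = 1" by (rule *) (use primes_below(4) that in auto)
    then show ?thesis by simp
  qed
qed

text \<open>A term common to all components is a choice of subsums with equal values.\<close>
lemma common_term:
  assumes h: "minimal_vanishing h" and d: "top_decomp h p f" and u: "\<And>j. j < p \<Longrightarrow> u \<in># f j"
  shows "j < p \<Longrightarrow> f j = {#u#}"
proof -
  have "p > 0" using top_decomp_props(2)[OF h d refl] prime_gt_0_nat by blast
  have "{#u#} \<subseteq># f j" if "j < p" for j using u[OF that] by simp
  then have "(\<forall>j<p. {#u#} = {#}) \<or> (\<forall>j<p. {#u#} = f j)"
    by (intro equal_subsums_trivial[OF h d, of "\<lambda>_. {#u#}" u]) simp_all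
  then show "j < p \<Longrightarrow> f j = {#u#}" using \<open>p > 0\<close> by auto
qed

lemma common_term_type:
  assumes h: "minimal_vanishing h" and d: "top_decomp h p f" and u: "\<And>j. j < p \<Longrightarrow> u \<in># f j"
  shows "has_type h (Rp p)"
proof (rule has_type_has_sum_type.Rp[OF h d])
  have "p > 0" using top_decomp_props(2)[OF h d refl] prime_gt_0_nat by blast
  then show "\<forall>j<p. f j = f 0" using common_term[OF h d u] by simp
qed

lemma pair_subsetI: "x \<in># A \<Longrightarrow> y \<in># A \<Longrightarrow> x \<noteq> y \<Longrightarrow> {#x, y#} \<subseteq># A"
  by (auto simp: insert_subset_eq_iff in_diff_count)

lemma component_nonempty:
  assumes h: "minimal_vanishing h" and d: "top_decomp h p f" and j: "j < p"
  shows "f j \<noteq> {#}"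
  using top_decomp_props(8)[OF h d refl j] by (simp add: sorou_def)

lemma one_in_base: "top_decomp h p f \<Longrightarrow> 1 \<in># f 0"
  by (simp add: top_decomp_def)

lemma classify_2:
  assumes h: "minimal_vanishing h" and p: "top_prime h = 2"
  shows "has_type h (Rp 2)"
proof -
  obtain f where d: "top_decomp h 2 f" using top_decomp_exists[OF h] p by auto
  have "1 \<in># f j" if j: "j < 2" for j
  proof -
    obtain w where "w \<in># f j" using component_nonempty[OF h d j] by auto
    then show ?thesis using component_power(1)[OF h d j] by auto
  qed
  then show ?thesis by (rule common_term_type[OF h d])
qed

lemma sum_mset_all_eq: "(\<And>w. w \<in># g \<Longrightarrow> w = c) \<Longrightarrow> sum_mset g = of_nat (size g) * c" for c :: complex
  by (induction g) (simp_all add: algebra_simps)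

text \<open>
  The terms of the components are \<open>1\<close> and \<open>-1\<close>. No component contains both, as it would contain a
  vanishing part; so each has terms of one sign, which is that of the base because the values
  agree.
\<close>
lemma classify_3:
  assumes h: "minimal_vanishing h" and p: "top_prime h = 3"
  shows "has_type h (Rp 3)"
proof -
  obtain f where d: "top_decomp h 3 f" using top_decomp_exists[OF h] p by auto
  have pm: "w = 1 \<or> w = - 1" if "j < 3" "w \<in># f j" for j w
    using component_power(2)[OF h d that] by (simp add: power2_eq_1_iff)
  have "- 1 \<notin># f 0"
  proof
    assume "- 1 \<in># f 0"
    then have "{#1, - 1#} \<subseteq># f 0" by (intro pair_subsetI one_in_base[OF d]) simp_all
    then have "{#1, - 1#} = ({#} :: complex multiset)" by (intro component_zero_free[OF h d, of 0]) auto
    then show False by simp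
  qed
  then have "w = 1" if "w \<in># f 0" for w using pm[of 0 w] that by auto
  then have s0: "sum_mset (f 0) = of_nat (size (f 0))" using sum_mset_all_eq[of "f 0" 1] by simp
  have "1 \<in># f j" if j: "j < 3" for j
  proof (rule ccontr)
    assume "1 \<notin># f j"
    then have "w = - 1" if "w \<in># f j" for w using pm[OF j that] that by auto
    then have "sum_mset (f j) = - of_nat (size (f j))" using sum_mset_all_eq[of "f j" "- 1"] by simp
    then have "of_nat (size (f 0) + size (f j)) = (0::complex)"
      using s0 top_decomp_props(10)[OF h d refl j] by simp
    then have "size (f 0) + size (f j) = 0" by (simp only: of_nat_eq_0_iff)
    then show False using component_nonempty[OF h d j] by simp
  qed
  then show ?thesis by (rule common_term_type[OF h d])
qed

lemma nu_3_not_real: "nu 3 \<notin> \<real>"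
proof
  assume "nu 3 \<in> \<real>"
  then obtain t where t: "nu 3 = of_real t" by (elim Reals_cases)
  then have "of_real (t ^ 3) = (1::complex)" using nu_3_cube by simp
  then have "t ^ 3 = 1" by (simp only: of_real_eq_1_iff)
  then have "(t - 1) * ((t + 1 / 2)\<^sup>2 + 3 / 4) = 0"
    by (simp add: power2_eq_square power3_eq_cube algebra_simps)
  moreover have "(t + 1 / 2)\<^sup>2 + 3 / 4 > 0" by (intro add_nonneg_pos) auto
  ultimately have "t = 1" by auto
  then have "nu 3 ^ 1 = 1" using t by simp
  then show False by (subst (asm) nu_power_eq_1_iff) auto
qed

lemma nu_3_independent:
  assumes "of_int a + of_int b * nu 3 + of_int c * nu 3 ^ 2 = 0"
  shows "a = c" "b = c"
proof -
  have "nu 3 ^ 2 = (1 + nu 3 + nu 3 ^ 2) - 1 - nu 3" by simp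
  then have "nu 3 ^ 2 = - 1 - nu 3" unfolding nu_3_relation by simp
  then have "of_int a + of_int b * nu 3 + of_int c * (- 1 - nu 3) = 0" using assms by (simp only:)
  then have *: "of_int (a - c) + of_int (b - c) * nu 3 = 0" by (simp add: algebra_simps)
  show "b = c"
  proof (rule ccontr)
    assume "b \<noteq> c"
    then have "of_int (b - c) \<noteq> (0::complex)" by simp
    moreover have "of_int (b - c) * nu 3 = - of_int (a - c)" using * by (simp only: add_eq_0_iff)
    ultimately have "nu 3 = - of_int (a - c) / of_int (b - c)" by (metis nonzero_mult_div_cancel_left)
    also have "\<dots> \<in> \<real>" by (intro Reals_minus Reals_divide Reals_of_int)
    finally show False using nu_3_not_real by blast
  qed
  then show "a = c" using * by simp
qed

lemma sixth_roots:
  assumes "w ^ 6 = 1"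
  shows "w \<in> {1, nu 3, nu 3 ^ 2, - 1, - nu 3, - (nu 3 ^ 2)}"
proof -
  have "(w ^ 3)\<^sup>2 = 1" using assms by (simp only: power_mult[symmetric]) simp
  then have "w ^ 3 = 1 \<or> w ^ 3 = - 1" by (simp only: power2_eq_1_iff)
  then have "w ^ 3 = 1 \<or> (- w) ^ 3 = 1" by auto
  then have "w \<in># mu 3 \<or> - w \<in># mu 3" by simp
  then show ?thesis unfolding mu_3 by (auto simp: minus_equation_iff[of w])
qed

lemma sixth_roots_distinct:
  "nu 3 \<noteq> 1" "nu 3 ^ 2 \<noteq> 1" "nu 3 ^ 2 \<noteq> nu 3"
  "- nu 3 \<noteq> 1" "- (nu 3 ^ 2) \<noteq> 1" "nu 3 \<noteq> - 1" "nu 3 ^ 2 \<noteq> - 1"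
  "- nu 3 \<noteq> nu 3 ^ 2" "- (nu 3 ^ 2) \<noteq> nu 3"
proof -
  show 1: "nu 3 \<noteq> 1" "nu 3 ^ 2 \<noteq> 1"
    using nu_power_eq_1_iff[of 3 1] nu_power_eq_1_iff[of 3 2] by simp_all
  then show "nu 3 ^ 2 \<noteq> nu 3" by (auto simp: power2_eq_square)
  have "\<not> odd_root (- nu 3)" "\<not> odd_root (- (nu 3 ^ 2))" "\<not> odd_root (- 1)"
    "odd_root (nu 3)" "odd_root (nu 3 ^ 2)" "odd_root 1"
    using not_odd_root_minus[of 1] by (auto simp del: not_odd_root_minus_nu simp: not_odd_root_minus)
  then show "- nu 3 \<noteq> 1" "- (nu 3 ^ 2) \<noteq> 1" "nu 3 \<noteq> - 1" "nu 3 ^ 2 \<noteq> - 1"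
    "- nu 3 \<noteq> nu 3 ^ 2" "- (nu 3 ^ 2) \<noteq> nu 3"
    by metis+
qed

definition signed_count :: "complex multiset \<Rightarrow> complex \<Rightarrow> int" where
  "signed_count f u = int (count f u) - int (count f (- u))"

text \<open>
  Since \<open>-1\<close> is a sixth root of unity, only the excess of \<open>u\<close> over \<open>- u\<close> matters for the value.
\<close>
lemma sum_mset_sixth_roots:
  assumes "\<And>w. w \<in># f \<Longrightarrow> w ^ 6 = 1"
  shows "sum_mset f = of_int (signed_count f 1) + of_int (signed_count f (nu 3)) * nu 3 +
    of_int (signed_count f (nu 3 ^ 2)) * nu 3 ^ 2"
  using assms
proof (induction f)
  case empty
  then show ?case by (simp add: signed_count_def)
next
  case (add w f)
  have "w \<in> {1, nu 3, nu 3 ^ 2, - 1, - nu 3, - (nu 3 ^ 2)}" using add.prems by (intro sixth_roots) simp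
  moreover note d = sixth_roots_distinct sixth_roots_distinct[symmetric]
  have n: "(- 1::complex) \<noteq> 1" "(1::complex) \<noteq> - 1" "- nu 3 \<noteq> nu 3" "nu 3 \<noteq> - nu 3"
    "- (nu 3 ^ 2) \<noteq> nu 3 ^ 2" "nu 3 ^ 2 \<noteq> - (nu 3 ^ 2)"
    by (simp_all add: neg_equal_zero equal_neg_zero)
  have "sum_mset f = of_int (signed_count f 1) + of_int (signed_count f (nu 3)) * nu 3 +
    of_int (signed_count f (nu 3 ^ 2)) * nu 3 ^ 2" using add by simp
  ultimately show ?case
    by (auto simp: signed_count_def d n algebra_simps)
qed

text \<open>
  As the components have equal values, their three signed counts differ by a common constant from
  one component to another. The counts in the base are not all equal, because its value is not
  \<open>0\<close>; so one of them is strictly largest or strictly smallest, and it is so in every component.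
  If the count of \<open>u\<close> is strictly largest, each component contains \<open>u\<close> or both of \<open>- u \<nu>\<^sub>3\<close> and
  \<open>- u \<nu>\<^sub>3\<^sup>2\<close>, whose sum is \<open>u\<close>; if it is strictly smallest, the same holds for \<open>- u\<close>.
\<close>
lemma common_sixth_root:
  assumes h: "minimal_vanishing h" and d: "top_decomp h 5 f"
  obtains u where "u \<in> {1, nu 3, nu 3 ^ 2, - 1, - nu 3, - (nu 3 ^ 2)}"
    and "\<And>j. j < 5 \<Longrightarrow> u \<in># f j \<or> - (u * nu 3) \<in># f j \<and> - (u * nu 3 ^ 2) \<in># f j"
proof -
  define x y z where "x j = signed_count (f j) 1" and "y j = signed_count (f j) (nu 3)"
    and "z j = signed_count (f j) (nu 3 ^ 2)" for j
  have sum: "sum_mset (f j) = of_int (x j) + of_int (y j) * nu 3 + of_int (z j) * nu 3 ^ 2" if "j < 5" for j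
    unfolding x_def y_def z_def using component_power(3)[OF h d that] by (intro sum_mset_sixth_roots) auto
  have eq: "x j - x 0 = z j - z 0" "y j - y 0 = z j - z 0" if "j < 5" for j
  proof -
    have "of_int (x j - x 0) + of_int (y j - y 0) * nu 3 + of_int (z j - z 0) * nu 3 ^ 2 = 0"
      using sum[OF that] sum[of 0] top_decomp_props(10)[OF h d refl that] by (simp add: algebra_simps)
    then show "x j - x 0 = z j - z 0" "y j - y 0 = z j - z 0" by (rule nu_3_independent)+
  qed
  have ne: "\<not> (x 0 = z 0 \<and> y 0 = z 0)"
  proof
    assume "x 0 = z 0 \<and> y 0 = z 0"
    then have "sum_mset (f 0) = of_int (z 0) * (1 + nu 3 + nu 3 ^ 2)" using sum[of 0]
      by (simp add: algebra_simps)
    then have "sum_mset (f 0) = 0" by (simp add: nu_3_relation)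
    then have "f 0 = {#}" by (intro component_zero_free[OF h d, of 0]) auto
    then show False using one_in_base[OF d] by simp
  qed
  have mem: "int (count (f j) v) > 0 \<longleftrightarrow> v \<in># f j" for j v by (simp add: count_greater_zero_iff)
  have cnt: "x j = int (count (f j) 1) - int (count (f j) (- 1))"
    "y j = int (count (f j) (nu 3)) - int (count (f j) (- nu 3))"
    "z j = int (count (f j) (nu 3 ^ 2)) - int (count (f j) (- (nu 3 ^ 2)))" for j
    by (simp_all add: x_def y_def z_def signed_count_def)
  have w: "nu 3 * nu 3 = nu 3 ^ 2" "nu 3 * nu 3 ^ 2 = 1" "nu 3 ^ 2 * nu 3 = 1" "nu 3 ^ 2 * nu 3 ^ 2 = nu 3"
  proof -
    have "nu 3 ^ 2 * nu 3 ^ 2 = nu 3 ^ 3 * nu 3"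
      by (simp only: power_add[symmetric] power_Suc2[symmetric]) simp
    then show "nu 3 ^ 2 * nu 3 ^ 2 = nu 3" by (simp only: nu_3_cube mult_1)
    show "nu 3 * nu 3 = nu 3 ^ 2" by (simp add: power2_eq_square)
    show "nu 3 * nu 3 ^ 2 = 1" "nu 3 ^ 2 * nu 3 = 1"
      using nu_3_cube by (simp_all add: power2_eq_square power3_eq_cube mult.assoc)
  qed
  consider "x 0 > y 0 \<and> x 0 > z 0" | "y 0 > x 0 \<and> y 0 > z 0" | "z 0 > x 0 \<and> z 0 > y 0"
    | "x 0 < y 0 \<and> x 0 < z 0" | "y 0 < x 0 \<and> y 0 < z 0" | "z 0 < x 0 \<and> z 0 < y 0"
    using ne by linarith
  then show ?thesis
  proof cases
    case 1
    show ?thesis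
    proof (rule that[of 1])
      fix j :: nat assume "j < 5"
      from eq[OF this] 1 cnt[of j] show "1 \<in># f j \<or> - (1 * nu 3) \<in># f j \<and> - (1 * nu 3 ^ 2) \<in># f j"
        unfolding mem[symmetric] mult_1 by linarith
    qed simp
  next
    case 2
    show ?thesis
    proof (rule that[of "nu 3"])
      fix j :: nat assume "j < 5"
      from eq[OF this] 2 cnt[of j] show "nu 3 \<in># f j \<or> - (nu 3 * nu 3) \<in># f j \<and> - (nu 3 * nu 3 ^ 2) \<in># f j"
        unfolding mem[symmetric] w by linarith
    qed simp
  next
    case 3
    show ?thesis
    proof (rule that[of "nu 3 ^ 2"])
      fix j :: nat assume "j < 5"
      from eq[OF this] 3 cnt[of j]
      show "nu 3 ^ 2 \<in># f j \<or> - (nu 3 ^ 2 * nu 3) \<in># f j \<and> - (nu 3 ^ 2 * nu 3 ^ 2) \<in># f j"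
        unfolding mem[symmetric] w by linarith
    qed simp
  next
    case 4
    show ?thesis
    proof (rule that[of "- 1"])
      fix j :: nat assume "j < 5"
      from eq[OF this] 4 cnt[of j] show "- 1 \<in># f j \<or> - (- 1 * nu 3) \<in># f j \<and> - (- 1 * nu 3 ^ 2) \<in># f j"
        unfolding mem[symmetric] mult_minus_left minus_minus mult_1 by linarith
    qed simp
  next
    case 5
    show ?thesis
    proof (rule that[of "- nu 3"])
      fix j :: nat assume "j < 5"
      from eq[OF this] 5 cnt[of j] show "- nu 3 \<in># f j \<or> - (- nu 3 * nu 3) \<in># f j \<and>
          - (- nu 3 * nu 3 ^ 2) \<in># f j"
        unfolding mem[symmetric] mult_minus_left minus_minus w by linarith
    qed simp
  next
    case 6
    show ?thesis
    proof (rule that[of "- (nu 3 ^ 2)"])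
      fix j :: nat assume "j < 5"
      from eq[OF this] 6 cnt[of j]
      show "- (nu 3 ^ 2) \<in># f j \<or> - (- (nu 3 ^ 2) * nu 3) \<in># f j \<and> - (- (nu 3 ^ 2) * nu 3 ^ 2) \<in># f j"
        unfolding mem[symmetric] mult_minus_left minus_minus w by linarith
    qed simp
  qed
qed

text \<open>
  The subsums \<open>u\<close> or \<open>- u \<nu>\<^sub>3 - u \<nu>\<^sub>3\<^sup>2\<close> of the components have the same value \<open>u\<close>, so they are
  the components. A base of least weight is a single term, and hence \<open>u = 1\<close>.
\<close>
lemma components_5:
  assumes h: "minimal_vanishing h" and d: "top_decomp h 5 f"
  shows "f 0 = {#1#}" and "j < 5 \<Longrightarrow> f j \<in> {{#1#}, {#- nu 3, - (nu 3 ^ 2)#}}"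
proof -
  obtain u where u: "u \<in> {1, nu 3, nu 3 ^ 2, - 1, - nu 3, - (nu 3 ^ 2)}"
    "\<And>j. j < 5 \<Longrightarrow> u \<in># f j \<or> - (u * nu 3) \<in># f j \<and> - (u * nu 3 ^ 2) \<in># f j"
    using common_sixth_root[OF h d] by metis
  have u0: "u \<noteq> 0" using u(1) by auto
  define K where "K j = (if u \<in># f j then {#u#} else {#- (u * nu 3), - (u * nu 3 ^ 2)#})" for j
  have sumK: "sum_mset (K j) = u" for j
  proof -
    have "- (u * nu 3) - u * nu 3 ^ 2 = u * 1"
    proof -
      have "u * 1 = u * (1 + nu 3 + nu 3 ^ 2) + (- (u * nu 3) - u * nu 3 ^ 2)"
        by (simp add: distrib_left)
      then show ?thesis unfolding nu_3_relation by simp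
    qed
    then show ?thesis by (simp add: K_def)
  qed
  have "K j \<subseteq># f j" if "j < 5" for j
  proof (cases "u \<in># f j")
    case True then show ?thesis by (simp add: K_def)
  next
    case False
    then have *: "- (u * nu 3) \<in># f j" "- (u * nu 3 ^ 2) \<in># f j" using u(2)[OF that] by auto
    moreover have "- (u * nu 3) \<noteq> - (u * nu 3 ^ 2)" using u0 sixth_roots_distinct(3) by auto
    ultimately show ?thesis using False by (auto simp: K_def insert_subset_eq_iff in_diff_count)
  qed
  then have "(\<forall>j<5. K j = {#}) \<or> (\<forall>j<5. K j = f j)" using sumK by (intro equal_subsums_trivial[OF h d])
  moreover have "K 0 \<noteq> {#}" by (simp add: K_def)
  ultimately have K: "f j = K j" if "j < 5" for j using that by (metis zero_less_numeral)
  have K1: "f j = {#u#}" if "j < 5" "u \<in># f j" for j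
    by (subst K[OF that(1)]) (simp add: K_def that(2))
  have K2: "f j = {#- (u * nu 3), - (u * nu 3 ^ 2)#}" if "j < 5" "u \<notin># f j" for j
    by (subst K[OF that(1)]) (simp add: K_def that(2))
  have u_in: "u \<in># f 0"
  proof (rule ccontr)
    assume u0: "u \<notin># f 0"
    have s0: "size (f 0) = 2" using K2[OF _ u0] by simp
    have "f j = f 0" if "j < 5" for j
    proof -
      have "size (f 0) \<le> size (f j)" using d that by (simp add: top_decomp_def)
      then have "u \<notin># f j" using K1[OF that] s0 by auto
      then show ?thesis using K2[OF that] K2[OF _ u0] by simp
    qed
    then have "f 0 = {#1#}" by (intro equal_components_singleton[OF h d]) blast
    then show False using s0 by simp
  qed
  have f0: "f 0 = {#u#}" using K1[OF _ u_in] by simp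
  then have u1: "u = 1" using one_in_base[OF d] by simp
  show "f 0 = {#1#}" using f0 u1 by simp
  show "f j \<in> {{#1#}, {#- nu 3, - (nu 3 ^ 2)#}}" if "j < 5"
    using K1[OF that] K2[OF that] u1 by (cases "u \<in># f j") auto
qed

lemma classify_5:
  assumes h: "minimal_vanishing h" and p: "top_prime h = 5"
  shows "has_type h (Rp 5) \<or> (\<exists>k\<in>{1..4}. has_type h (RC 5 (copies k (Rp 3))))"
proof -
  obtain f where d: "top_decomp h 5 f" using top_decomp_exists[OF h] p by auto
  note c = components_5[OF h d]
  define J where "J = {j\<in>{1..<5}. f j \<noteq> f 0}"
  have finJ: "finite J" by (simp add: J_def)
  show ?thesis
  proof (cases "J = {}")
    case True
    have "f j = f 0" if "j < 5" for j using True that by (cases "j = 0") (auto simp: J_def)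
    then show ?thesis using has_type_has_sum_type.Rp[OF h d] by blast
  next
    case False
    have "has_sum_type (f 0 + rot (- 1) (f j)) {#Rp 3#}" if "j \<in> J" for j
    proof -
      have "f j = {#- nu 3, - (nu 3 ^ 2)#}" using that c(1) c(2)[of j] by (auto simp: J_def)
      then show ?thesis using has_type_mu[of 3] by (simp add: c(1) mu_3 add_mset_commute)
    qed
    then have "has_type h (Comp 5 (f 0) (image_mset (\<lambda>_. {#Rp 3#}) (mset_set J)))"
      using False by (intro has_type_has_sum_type.Comp[OF h d J_def]) auto
    then have "has_type h (RC 5 (copies (card J) (Rp 3)))" using c(1) by (simp add: image_mset_const_eq)
    moreover have "card J \<le> card {1..<5::nat}" by (rule card_mono) (auto simp: J_def)
    moreover have "card J \<noteq> 0" using False finJ by simp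
    ultimately show ?thesis by (intro disjI2 bexI[of _ "card J"]) auto
  qed
qed

definition small_types :: "mv_type set" where
  "small_types = {Rp 2, Rp 3, Rp 5} \<union> (\<lambda>k. RC 5 (copies k (Rp 3))) ` {1..4}"

lemma classify_small:
  assumes h: "minimal_vanishing h" and p: "top_prime h < 7"
  shows "\<exists>T\<in>small_types. has_type h T"
proof -
  have "top_prime h \<in> {2, 3, 5}" using primes_below(4)[OF top_prime_props(1)[OF h] p] .
  then consider "top_prime h = 2" | "top_prime h = 3" | "top_prime h = 5" by blast
  then show ?thesis
    using classify_2[OF h] classify_3[OF h] classify_5[OF h] by cases (auto simp: small_types_def)
qed

section \<open>Height\<close>

lemma count_rot: "c \<noteq> 0 \<Longrightarrow> count (rot c g) x = count g (x / c)"
  by (induction g) (auto simp: field_simps)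

text \<open>
  Different components contribute different terms, since \<open>w\<^sup>M\<close> takes different values on them.
\<close>
lemma count_le_1_of_components:
  assumes h: "minimal_vanishing h" and d: "top_decomp h p f"
    and f: "\<And>j x. j < p \<Longrightarrow> count (f j) x \<le> 1"
  shows "count h x \<le> 1"
proof (cases "x \<in># h")
  case True
  note t = top_decomp_props[OF h d refl]
  obtain z where z: "root_of_unity z" "rot z h = (\<Sum>j<p. rot (nu p ^ j) (f j))"
    using d by (auto simp: top_decomp_def)
  have z0: "z \<noteq> 0" using z root_of_unity_ne_0 by blast
  have p0: "p > 0" using t(2) prime_gt_0_nat by blast
  define M where "M = relative_order h div p"
  have "z * x \<in># rot z h" unfolding set_mset_rot using True by (rule imageI)
  then obtain i u where iu: "i < p" "u \<in># f i" "z * x = nu p ^ i * u"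
    unfolding z(2) by (auto simp: set_mset_sum)
  have "u ^ M = 1" using t(9)[OF iu(1,2)] by (simp add: M_def)
  then have "(z * x) ^ M = nu p ^ (i * M)" unfolding iu(3) by (simp add: power_mult_distrib power_mult)
  then have "count (rot z h) (z * x) = count {#w \<in># rot z h. w ^ M = nu p ^ (i * M)#} (z * x)" by simp
  also have "{#w \<in># rot z h. w ^ M = nu p ^ (i * M)#} = rot (nu p ^ i) (f i)"
    unfolding z(2) M_def using component_eq_filter[OF t(2,5,9) iu(1)] by simp
  also have "count (rot (nu p ^ i) (f i)) (z * x) \<le> 1"
    using f[OF iu(1)] p0 by (simp add: count_rot)
  finally show ?thesis using z0 by (simp add: count_rot)
qed (simp add: not_in_iff)

lemma height_eq_1:
  assumes "h \<noteq> {#}" "\<And>x. count h x \<le> 1"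
  shows "height h = 1"
proof -
  have "count h x = 1" if "x \<in># h" for x
    using assms(2)[of x] that by (metis count_greater_eq_one_iff le_antisym)
  then have "count h ` set_mset h = {1}" using assms(1) by (auto simp: image_iff)
  then show ?thesis by (simp add: height_def)
qed

definition simple_type :: "mv_type \<Rightarrow> bool" where
  "simple_type T \<longleftrightarrow> (\<forall>h x. has_type h T \<longrightarrow> count h x \<le> 1)"

lemma simple_type_Rp: "simple_type (Rp p)"
  unfolding simple_type_def
proof (intro allI impI)
  fix h x assume "has_type h (Rp p)"
  then obtain z where "root_of_unity z" "h = rot z (mu p)" by (rule has_type_Rp_shape)
  then show "count h x \<le> 1" using root_of_unity_ne_0 count_mu by (simp add: count_rot)
qed

lemma simple_type_RC:
  assumes "\<forall>X\<in>#Ts. \<exists>T. X = {#T#} \<and> simple_type T"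
  shows "simple_type (RC p Ts)"
  unfolding simple_type_def
proof (intro allI impI)
  fix h x assume "has_type h (RC p Ts)"
  then show "count h x \<le> 1"
  proof cases
    case (Comp f J T)
    have h: "minimal_vanishing h" and d: "top_decomp h p f" by (rule Comp)+
    have f0: "f 0 = {#1#}" using Comp(1) by simp
    show ?thesis
    proof (rule count_le_1_of_components[OF h d])
      fix j x assume j: "j < p"
      show "count (f j) x \<le> 1"
      proof (cases "f j = f 0")
        case True
        then show ?thesis by (simp add: f0)
      next
        case False
        then have "j \<noteq> 0" by metis
        then have jJ: "j \<in> J" using False j Comp(5) by simp
        moreover have "finite J" using Comp(5) by simp
        ultimately obtain T' where T': "T j = {#T'#}" "simple_type T'" using assms Comp(2) by force
        have "has_sum_type (f 0 + rot (- 1) (f j)) (T j)" using Comp jJ by blast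
        then have "has_type ({#1#} + rot (- 1) (f j)) T'" by (simp add: T' f0)
        then have "count ({#1#} + rot (- 1) (f j)) (- x) \<le> 1" using T'(2) unfolding simple_type_def by blast
        then have "count (rot (- 1) (f j)) (- x) \<le> 1" by (metis add_leD2 count_union)
        then show ?thesis by (simp add: count_rot)
      qed
    qed
  qed
qed

lemma simple_type_small: "T \<in> small_types \<Longrightarrow> simple_type T"
  using simple_type_Rp by (auto simp: small_types_def intro!: simple_type_RC)

section \<open>Components over the base \<open>1\<close>\<close>

lemma subset_plus_split:
  assumes "g \<subseteq># A + B"
  obtains a b where "g = a + b" "a \<subseteq># A" "b \<subseteq># B"
proof
  show "g = (g \<inter># A) + (g - A)" by (simp add: multiset_eq_iff min_def)
  show "g \<inter># A \<subseteq># A" by simp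
  show "g - A \<subseteq># B" using assms by (simp add: subset_eq_diff_conv add.commute)
qed

lemma subset_rot_obtain:
  assumes "b \<subseteq># rot c B" "c \<noteq> 0"
  obtains k where "k \<subseteq># B" "b = rot c k"
proof
  show "rot (1 / c) b \<subseteq># B" using rot_mono[OF assms(1), of "1 / c"] assms(2) by simp
  show "b = rot c (rot (1 / c) b)" using assms(2) by simp
qed

lemma top_prime_less:
  assumes v: "minimal_vanishing v" and M: "\<And>w. w \<in># v \<Longrightarrow> w ^ (2 * M) = 1"
    and q: "\<And>q. prime q \<Longrightarrow> q dvd M \<Longrightarrow> q < p" and p: "2 < p"
  shows "top_prime v < p"
proof -
  have "relative_order v dvd 2 * M"
    unfolding relative_order_dvd_iff[OF vanishing_sorou[OF v]] using M by (simp add: power_divide)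
  then have "top_prime v dvd 2 * M" using top_prime_props(2)[OF v] dvd_trans by blast
  then have "top_prime v dvd 2 \<or> top_prime v dvd M" using top_prime_props(1)[OF v]
    by (simp add: prime_dvd_mult_iff)
  then show ?thesis using q[OF top_prime_props(1)[OF v]] p by (auto dest: dvd_imp_le)
qed

lemma difference_sorou:
  assumes h: "minimal_vanishing h" and d: "top_decomp h p f" and j: "j < p"
  shows "sorou (f 0 + rot (- 1) (f j))" and "sum_mset (f 0 + rot (- 1) (f j)) = 0"
    and "w \<in># f 0 + rot (- 1) (f j) \<Longrightarrow> w ^ (2 * (relative_order h div p)) = 1"
proof -
  note t = top_decomp_props[OF h d refl]
  have p0: "p > 0" using j by simp
  show "sorou (f 0 + rot (- 1) (f j))"
    using t(8)[OF p0] t(8)[OF j] by (auto simp: sorou_def intro: root_of_unity_minus)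
  show "sum_mset (f 0 + rot (- 1) (f j)) = 0" using t(10)[OF j] by simp
  show "w ^ (2 * (relative_order h div p)) = 1" if "w \<in># f 0 + rot (- 1) (f j)"
  proof -
    have "w \<in># f 0 \<or> - w \<in># f j" using that by auto
    then have "w ^ (relative_order h div p) = 1 \<or> (- w) ^ (relative_order h div p) = 1"
      using t(9)[OF p0] t(9)[OF j] by blast
    then have "(w ^ 2) ^ (relative_order h div p) = 1"
      by (metis mult.commute power2_minus power_mult power_one)
    then show ?thesis by (simp only: power_mult)
  qed
qed

text \<open>
  A vanishing part of \<open>1 - f j\<close> that omits \<open>1\<close> is a vanishing part of \<open>- f j\<close>, hence empty. One
  that contains \<open>1\<close> gives a subsum of \<open>f j\<close> of value \<open>1\<close>; together with the other components
  themselves, which also have the value \<open>1\<close>, it is a choice of subsums with equal values.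
\<close>
lemma unit_base_difference:
  assumes h: "minimal_vanishing h" and d: "top_decomp h p f" and f0: "f 0 = {#1#}"
    and j: "j < p" "j \<noteq> 0"
  shows "minimal_vanishing ({#1#} + rot (- 1) (f j))"
proof (rule minimal_vanishingI)
  note ds = difference_sorou[OF h d j(1), unfolded f0]
  show "sorou ({#1#} + rot (- 1) (f j))" "sum_mset ({#1#} + rot (- 1) (f j)) = 0" by (rule ds)+
  fix g assume g: "g \<subseteq># {#1#} + rot (- 1) (f j)" "sum_mset g = 0"
  obtain a b where ab: "g = a + b" "a \<subseteq># {#1#}" "b \<subseteq># rot (- 1) (f j)"
    using subset_plus_split[OF g(1)] .
  obtain k where k: "k \<subseteq># f j" "b = rot (- 1) k" using subset_rot_obtain[OF ab(3)] by auto
  from subseteq_single_mset[OF ab(2)] show "g = {#} \<or> g = {#1#} + rot (- 1) (f j)"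
  proof
    assume "a = {#}"
    then have "k = {#}" using g(2) ab k by (intro component_zero_free[OF h d j(1) k(1)]) auto
    then show ?thesis using ab k \<open>a = {#}\<close> by simp
  next
    assume a: "a = {#1#}"
    then have k1: "sum_mset k = 1" using g(2) ab k by simp
    define K where "K i = (if i = j then k else f i)" for i
    have "(\<forall>i<p. K i = {#}) \<or> (\<forall>i<p. K i = f i)"
    proof (rule equal_subsums_trivial[OF h d])
      show "K i \<subseteq># f i" if "i < p" for i using k(1) by (simp add: K_def)
      show "sum_mset (K i) = 1" if "i < p" for i
        using k1 top_decomp_props(10)[OF h d refl that] f0 by (simp add: K_def)
    qed
    moreover have "K 0 \<noteq> {#}" using j f0 by (simp add: K_def)
    ultimately have "K j = f j" using j by auto
    then show ?thesis using ab k a by (simp add: K_def)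
  qed
qed

text \<open>
  The recursion step of the classification. The differences \<open>1 - f j\<close> are minimal vanishing sums
  with a smaller top prime. As every other component has at least one term, their weight is also
  bounded, so a set \<open>L\<close> of types for smaller sums is enough.
\<close>
lemma RC_of_unit_base:
  assumes h: "minimal_vanishing h" and d: "top_decomp h p f" and f0: "f 0 = {#1#}" and p: "p > 2"
    and L: "\<And>v. minimal_vanishing v \<Longrightarrow> top_prime v < p \<Longrightarrow> size v + p \<le> size h + 2 \<Longrightarrow> \<exists>T\<in>L. has_type v T"
  shows "has_type h (Rp p) \<or>
    (\<exists>Ts. Ts \<noteq> {#} \<and> size Ts < p \<and> (\<forall>X\<in>#Ts. \<exists>T\<in>L - {Rp 2}. X = {#T#}) \<and> has_type h (RC p Ts))"
proof -
  define J where "J = {j\<in>{1..<p}. f j \<noteq> f 0}"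
  have finJ: "finite J" by (simp add: J_def)
  show ?thesis
  proof (cases "J = {}")
    case True
    have "f j = f 0" if "j < p" for j using True that by (cases "j = 0") (auto simp: J_def)
    then show ?thesis using has_type_has_sum_type.Rp[OF h d] by blast
  next
    case False
    have "\<exists>T\<in>L - {Rp 2}. has_sum_type (f 0 + rot (- 1) (f j)) {#T#}" if jJ: "j \<in> J" for j
    proof -
      have j: "j < p" "j \<noteq> 0" and fj: "f j \<noteq> {#1#}" using jJ f0 by (auto simp: J_def)
      define v where "v = {#1#} + rot (- 1) (f j)"
      have v: "minimal_vanishing v" unfolding v_def by (rule unit_base_difference[OF h d f0 j])
      have "top_prime v < p"
        using difference_sorou(3)[OF h d j(1)] top_decomp_props(7)[OF h d refl] p
        by (intro top_prime_less[OF v]) (auto simp: v_def f0)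
      moreover have "size v + p \<le> size h + 2"
      proof -
        have "size h = size (f j) + (\<Sum>i\<in>{..<p} - {j}. size (f i))"
          unfolding size_components[OF d] using j by (subst sum.remove[of _ j]) auto
        moreover have "(\<Sum>i\<in>{..<p} - {j}. 1) \<le> (\<Sum>i\<in>{..<p} - {j}. size (f i))"
          using component_nonempty[OF h d]
            by (intro sum_mono) (auto simp: Suc_le_eq nonempty_has_size[symmetric])
        moreover have "(\<Sum>i\<in>{..<p} - {j}. 1) = p - 1" using j by simp
        moreover have "size v = 1 + size (f j)" by (simp add: v_def)
        ultimately show ?thesis by linarith
      qed
      ultimately obtain T where T: "T \<in> L" "has_type v T" using L[OF v] by blast
      have "T \<noteq> Rp 2"
      proof
        assume "T = Rp 2"
        then have "v = mu 2" using T(2) by (intro has_type_Rp_containing_1) (auto simp: v_def)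
        then have "rot (- 1) (f j) = {#- 1#}" by (simp add: v_def mu_2)
        then have "rot (- 1) (rot (- 1) (f j)) = {#1#}" by simp
        then show False using fj by simp
      qed
      then show ?thesis using T by (auto simp: f0 v_def)
    qed
    then obtain T where T: "\<And>j. j \<in> J \<Longrightarrow> T j \<in> L - {Rp 2} \<and> has_sum_type (f 0 + rot (- 1) (f j)) {#T j#}"
      by metis
    have "has_type h (Comp p (f 0) (image_mset (\<lambda>j. {#T j#}) (mset_set J)))"
      using False T by (intro has_type_has_sum_type.Comp[OF h d J_def]) auto
    then have "has_type h (RC p (image_mset (\<lambda>j. {#T j#}) (mset_set J)))" by (simp add: f0)
    moreover have "image_mset (\<lambda>j. {#T j#}) (mset_set J) \<noteq> {#}"
      using False finJ by (simp add: mset_set_empty_iff)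
    moreover have "card J \<le> card {1..<p}" by (rule card_mono) (auto simp: J_def)
    then have "size (image_mset (\<lambda>j. {#T j#}) (mset_set J)) < p" using p by simp
    moreover have "\<forall>X\<in>#image_mset (\<lambda>j. {#T j#}) (mset_set J). \<exists>T\<in>L - {Rp 2}. X = {#T#}"
      using T finJ by auto
    ultimately show ?thesis by blast
  qed
qed

lemma top_prime_le_size:
  assumes h: "minimal_vanishing h" and d: "top_decomp h p f"
  shows "p * size (f 0) \<le> size h"
proof -
  have "(\<Sum>j<p. size (f 0)) \<le> (\<Sum>j<p. size (f j))" using d by (intro sum_mono) (simp add: top_decomp_def)
  then show ?thesis using size_components[OF d] by simp
qed

lemma size_eq_top_prime:
  assumes h: "minimal_vanishing h" and s: "size h = top_prime h"
  shows "has_type h (Rp (top_prime h))"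
proof -
  define p where "p = top_prime h"
  obtain f where d: "top_decomp h p f" using top_decomp_exists[OF h] p_def by auto
  have ge: "1 \<le> size (f j)" if "j < p" for j
    using component_nonempty[OF h d that] by (simp add: Suc_le_eq nonempty_has_size[symmetric])
  have "(\<Sum>j<p. 1) = (\<Sum>j<p. size (f j))" using s size_components[OF d] by (simp add: p_def)
  then have one: "size (f j) = 1" if "j < p" for j
    using sum_mono_inv[of "\<lambda>_. 1" "{..<p}" "\<lambda>j. size (f j)" j] ge that by simp
  have p0: "p > 0" using top_decomp_props(2)[OF h d refl] prime_gt_0_nat by blast
  have "f j = f 0" if j: "j < p" for j
  proof -
    obtain a b where "f j = {#a#}" "f 0 = {#b#}" using one[OF j] one[OF p0] size_1_singleton_mset by metis
    then show ?thesis using top_decomp_props(10)[OF h d refl j] by simp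
  qed
  then show ?thesis using has_type_has_sum_type.Rp[OF h d] p_def by blast
qed

section \<open>Components over a base of two terms\<close>

text \<open>
  Complex conjugation turns \<open>1 + a = b + c\<close> into \<open>1 + 1 / a = 1 / b + 1 / c\<close>, so the two pairs
  have the same sum and the same product.
\<close>
lemma unit_pair_unique:
  fixes a b c :: complex
  assumes a: "norm a = 1" and b: "norm b = 1" "norm c = 1" and s: "1 + a = b + c" "1 + a \<noteq> 0"
  shows "{#1, a#} = {#b, c#}"
proof -
  have inv: "cnj w = 1 / w" if "norm w = 1" for w :: complex
  proof -
    have "w * cnj w = 1" using that complex_norm_square[of w] by simp
    then show ?thesis by (metis div_by_0 mult_zero_left nonzero_eq_divide_eq mult.commute zero_neq_one)
  qed
  have nz: "a \<noteq> 0" "b \<noteq> 0" "c \<noteq> 0" using a b by auto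
  have "(1 + a) / a = (b + c) / (b * c)"
  proof -
    have "cnj (1 + a) = cnj (b + c)" using s by simp
    then have "1 + 1 / a = 1 / b + 1 / c" by (simp add: inv a b)
    moreover have "(1 + a) / a = 1 + 1 / a" using nz by (simp add: add_divide_distrib)
    moreover have "(b + c) / (b * c) = 1 / b + 1 / c" using nz by (simp add: add_divide_distrib)
    ultimately show ?thesis by simp
  qed
  then have "(1 + a) / a = (1 + a) / (b * c)" by (simp only: s(1))
  then have "a = b * c" using s(2) by (simp only: divide_cancel_left) simp
  moreover have "(1 - b) * (1 - c) = 1 + b * c - (b + c)" by (simp add: algebra_simps)
  ultimately have "(1 - b) * (1 - c) = 0" using s(1) by simp
  then have "b = 1 \<or> c = 1" by auto
  then show ?thesis using s(1) by (elim disjE) (simp_all add: add_mset_commute)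
qed

text \<open>
  A proper nonempty part or its complement would be a single term, whose value is not \<open>0\<close>.
\<close>
lemma vanishing_le_3_minimal:
  assumes v: "sorou v" "sum_mset v = 0" "size v \<le> 3"
  shows "minimal_vanishing v"
proof (rule minimal_vanishingI[OF v(1,2)])
  fix g assume g: "g \<subseteq># v" "sum_mset g = 0"
  have two: "size k \<noteq> 1" if "k \<subseteq># v" "sum_mset k = 0" for k
  proof
    assume "size k = 1"
    then obtain w where k: "k = {#w#}" using size_1_singleton_mset by blast
    then have "w \<in># v" "w = 0" using that by auto
    then show False using v(1) root_of_unity_ne_0 by (auto simp: sorou_def)
  qed
  have eq: "v = g + (v - g)" using g(1) by simp
  have "sum_mset v = sum_mset g + sum_mset (v - g)" by (subst eq) simp
  then have "sum_mset (v - g) = 0" using g(2) v(2) by simp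
  moreover have "v - g \<subseteq># v" by simp
  ultimately have "size (v - g) \<noteq> 1" "size g \<noteq> 1" using two g by blast+
  moreover have "size v = size g + size (v - g)" by (subst eq) (simp only: size_union)
  ultimately have "size g = 0 \<or> size (v - g) = 0" using v(3) by linarith
  then show "g = {#} \<or> g = v" using eq by auto
qed

lemma small_types_size:
  assumes "T \<in> small_types"
  shows "type_size T = 2 \<Longrightarrow> T = Rp 2" and "type_size T = 3 \<Longrightarrow> T = Rp 3"
    and "type_size T = 5 \<Longrightarrow> T = Rp 5" and "type_size T = 6 \<Longrightarrow> T = RC 5 (copies 1 (Rp 3))"
  using assms type_size_RC5 by (auto simp: small_types_def simp del: type_size.simps(2) replicate_mset_Suc)

lemma fifth_roots:
  assumes "a ^ 5 = 1" obtains y where "y < 5" "a = nu 5 ^ y"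
  using root_of_unity_nu_power[of 5 a] assms by auto

text \<open>
  The terms of a sum of type \<open>R\<^sub>3\<close> differ by cube roots of unity, so all of them are odd if \<open>b\<close>
  is.
\<close>
lemma count_R3_complement:
  assumes "has_type ({#b#} + rot (- 1) k) (Rp 3)" and b: "odd_root b"
  shows "count k x \<le> 1" and "x \<in># k \<Longrightarrow> \<not> odd_root x"
proof -
  have b0: "b \<noteq> 0" using b odd_root_ne_0 by blast
  obtain z where z: "root_of_unity z" "{#b#} + rot (- 1) k = rot z (mu 3)"
    using has_type_Rp_shape[OF assms(1)] .
  have z0: "z \<noteq> 0" using z root_of_unity_ne_0 by blast
  have mem: "odd_root w" if w: "w \<in># {#b#} + rot (- 1) k" for w
  proof -
    obtain u where u: "u ^ 3 = 1" "w = z * u" using w unfolding z(2) by auto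
    have "b \<in># rot z (mu 3)" by (simp flip: z(2))
    then obtain u' where u': "u' ^ 3 = 1" "b = z * u'" by auto
    have "odd_root u" "odd_root u'" using u u' by (auto intro: odd_rootI[of 3])
    moreover have "w = b * (u * (1 / u'))" using u u' b0 by auto
    ultimately show ?thesis using b odd_root_mult odd_root_inverse by metis
  qed
  show "\<not> odd_root x" if "x \<in># k"
  proof -
    have "odd_root (- x)" using that by (intro mem) auto
    then show ?thesis using not_odd_root_minus[of "- x"] by simp
  qed
  have "count ({#b#} + rot (- 1) k) (- x) \<le> 1" unfolding z(2) using z0 count_mu[of 3 "- x / z"]
    by (simp add: count_rot)
  then have "count (rot (- 1) k) (- x) \<le> 1" by (metis add_leD2 count_union)
  then show "count k x \<le> 1" by (simp add: count_rot)
qed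

lemma norm_root_of_unity: "root_of_unity w \<Longrightarrow> norm w = 1"
proof -
  assume "root_of_unity w"
  then obtain n where "n > 0" "w ^ n = 1" by (auto simp: root_of_unity_def)
  then have "norm w ^ n = 1" using norm_power[of w n] by simp
  then show ?thesis using \<open>n > 0\<close> power_eq_1_iff[of "norm w" n] by simp
qed

lemma pair_component_eq:
  assumes h: "minimal_vanishing h" and d: "top_decomp h p f" and f0: "f 0 = {#1, a#}"
    and j: "j < p" "size (f j) = 2"
  shows "f j = f 0"
proof -
  note t = top_decomp_props[OF h d refl]
  have p0: "0 < p" using j by simp
  have ru: "root_of_unity w" if "i < p" "w \<in># f i" for i w
    using t(8)[OF that(1)] that(2) by (simp add: sorou_def)
  obtain b g where bg: "f j = add_mset b g" using size_eq_Suc_imp_eq_union[of "f j" 1] j(2) by auto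
  then have "size g = 1" using j(2) by simp
  then obtain c where "g = {#c#}" using size_1_singleton_mset by blast
  then have bc: "f j = {#b, c#}" using bg by simp
  have "norm a = 1" "norm b = 1" "norm c = 1"
    using norm_root_of_unity ru[OF p0, of a] ru[OF j(1)] bc f0 by auto
  moreover have "1 + a = b + c" using t(10)[OF j(1)] bc f0 by simp
  moreover have "1 + a \<noteq> 0"
  proof
    assume "1 + a = 0"
    then have "f 0 = {#}" using f0 by (intro component_zero_free[OF h d p0]) auto
    then show False using f0 by simp
  qed
  ultimately show ?thesis using unit_pair_unique f0 bc by metis
qed

text \<open>
  A vanishing part of \<open>1 + a - f j\<close> consists of a part of the base and a part of \<open>f j\<close> of the same
  value \<open>0\<close>, \<open>1\<close>, \<open>a\<close> or \<open>1 + a\<close>. Passing to the complement in \<open>f j\<close>, the values \<open>a\<close> and \<open>1 + a\<close> reduce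
  to the values \<open>1\<close> and \<open>0\<close>.
\<close>
lemma minimal_of_no_unit_subsum:
  assumes h: "minimal_vanishing h" and d: "top_decomp h p f" and f0: "f 0 = {#1, a#}"
    and j: "j < p" and na: "\<nexists>k. k \<subseteq># f j \<and> sum_mset k = 1"
  shows "minimal_vanishing ({#1, a#} + rot (- 1) (f j))"
proof (rule minimal_vanishingI)
  note ds = difference_sorou[OF h d j, unfolded f0]
  show "sorou ({#1, a#} + rot (- 1) (f j))" "sum_mset ({#1, a#} + rot (- 1) (f j)) = 0" by (rule ds)+
  have free: "k = {#}" if "k \<subseteq># f j" "sum_mset k = 0" for k
    using component_zero_free[OF h d j that] .
  fix g assume g: "g \<subseteq># {#1, a#} + rot (- 1) (f j)" "sum_mset g = 0"
  obtain b b' where b: "g = b + b'" "b \<subseteq># {#1, a#}" "b' \<subseteq># rot (- 1) (f j)"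
    using subset_plus_split[OF g(1)] .
  obtain k where k: "k \<subseteq># f j" "b' = rot (- 1) k" using subset_rot_obtain[OF b(3)] by auto
  have sk: "sum_mset k = sum_mset b" using g(2) b k by simp
  have "b \<subseteq># {#1#} + {#a#}" using b(2) by (simp add: add_mset_commute)
  then obtain b1 b2 where b12: "b = b1 + b2" "b1 \<subseteq># {#1#}" "b2 \<subseteq># {#a#}"
    by (rule subset_plus_split)
  have rest: "sum_mset (f j - k) = 1 + a - sum_mset k"
  proof -
    have "f j = k + (f j - k)" using k(1) by simp
    then have "sum_mset (f j) = sum_mset k + sum_mset (f j - k)" by (metis sum_mset.union)
    then show ?thesis using top_decomp_props(10)[OF h d refl j] f0 by simp
  qed
  consider "b = {#}" | "b = {#1#}" | "b = {#a#}" | "b = {#1, a#}"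
    using subseteq_single_mset[OF b12(2)] subseteq_single_mset[OF b12(3)] b12(1) by auto
  then show "g = {#} \<or> g = {#1, a#} + rot (- 1) (f j)"
  proof cases
    case 1
    then have "k = {#}" using sk k by (intro free) auto
    then show ?thesis using 1 b k by simp
  next
    case 2
    then have False using na sk k(1) by auto
    then show ?thesis ..
  next
    case 3
    then have "sum_mset (f j - k) = 1" using rest sk by simp
    then have False using na by (auto intro: diff_subset_eq_self)
    then show ?thesis ..
  next
    case 4
    then have "sum_mset (f j - k) = 0" using rest sk by simp
    then have "f j - k = {#}" by (intro free) auto
    then have "k = f j" using k(1) by (metis add.right_neutral subset_mset.add_diff_inverse)
    then show ?thesis using 4 b k by simp
  qed
qed

text \<open>
  Otherwise subsums of value \<open>1\<close> of all components, with \<open>1\<close> itself chosen in the base, would be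
  subsums with equal values that do not exhaust the base.
\<close>
lemma component_without_unit_subsum:
  assumes h: "minimal_vanishing h" and d: "top_decomp h p f" and f0: "f 0 = {#1, a#}"
  obtains j where "j < p" "\<nexists>k. k \<subseteq># f j \<and> sum_mset k = 1"
proof (rule ccontr)
  assume "\<not> thesis"
  then have "\<forall>j. \<exists>k. j < p \<longrightarrow> k \<subseteq># f j \<and> sum_mset k = 1" using that by blast
  then obtain k where k: "\<And>j. j < p \<Longrightarrow> k j \<subseteq># f j \<and> sum_mset (k j) = 1" by metis
  have p0: "0 < p" using top_decomp_props(2)[OF h d refl] prime_gt_0_nat by blast
  define K where "K = k(0 := {#1#})"
  have "(\<forall>j<p. K j = {#}) \<or> (\<forall>j<p. K j = f j)"
    using k f0 by (intro equal_subsums_trivial[OF h d, of K 1]) (auto simp: K_def)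
  then have "K 0 = {#} \<or> K 0 = f 0" using p0 by auto
  then show False using f0 by (auto simp: K_def)
qed

lemma difference_part_type:
  assumes h: "minimal_vanishing h" and d: "top_decomp h 7 f" and j: "j < 7"
    and g: "minimal_vanishing g" "g \<subseteq># f 0 + rot (- 1) (f j)"
  shows "\<exists>T\<in>small_types. has_type g T"
proof (rule classify_small[OF g(1)], rule top_prime_less[OF g(1)])
  show "w ^ (2 * (relative_order h div 7)) = 1" if "w \<in># g" for w
    using difference_sorou(3)[OF h d j] mset_subset_eqD[OF g(2) that] .
qed (use top_decomp_props(7)[OF h d refl] in auto)

text \<open>
  A subsum \<open>k\<close> of value \<open>1\<close> splits \<open>1 + a - f i\<close> into \<open>1 - k\<close> and \<open>a - k'\<close>, vanishing sums of weights \<open>2\<close>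
  and \<open>3\<close> in one order or the other. Parity keeps the terms that come from \<open>R\<^sub>3\<close> apart from \<open>1\<close> and \<open>a\<close>.
\<close>
lemma pair_component_split:
  assumes h: "minimal_vanishing h" and d: "top_decomp h 7 f" and f0: "f 0 = {#1, a#}"
    and i: "i < 7" "size (f i) = 3" and k: "k \<subseteq># f i" "sum_mset k = 1" and oa: "odd_root a"
  shows "has_sum_type ({#1, a#} + rot (- 1) (f i)) {#Rp 2, Rp 3#}" and "count (f i) x \<le> 1"
proof -
  define v where "v = {#1, a#} + rot (- 1) (f i)"
  have vso: "sorou v" using difference_sorou(1)[OF h d i(1)] by (simp add: v_def f0)
  define k' where "k' = f i - k"
  have fik: "f i = k + k'" using k(1) by (simp add: k'_def)
  have sk': "sum_mset k' = a" using top_decomp_props(10)[OF h d refl i(1)] k(2) f0 by (simp add: fik)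
  have "k \<noteq> {#}" "k' \<noteq> {#}" using k(2) sk' odd_root_ne_0[OF oa] by auto
  then have sizes: "size k \<ge> 1" "size k' \<ge> 1" "size k + size k' = 3"
    using i(2) by (auto simp: fik Suc_le_eq nonempty_has_size[symmetric])
  have piece: "has_type ({#b#} + rot (- 1) l) (Rp (1 + size l))"
    if b: "b \<in> {1, a}" and l: "l \<in> {k, k'}" "sum_mset l = b" for b l
  proof -
    have sub: "{#b#} + rot (- 1) l \<subseteq># v"
      unfolding v_def using b l(1) by (intro subset_mset.add_mono rot_mono) (auto simp: fik)
    have sl: "size l = 1 \<or> size l = 2" using l sizes by auto
    have "sorou ({#b#} + rot (- 1) l)" using sorou_subset[OF vso sub] by simp
    then have m: "minimal_vanishing ({#b#} + rot (- 1) l)"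
      using l(2) sl by (intro vanishing_le_3_minimal) auto
    obtain T where T: "T \<in> small_types" "has_type ({#b#} + rot (- 1) l) T"
      using difference_part_type[OF h d i(1) m] sub by (auto simp: v_def f0)
    have "type_size T = 1 + size l" using has_type_size(1)[OF T(2)] by simp
    then have "T = Rp (1 + size l)"
      using sl small_types_size(1,2)[OF T(1)] by (auto simp: numeral_2_eq_2 numeral_3_eq_3)
    then show ?thesis using T(2) by simp
  qed
  have vi: "v = ({#1#} + rot (- 1) k) + ({#a#} + rot (- 1) k')" by (simp add: v_def fik)
  have p1: "has_type ({#1#} + rot (- 1) k) (Rp (1 + size k))" using piece[of 1 k] k(2) by simp
  have p2: "has_type ({#a#} + rot (- 1) k') (Rp (1 + size k'))" using piece[of a k'] sk' by simp
  have "has_sum_type v {#Rp 2, Rp 3#} \<and> (\<forall>x. count (f i) x \<le> 1)"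
  proof (cases "size k = 1")
    case True
    then have s1: "1 + size k = 2" "1 + size k' = 3" using sizes by simp_all
    have "has_sum_type v {#Rp 2, Rp 3#}"
      unfolding vi
      by (rule has_type_has_sum_type.add[OF p1[unfolded s1] has_type_has_sum_type.single[OF p2[unfolded
        s1]]])
    moreover obtain w where "k = {#w#}" using True size_1_singleton_mset by blast
    then have "k = {#1#}" using k(2) by simp
    then have "count (f i) x \<le> 1" for x
      using count_R3_complement[OF p2[unfolded s1] oa, of x]
      by (cases "x = 1") (auto simp: fik count_eq_zero_iff)
    ultimately show ?thesis by blast
  next
    case False
    then have s1: "1 + size k = 3" "1 + size k' = 2" using sizes by simp_all
    have "has_sum_type (({#a#} + rot (- 1) k') + ({#1#} + rot (- 1) k)) {#Rp 2, Rp 3#}"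
      by (rule has_type_has_sum_type.add[OF p2[unfolded s1] has_type_has_sum_type.single[OF p1[unfolded
        s1]]])
    then have "has_sum_type v {#Rp 2, Rp 3#}" unfolding vi by (simp only: add.commute)
    moreover obtain w where "k' = {#w#}" using s1 size_1_singleton_mset[of k'] by auto
    then have "k' = {#a#}" using sk' by simp
    then have "count (f i) x \<le> 1" for x
      using count_R3_complement[OF p1[unfolded s1] odd_root_1, of x] oa
      by (cases "x = a") (auto simp: fik count_eq_zero_iff)
    ultimately show ?thesis by blast
  qed
  then show "has_sum_type ({#1, a#} + rot (- 1) (f i)) {#Rp 2, Rp 3#}" "count (f i) x \<le> 1"
    by (simp_all add: v_def)
qed

text \<open>
  A component \<open>f j\<close> without a subsum of value \<open>1\<close> has at least three terms, and with total weight at most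
  \<open>16\<close> it has at most four. So the minimal sum \<open>1 + a - f j\<close> is \<open>R\<^sub>5\<close> or \<open>(R\<^sub>5 : R\<^sub>3)\<close>, and the weight left
  over allows a second component different from the base only next to \<open>R\<^sub>5\<close>.
\<close>
lemma pair_base:
  assumes h: "minimal_vanishing h" and d: "top_decomp h 7 f" and s: "size h \<le> 16"
    and f0: "f 0 = {#1, a#}"
  shows "(\<forall>x. count h x \<le> 1) \<and>
    (size h = 15 \<and> a ^ 5 = 1 \<and> a \<noteq> 1 \<and> has_type h (Comp 7 {#1, a#} (copies 1 (Rp 5))) \<or>
     size h = 16 \<and> a ^ 5 = 1 \<and> a \<noteq> 1 \<and> has_type h (Comp 7 {#1, a#} (copies 2 (Rp 5))) \<or>
     size h = 16 \<and> a ^ 5 = 1 \<and> a \<noteq> 1 \<and>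
       has_type h (Comp 7 {#1, a#} ({#{#Rp 2, Rp 3#}#} + copies 1 (Rp 5))) \<or>
     size h = 16 \<and> (\<exists>x y. {#x, y#} \<subseteq># six_sum \<and> a = y / x) \<and>
       has_type h (Comp 7 {#1, a#} (copies 1 (RC 5 (copies 1 (Rp 3))))))"
proof -
  note t = top_decomp_props[OF h d refl]
  define v where "v j = {#1, a#} + rot (- 1) (f j)" for j
  have ge2: "2 \<le> size (f j)" if "j < 7" for j
    using d that f0 by (auto simp: top_decomp_def)
  have size2: "f j = f 0" if "j < 7" "size (f j) = 2" for j
    using pair_component_eq[OF h d f0 that] .
  have total: "size h = (\<Sum>j<7. size (f j))" using size_components[OF d] .
  obtain j where j: "j < 7" "\<nexists>k. k \<subseteq># f j \<and> sum_mset k = 1"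
    using component_without_unit_subsum[OF h d f0] .
  have "\<exists>k. k \<subseteq># f 0 \<and> sum_mset k = 1" unfolding f0 by (intro exI[of _ "{#1#}"]) auto
  then have fj: "f j \<noteq> f 0" "j \<noteq> 0" using j(2) by metis+
  then have "size (f j) \<noteq> 2" using size2[OF j(1)] by blast
  then have ge3: "3 \<le> size (f j)" using ge2[OF j(1)] by simp
  have split_j: "size h = size (f j) + (\<Sum>i\<in>{..<7} - {j}. size (f i))"
    unfolding total using j(1) by (subst sum.remove[of _ j]) auto
  have card_j: "(\<Sum>i\<in>{..<7} - {j}. 2) = (12::nat)" using j(1) by simp
  have le_j: "(\<Sum>i\<in>{..<7} - {j}. 2) \<le> (\<Sum>i\<in>{..<7} - {j}. size (f i))"
    using ge2 by (intro sum_mono) auto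
  have all2: "size (f i) = 2" if "(\<Sum>i\<in>{..<7} - {j}. size (f i)) = 12" "i < 7" "i \<noteq> j" for i
    using sum_mono_inv[of "\<lambda>_. 2" "{..<7} - {j}" "\<lambda>i. size (f i)" i] ge2 that card_j by auto
  have vj: "minimal_vanishing (v j)" using minimal_of_no_unit_subsum[OF h d f0 j] by (simp add: v_def)
  obtain T where T: "T \<in> small_types" "has_type (v j) T"
    using difference_part_type[OF h d j(1) vj] by (auto simp: v_def f0)
  have Ts: "type_size T = 2 + size (f j)" using has_type_size(1)[OF T(2)] by (simp add: v_def)
  have J1: "{i\<in>{1..<7}. f i \<noteq> f 0} = {j}" if "\<And>i. i < 7 \<Longrightarrow> i \<noteq> j \<Longrightarrow> size (f i) = 2"
    using that size2 fj j(1) by auto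
  have count_f0: "count (f 0) x \<le> 1" if "a \<noteq> 1" for x using that f0 by simp
  have count_vj: "count (v j) x \<le> 1" for x
    using simple_type_small[OF T(1)] T(2) by (simp add: simple_type_def)
  have a1: "a \<noteq> 1"
  proof
    assume "a = 1"
    then have "count (v j) 1 \<ge> 2" by (simp add: v_def)
    then show False using count_vj[of 1] by simp
  qed
  have count_fj: "count (f j) x \<le> 1" if "\<And>x. count (v j) x \<le> 1" for j x
  proof -
    have "count (rot (- 1) (f j)) (- x) \<le> 1" using that[of "- x"] unfolding v_def
      by (metis add_leD2 count_union)
    then show ?thesis by (simp add: count_rot)
  qed
  have "size (f j) = 3 \<or> size (f j) = 4" using ge3 split_j card_j le_j s by linarith
  then show ?thesis
  proof
    assume s4: "size (f j) = 4"
    have T6: "T = RC 5 (copies 1 (Rp 3))" using small_types_size(4)[OF T(1)] Ts s4 by simp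
    have "(\<Sum>i\<in>{..<7} - {j}. size (f i)) = 12" using split_j card_j le_j s s4 by linarith
    then have two: "size (f i) = 2" if "i < 7" "i \<noteq> j" for i using all2 that by blast
    have h16: "size h = 16" using split_j \<open>(\<Sum>i\<in>{..<7} - {j}. size (f i)) = 12\<close> s4 by simp
    have "has_sum_type (f 0 + rot (- 1) (f j)) {#T#}" using T(2) by (simp add: v_def f0)
    then have "has_type h (Comp 7 (f 0) (image_mset (\<lambda>_. {#T#}) (mset_set {j})))"
      using J1[OF two] by (intro has_type_has_sum_type.Comp[OF h d]) auto
    then have ht: "has_type h (Comp 7 {#1, a#} (copies 1 (RC 5 (copies 1 (Rp 3)))))"
      by (simp add: f0 T6)
    have "{#1, a#} \<subseteq># v j" by (simp add: v_def)
    then obtain x y where "{#x, y#} \<subseteq># six_sum" "a = y / x"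
      using pair_in_six_sum[OF T(2)[unfolded T6]] by metis
    moreover have "count h x \<le> 1" for x
    proof (rule count_le_1_of_components[OF h d])
      show "count (f i) x \<le> 1" if "i < 7" for i x
        using count_fj[OF count_vj] count_f0[OF a1] size2[OF that two[OF that]] by (cases "i = j") auto
    qed
    ultimately show ?thesis using ht h16 by blast
  next
    assume s3: "size (f j) = 3"
    have T5: "T = Rp 5" using small_types_size(3)[OF T(1)] Ts s3 by simp
    have "v j = mu 5" using T(2)[unfolded T5] by (rule has_type_Rp_containing_1) (simp add: v_def)
    moreover have "a \<in># v j" by (simp add: v_def)
    ultimately have a5: "a ^ 5 = 1" by simp
    have oa: "odd_root a" using a5 by (intro odd_rootI[of 5]) auto
    have tj: "has_sum_type (f 0 + rot (- 1) (f j)) {#Rp 5#}" using T(2) T5 by (simp add: v_def f0)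
    show ?thesis
    proof (cases "\<forall>i<7. i \<noteq> j \<longrightarrow> size (f i) = 2")
      case True
      then have two: "size (f i) = 2" if "i < 7" "i \<noteq> j" for i using that by blast
      have "(\<Sum>i\<in>{..<7} - {j}. size (f i)) = (\<Sum>i\<in>{..<7} - {j}. 2)" by (intro sum.cong) (auto simp: two)
      then have h15: "size h = 15" using split_j card_j s3 by simp
      have "has_type h (Comp 7 (f 0) (image_mset (\<lambda>_. {#Rp 5#}) (mset_set {j})))"
        using J1[OF two] tj by (intro has_type_has_sum_type.Comp[OF h d]) auto
      then have ht: "has_type h (Comp 7 {#1, a#} (copies 1 (Rp 5)))" by (simp add: f0)
      have "count h x \<le> 1" for x
      proof (rule count_le_1_of_components[OF h d])
        show "count (f i) x \<le> 1" if "i < 7" for i x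
          using count_fj[OF count_vj] count_f0[OF a1] size2[OF that two[OF that]] by (cases "i = j") auto
      qed
      then show ?thesis using ht h15 a5 a1 by blast
    next
      case False
      then obtain i where i: "i < 7" "i \<noteq> j" "size (f i) \<noteq> 2" by blast
      have i3: "3 \<le> size (f i)" using ge2[OF i(1)] i(3) by simp
      have split_i: "(\<Sum>l\<in>{..<7} - {j}. size (f l)) = size (f i) + (\<Sum>l\<in>{..<7} - {j} - {i}. size (f l))"
        using i by (subst sum.remove[of _ i]) auto
      have card_i: "(\<Sum>l\<in>{..<7} - {j} - {i}. 2) = (10::nat)" using i j by simp
      have le_i: "(\<Sum>l\<in>{..<7} - {j} - {i}. 2) \<le> (\<Sum>l\<in>{..<7} - {j} - {i}. size (f l))"
        using ge2 by (intro sum_mono) auto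
      have fi3: "size (f i) = 3" and rest10: "(\<Sum>l\<in>{..<7} - {j} - {i}. size (f l)) = 10"
        and h16: "size h = 16"
        using split_j split_i card_i le_i s s3 i3 by linarith+
      have two: "size (f l) = 2" if "l < 7" "l \<noteq> j" "l \<noteq> i" for l
        using sum_mono_inv[of "\<lambda>_. 2" "{..<7} - {j} - {i}" "\<lambda>l. size (f l)" l] ge2 that card_i rest10
          by auto
      have fi: "f i \<noteq> f 0" using fi3 f0 by auto
      then have i0: "i \<noteq> 0" by metis
      have J2: "{l\<in>{1..<7}. f l \<noteq> f 0} = {i, j}"
        using two size2 fj fi i0 i(1) j(1) by auto
      have type_ij: "has_type h (Comp 7 {#1, a#} {#X, {#Rp 5#}#})"
        if X: "has_sum_type (v i) X" for X
      proof -
        define Z where "Z l = (if l = i then X else {#Rp 5#})" for l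
        have "has_type h (Comp 7 (f 0) (image_mset Z (mset_set {i, j})))"
        proof (rule has_type_has_sum_type.Comp[OF h d])
          show "\<forall>l\<in>{i, j}. has_sum_type (f 0 + rot (- 1) (f l)) (Z l)"
            using X tj i(2) by (simp add: Z_def v_def f0)
        qed (use J2 in auto)
        then show ?thesis using i(2) by (simp add: Z_def f0)
      qed
      have count_h: "count h x \<le> 1" if "\<And>x. count (f i) x \<le> 1" for x
      proof (rule count_le_1_of_components[OF h d])
        show "count (f l) x \<le> 1" if l: "l < 7" for l x
        proof -
          consider "l = j" | "l = i" | "f l = f 0" using size2[OF l two[OF l]] by blast
          then show ?thesis
            using count_fj[OF count_vj] count_f0[OF a1] \<open>\<And>x. count (f i) x \<le> 1\<close> by cases auto
        qed
      qed
      show ?thesis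
      proof (cases "\<exists>k. k \<subseteq># f i \<and> sum_mset k = 1")
        case False
        have vi: "minimal_vanishing (v i)"
          using minimal_of_no_unit_subsum[OF h d f0 i(1) False] by (simp add: v_def)
        obtain T' where T': "T' \<in> small_types" "has_type (v i) T'"
          using difference_part_type[OF h d i(1) vi] by (auto simp: v_def f0)
        have "type_size T' = 5" using has_type_size(1)[OF T'(2)] fi3 by (simp add: v_def)
        then have "T' = Rp 5" using small_types_size(3)[OF T'(1)] by simp
        then have "has_type h (Comp 7 {#1, a#} {#{#Rp 5#}, {#Rp 5#}#})" using T'(2) by (intro type_ij) simp
        then have "has_type h (Comp 7 {#1, a#} (copies 2 (Rp 5)))" by (simp add: numeral_2_eq_2)
        moreover have "count (v i) x \<le> 1" for x
          using simple_type_small[OF T'(1)] T'(2) by (simp add: simple_type_def)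
        then have "count h x \<le> 1" for x using count_h[OF count_fj] by blast
        ultimately show ?thesis using h16 a5 a1 by blast
      next
        case True
        then obtain k where k: "k \<subseteq># f i" "sum_mset k = 1" by blast
        note split = pair_component_split[OF h d f0 i(1) fi3 k oa]
        have ht: "has_type h (Comp 7 {#1, a#} {#{#Rp 2, Rp 3#}, {#Rp 5#}#})"
          using split(1) by (intro type_ij) (simp add: v_def)
        have c: "count h x \<le> 1" for x using count_h[OF split(2)] .
        have "has_type h (Comp 7 {#1, a#} ({#{#Rp 2, Rp 3#}#} + copies 1 (Rp 5)))"
          using ht by (simp add: add_mset_commute)
        then show ?thesis using c h16 a5 a1 by blast
      qed
    qed
  qed
qed

section \<open>The entries of the table are correct\<close>

lemmas table_lookup = fun_upd_apply numeral_eq_iff num.simps if_True if_False simp_thms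

lemmas type_table_2 = type_table_def[THEN fun_cong, of 2, simplified table_lookup]
lemmas type_table_3 = type_table_def[THEN fun_cong, of 3, simplified table_lookup]
lemmas type_table_5 = type_table_def[THEN fun_cong, of 5, simplified table_lookup]
lemmas type_table_6 = type_table_def[THEN fun_cong, of 6, simplified table_lookup]
lemmas type_table_7 = type_table_def[THEN fun_cong, of 7, simplified table_lookup]
lemmas type_table_8 = type_table_def[THEN fun_cong, of 8, simplified table_lookup]
lemmas type_table_9 = type_table_def[THEN fun_cong, of 9, simplified table_lookup]
lemmas type_table_10 = type_table_def[THEN fun_cong, of 10, simplified table_lookup]
lemmas type_table_11 = type_table_def[THEN fun_cong, of 11, simplified table_lookup]
lemmas type_table_12 = type_table_def[THEN fun_cong, of 12, simplified table_lookup]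
lemmas type_table_13 = type_table_def[THEN fun_cong, of 13, simplified table_lookup]
lemmas type_table_14 = type_table_def[THEN fun_cong, of 14, simplified table_lookup]
lemmas type_table_15 = type_table_def[THEN fun_cong, of 15, simplified table_lookup]
lemmas type_table_16 = type_table_def[THEN fun_cong, of 16, simplified table_lookup]

lemma type_table_rest: "n \<in> {0, 1, 4} \<Longrightarrow> type_table n = {}"
  by (auto simp: type_table_def)

lemma type_odds_Rp_2: "type_odds (Rp 2) = {1}"
proof -
  have one: "odds v = 1" if v: "has_type v (Rp 2)" "\<forall>w\<in>#v. signed_odd_root w" for v
  proof -
    obtain z where z: "root_of_unity z" "v = rot z (mu 2)" using has_type_Rp_shape[OF v(1)] .
    then have "v = {#z, - z#}" by (simp add: mu_2)
    then show ?thesis using v(2) odd_root_minus_iff by auto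
  qed
  have "odds (mu 2) \<in> type_odds (Rp 2)"
    using has_type_mu[of 2] by (intro type_oddsI) (auto simp: mu_2)
  moreover have "type_odds (Rp 2) \<subseteq> {1}" using one by (auto simp: type_odds_def)
  ultimately show ?thesis using subset_singletonD by fastforce
qed

lemma valid_entry_Rp_2: "valid_entry 2 (Rp 2) (replicate 2 1) {Upair 1 1}"
  using has_type_mu[of 2] has_type_Rp_weight_partition
  by (intro valid_entryI) (auto simp: type_odds_Rp_2)

lemma compl_odds_RC5_expanded:
  "compl_odds {#1#} {#RC 5 {#{#Rp 3#}#}#} = {2, 4}"
  "compl_odds {#1#} {#RC 5 {#{#Rp 3#}, {#Rp 3#}#}#} = {4, 3}"
  "compl_odds {#1#} {#RC 5 {#{#Rp 3#}, {#Rp 3#}, {#Rp 3#}#}#} = {6, 2}"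
  "compl_odds {#1#} {#RC 5 {#{#Rp 3#}, {#Rp 3#}, {#Rp 3#}, {#Rp 3#}#}#} = {8, 1}"
  using compl_odds_RC5[of 1] compl_odds_RC5[of 2] compl_odds_RC5[of 3] compl_odds_RC5[of 4]
  by (simp_all add: replicate_mset_numeral)

text \<open>
  With these rules the simplifier computes the hypotheses of \<open>valid_entry_RC\<close> for a single entry.
  It needs the multisets in expanded form, and the sets \<open>compl_odds\<close> for the types of all
  differences.
\<close>
lemmas valid_simps = replicate_mset_numeral attachable_def sorted_append insert_commute
  compl_odds_RC5_expanded

lemma valid_entries_2: "\<forall>(T, W, Ps)\<in>type_table 2. valid_entry 2 T W Ps"
  unfolding type_table_2 ball_simps prod.case
  by (intro conjI TrueI; rule valid_entry_Rp_2 valid_entry_Rp valid_entry_RC; simp add: valid_simps; auto)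

lemma valid_entries_3: "\<forall>(T, W, Ps)\<in>type_table 3. valid_entry 3 T W Ps"
  unfolding type_table_3 ball_simps prod.case
  by (intro conjI TrueI; rule valid_entry_Rp_2 valid_entry_Rp valid_entry_RC; simp add: valid_simps; auto)

lemma valid_entries_5: "\<forall>(T, W, Ps)\<in>type_table 5. valid_entry 5 T W Ps"
  unfolding type_table_5 ball_simps prod.case
  by (intro conjI TrueI; rule valid_entry_Rp_2 valid_entry_Rp valid_entry_RC; simp add: valid_simps; auto)

lemma valid_entries_6: "\<forall>(T, W, Ps)\<in>type_table 6. valid_entry 6 T W Ps"
  unfolding type_table_6 ball_simps prod.case
  by (intro conjI TrueI; rule valid_entry_Rp_2 valid_entry_Rp valid_entry_RC; simp add: valid_simps; auto)

lemma valid_entries_7: "\<forall>(T, W, Ps)\<in>type_table 7. valid_entry 7 T W Ps"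
  unfolding type_table_7 ball_simps prod.case
  by (intro conjI TrueI; rule valid_entry_Rp_2 valid_entry_Rp valid_entry_RC; simp add: valid_simps; auto)

lemma valid_entries_8: "\<forall>(T, W, Ps)\<in>type_table 8. valid_entry 8 T W Ps"
  unfolding type_table_8 ball_simps prod.case
  by (intro conjI TrueI; rule valid_entry_Rp_2 valid_entry_Rp valid_entry_RC; simp add: valid_simps; auto)

lemma valid_entries_9: "\<forall>(T, W, Ps)\<in>type_table 9. valid_entry 9 T W Ps"
  unfolding type_table_9 ball_simps prod.case
  by (intro conjI TrueI; rule valid_entry_Rp_2 valid_entry_Rp valid_entry_RC; simp add: valid_simps; auto)

lemma valid_entries_10: "\<forall>(T, W, Ps)\<in>type_table 10. valid_entry 10 T W Ps"
  unfolding type_table_10 ball_simps prod.case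
  by (intro conjI TrueI; rule valid_entry_Rp_2 valid_entry_Rp valid_entry_RC; simp add: valid_simps; auto)

lemma valid_entries_11: "\<forall>(T, W, Ps)\<in>type_table 11. valid_entry 11 T W Ps"
  unfolding type_table_11 ball_simps prod.case
  by (intro conjI TrueI; rule valid_entry_Rp_2 valid_entry_Rp valid_entry_RC; simp add: valid_simps; auto)

lemma valid_entries_12: "\<forall>(T, W, Ps)\<in>type_table 12. valid_entry 12 T W Ps"
  unfolding type_table_12 ball_simps prod.case
  by (intro conjI TrueI; rule valid_entry_Rp_2 valid_entry_Rp valid_entry_RC; simp add: valid_simps; auto)

lemma valid_entries_13: "\<forall>(T, W, Ps)\<in>type_table 13. valid_entry 13 T W Ps"
  unfolding type_table_13 ball_simps prod.case
  by (intro conjI TrueI; rule valid_entry_Rp_2 valid_entry_Rp valid_entry_RC; simp add: valid_simps; auto)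

lemma valid_entries_14: "\<forall>(T, W, Ps)\<in>type_table 14. valid_entry 14 T W Ps"
  unfolding type_table_14 ball_simps prod.case
  by (intro conjI TrueI; rule valid_entry_Rp_2 valid_entry_Rp valid_entry_RC; simp add: valid_simps; auto)

lemma valid_entries_15: "\<forall>(T, W, Ps)\<in>type_table 15. valid_entry 15 T W Ps"
proof -
  have pairs: "\<forall>(T, W, Ps)\<in>{(F y, V, {Q}) | y. y \<in> Y}. valid_entry 15 T W Ps"
    if "\<And>y. y \<in> Y \<Longrightarrow> valid_entry 15 (F y) V {Q}" for F V Q and Y :: "nat set"
    using that by blast
  show ?thesis
    unfolding type_table_15 ball_Un
    by (intro conjI; (rule pairs, (rule valid_entry_pair_R5 valid_entry_pair_six_sum; assumption))?;
      (simp only: ball_simps prod.case)?;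
      (intro conjI TrueI; rule valid_entry_pair_six_sum(1) valid_entry_RC; simp add: valid_simps; auto)?)
qed

lemma valid_entries_16: "\<forall>(T, W, Ps)\<in>type_table 16. valid_entry 16 T W Ps"
proof -
  have pairs: "\<forall>(T, W, Ps)\<in>{(F y, V, {Q}) | y. y \<in> Y}. valid_entry 16 T W Ps"
    if "\<And>y. y \<in> Y \<Longrightarrow> valid_entry 16 (F y) V {Q}" for F V Q and Y :: "nat set"
    using that by blast
  show ?thesis
    unfolding type_table_16 ball_Un
    by (intro conjI; (rule pairs, (rule valid_entry_pair_R5 valid_entry_pair_six_sum; assumption))?;
      (simp only: ball_simps prod.case)?;
      (intro conjI TrueI; rule valid_entry_pair_six_sum(1) valid_entry_RC; simp add: valid_simps; auto)?)
qed

lemma valid_entries: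
  assumes "n \<le> 16"
  shows "\<forall>(T, W, Ps)\<in>type_table n. valid_entry n T W Ps"
proof -
  have "n \<in> set [0..<17]" using assms by (simp only: set_upt atLeastLessThan_iff) simp
  then consider "n \<in> {0, 1, 4}" | "n = 2" | "n = 3" | "n = 5" | "n = 6" | "n = 7" | "n = 8" | "n = 9"
    | "n = 10" | "n = 11" | "n = 12" | "n = 13" | "n = 14" | "n = 15" | "n = 16"
    by (auto simp: upt_rec simp del: set_upt)
  then show ?thesis
    using valid_entries_2 valid_entries_3 valid_entries_5 valid_entries_6 valid_entries_7 valid_entries_8
      valid_entries_9 valid_entries_10 valid_entries_11 valid_entries_12 valid_entries_13
      valid_entries_14 valid_entries_15 valid_entries_16
    by cases (simp_all only: type_table_rest ball_empty)
qed

section \<open>Every minimal vanishing sum is listed\<close>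

definition listed :: "nat \<Rightarrow> mv_type \<Rightarrow> bool" where
  "listed n T \<longleftrightarrow> (\<exists>W Ps. (T, W, Ps) \<in> type_table n)"

lemma listed_RC7:
  "listed 8 (RC 7 (copies 1 (Rp 3)))"
  "listed 9 (RC 7 (copies 2 (Rp 3)))"
  "listed 10 (RC 7 (copies 1 (Rp 5)))"
  "listed 10 (RC 7 (copies 3 (Rp 3)))"
  "listed 11 (RC 7 (copies 1 (RC 5 (copies 1 (Rp 3)))))"
  "listed 11 (RC 7 (copies 1 (Rp 3) + copies 1 (Rp 5)))"
  "listed 11 (RC 7 (copies 4 (Rp 3)))"
  "listed 12 (RC 7 (copies 1 (RC 5 (copies 2 (Rp 3)))))"
  "listed 12 (RC 7 (copies 1 (Rp 3) + copies 1 (RC 5 (copies 1 (Rp 3)))))"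
  "listed 12 (RC 7 (copies 2 (Rp 3) + copies 1 (Rp 5)))"
  "listed 12 (RC 7 (copies 5 (Rp 3)))"
  "listed 13 (RC 7 (copies 1 (RC 5 (copies 3 (Rp 3)))))"
  "listed 13 (RC 7 (copies 2 (Rp 5)))"
  "listed 13 (RC 7 (copies 1 (Rp 3) + copies 1 (RC 5 (copies 2 (Rp 3)))))"
  "listed 13 (RC 7 (copies 2 (Rp 3) + copies 1 (RC 5 (copies 1 (Rp 3)))))"
  "listed 13 (RC 7 (copies 3 (Rp 3) + copies 1 (Rp 5)))"
  "listed 13 (RC 7 (copies 6 (Rp 3)))"
  "listed 14 (RC 7 (copies 1 (RC 5 (copies 4 (Rp 3)))))"
  "listed 14 (RC 7 (copies 1 (Rp 5) + copies 1 (RC 5 (copies 1 (Rp 3)))))"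
  "listed 14 (RC 7 (copies 1 (Rp 3) + copies 1 (RC 5 (copies 3 (Rp 3)))))"
  "listed 14 (RC 7 (copies 1 (Rp 3) + copies 2 (Rp 5)))"
  "listed 14 (RC 7 (copies 2 (Rp 3) + copies 1 (RC 5 (copies 2 (Rp 3)))))"
  "listed 14 (RC 7 (copies 3 (Rp 3) + copies 1 (RC 5 (copies 1 (Rp 3)))))"
  "listed 14 (RC 7 (copies 4 (Rp 3) + copies 1 (Rp 5)))"
  "listed 15 (RC 7 (copies 2 (RC 5 (copies 1 (Rp 3)))))"
  "listed 15 (RC 7 (copies 1 (Rp 5) + copies 1 (RC 5 (copies 2 (Rp 3)))))"
  "listed 15 (RC 7 (copies 1 (Rp 3) + copies 1 (RC 5 (copies 4 (Rp 3)))))"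
  "listed 15 (RC 7 (copies 1 (Rp 3) + copies 1 (Rp 5) + copies 1 (RC 5 (copies 1 (Rp 3)))))"
  "listed 15 (RC 7 (copies 2 (Rp 3) + copies 1 (RC 5 (copies 3 (Rp 3)))))"
  "listed 15 (RC 7 (copies 2 (Rp 3) + copies 2 (Rp 5)))"
  "listed 15 (RC 7 (copies 3 (Rp 3) + copies 1 (RC 5 (copies 2 (Rp 3)))))"
  "listed 15 (RC 7 (copies 4 (Rp 3) + copies 1 (RC 5 (copies 1 (Rp 3)))))"
  "listed 15 (RC 7 (copies 5 (Rp 3) + copies 1 (Rp 5)))"
  "listed 16 (RC 7 (copies 1 (RC 5 (copies 1 (Rp 3))) + copies 1 (RC 5 (copies 2 (Rp 3)))))"
  "listed 16 (RC 7 (copies 1 (Rp 5) + copies 1 (RC 5 (copies 3 (Rp 3)))))"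
  "listed 16 (RC 7 (copies 3 (Rp 5)))"
  "listed 16 (RC 7 (copies 1 (Rp 3) + copies 2 (RC 5 (copies 1 (Rp 3)))))"
  "listed 16 (RC 7 (copies 1 (Rp 3) + copies 1 (Rp 5) + copies 1 (RC 5 (copies 2 (Rp 3)))))"
  "listed 16 (RC 7 (copies 2 (Rp 3) + copies 1 (RC 5 (copies 4 (Rp 3)))))"
  "listed 16 (RC 7 (copies 2 (Rp 3) + copies 1 (Rp 5) + copies 1 (RC 5 (copies 1 (Rp 3)))))"
  "listed 16 (RC 7 (copies 3 (Rp 3) + copies 1 (RC 5 (copies 3 (Rp 3)))))"
  "listed 16 (RC 7 (copies 3 (Rp 3) + copies 2 (Rp 5)))"
  "listed 16 (RC 7 (copies 4 (Rp 3) + copies 1 (RC 5 (copies 2 (Rp 3)))))"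
  "listed 16 (RC 7 (copies 5 (Rp 3) + copies 1 (RC 5 (copies 1 (Rp 3)))))"
  unfolding listed_def type_table_8 type_table_9 type_table_10 type_table_11 type_table_12 type_table_13
    type_table_14 type_table_15 type_table_16
  by ((intro exI, (rule insertI1 | rule insertI2 | rule UnI1)+)+)

lemma listed_RC11:
  "listed 12 (RC 11 (copies 1 (Rp 3)))"
  "listed 13 (RC 11 (copies 2 (Rp 3)))"
  "listed 14 (RC 11 (copies 1 (Rp 5)))"
  "listed 14 (RC 11 (copies 3 (Rp 3)))"
  "listed 15 (RC 11 (copies 1 (RC 5 (copies 1 (Rp 3)))))"
  "listed 15 (RC 11 (copies 1 (Rp 3) + copies 1 (Rp 5)))"
  "listed 15 (RC 11 (copies 4 (Rp 3)))"
  "listed 16 (RC 11 (copies 1 (Rp 7)))"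
  "listed 16 (RC 11 (copies 1 (RC 5 (copies 2 (Rp 3)))))"
  "listed 16 (RC 11 (copies 1 (Rp 3) + copies 1 (RC 5 (copies 1 (Rp 3)))))"
  "listed 16 (RC 11 (copies 2 (Rp 3) + copies 1 (Rp 5)))"
  "listed 16 (RC 11 (copies 5 (Rp 3)))"
  unfolding listed_def type_table_12 type_table_13 type_table_14 type_table_15 type_table_16
  by ((intro exI, (rule insertI1 | rule insertI2 | rule UnI1)+)+)

lemma listed_RC13:
  "listed 14 (RC 13 (copies 1 (Rp 3)))"
  "listed 15 (RC 13 (copies 2 (Rp 3)))"
  "listed 16 (RC 13 (copies 1 (Rp 5)))"
  "listed 16 (RC 13 (copies 3 (Rp 3)))"
  unfolding listed_def type_table_14 type_table_15 type_table_16
  by ((intro exI, (rule insertI1 | rule insertI2 | rule UnI1)+)+)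

lemma listed_RC5:
  "listed 6 (RC 5 (copies 1 (Rp 3)))"
  "listed 7 (RC 5 (copies 2 (Rp 3)))"
  "listed 8 (RC 5 (copies 3 (Rp 3)))"
  "listed 9 (RC 5 (copies 4 (Rp 3)))"
  unfolding listed_def type_table_6 type_table_7 type_table_8 type_table_9
  by ((intro exI, (rule insertI1 | rule insertI2 | rule UnI1)+)+)

lemma listed_pair_nu_3:
  "listed 16 (Comp 7 {#1, nu 3#} (copies 1 (RC 5 (copies 1 (Rp 3)))))"
  unfolding listed_def type_table_16
  by ((intro exI, (rule insertI1 | rule insertI2 | rule UnI1)+)+)

lemma listed_Rp:
  "listed 2 (Rp 2)"
  "listed 3 (Rp 3)"
  "listed 5 (Rp 5)"
  "listed 7 (Rp 7)"
  "listed 11 (Rp 11)"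
  "listed 13 (Rp 13)"
  unfolding listed_def type_table_2 type_table_3 type_table_5 type_table_7 type_table_11 type_table_13
  by ((intro exI, (rule insertI1 | rule insertI2 | rule UnI1)+)+)

lemma listed_pairs:
  "y \<in> {1, 2} \<Longrightarrow> listed 15 (Comp 7 {#1, nu 5 ^ y#} (copies 1 (Rp 5)))"
  "y \<in> {1, 2} \<Longrightarrow> listed 16 (Comp 7 {#1, nu 5 ^ y#} (copies 2 (Rp 5)))"
  "y \<in> {1, 2} \<Longrightarrow> listed 16 (Comp 7 {#1, nu 5 ^ y#} ({#{#Rp 2, Rp 3#}#} + copies 1 (Rp 5)))"
  "y \<in> {1, 2} \<Longrightarrow> listed 16 (Comp 7 {#1, nu 5 ^ y#} (copies 1 (RC 5 (copies 1 (Rp 3)))))"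
  "y \<in> {1, 2, 3, 4} \<Longrightarrow>
    listed 16 (Comp 7 {#1, - (nu 3 * nu 5 ^ y)#} (copies 1 (RC 5 (copies 1 (Rp 3)))))"
  unfolding listed_def type_table_15 type_table_16
  by (intro exI, ((rule UnI2, rule CollectI, rule exI, rule conjI, rule refl, assumption) | rule UnI1)+)+

text \<open>
  The multiplicities of \<open>R\<^sub>3\<close>, of \<open>R\<^sub>5\<close> and of \<open>(R\<^sub>5 : k R\<^sub>3)\<close> for \<open>k = 1, \<dots>, 4\<close> for which a type
  over the base \<open>1\<close> with top prime \<open>7\<close> has weight at most \<open>16\<close>. A copy of these types increases
  the weight \<open>7\<close> by \<open>1\<close>, \<open>3\<close> and \<open>3 + k\<close>.
\<close>
definition multiplicity_list_7 :: "(nat \<times> nat \<times> nat \<times> nat \<times> nat \<times> nat) list" where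
  "multiplicity_list_7 = [
    (1, 0, 0, 0, 0, 0), (2, 0, 0, 0, 0, 0), (0, 1, 0, 0, 0, 0), (3, 0, 0, 0, 0, 0), (0, 0, 1, 0, 0, 0),
    (1, 1, 0, 0, 0, 0), (4, 0, 0, 0, 0, 0), (0, 0, 0, 1, 0, 0), (1, 0, 1, 0, 0, 0), (2, 1, 0, 0, 0, 0),
    (5, 0, 0, 0, 0, 0), (0, 0, 0, 0, 1, 0), (0, 2, 0, 0, 0, 0), (1, 0, 0, 1, 0, 0), (2, 0, 1, 0, 0, 0),
    (3, 1, 0, 0, 0, 0), (6, 0, 0, 0, 0, 0), (0, 0, 0, 0, 0, 1), (0, 1, 1, 0, 0, 0), (1, 0, 0, 0, 1, 0),
    (1, 2, 0, 0, 0, 0), (2, 0, 0, 1, 0, 0), (3, 0, 1, 0, 0, 0), (4, 1, 0, 0, 0, 0), (0, 0, 2, 0, 0, 0),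
    (0, 1, 0, 1, 0, 0), (1, 0, 0, 0, 0, 1), (1, 1, 1, 0, 0, 0), (2, 0, 0, 0, 1, 0), (2, 2, 0, 0, 0, 0),
    (3, 0, 0, 1, 0, 0), (4, 0, 1, 0, 0, 0), (5, 1, 0, 0, 0, 0), (0, 0, 1, 1, 0, 0), (0, 1, 0, 0, 1, 0),
    (0, 3, 0, 0, 0, 0), (1, 0, 2, 0, 0, 0), (1, 1, 0, 1, 0, 0), (2, 0, 0, 0, 0, 1), (2, 1, 1, 0, 0, 0),
    (3, 0, 0, 0, 1, 0), (3, 2, 0, 0, 0, 0), (4, 0, 0, 1, 0, 0), (5, 0, 1, 0, 0, 0)]"

lemma multiplicities_7:
  "\<forall>c6\<in>set [0..<2]. \<forall>c5\<in>set [0..<2]. \<forall>c4\<in>set [0..<2]. \<forall>c3\<in>set [0..<3]. \<forall>c2\<in>set [0..<4].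
    \<forall>c1\<in>set [0..<7]. 0 < c1 + c2 + c3 + c4 + c5 + c6 \<and> c1 + c2 + c3 + c4 + c5 + c6 < 7 \<and>
      c1 + 3 * c2 + 4 * c3 + 5 * c4 + 6 * c5 + 7 * c6 \<le> 9 \<longrightarrow>
    (c1, c2, c3, c4, c5, c6) \<in> set multiplicity_list_7"
  by code_simp

lemma listed_multiplicities_7:
  "\<forall>(c1, c2, c3, c4, c5, c6)\<in>set multiplicity_list_7.
    listed (7 + c1 + 3 * c2 + 4 * c3 + 5 * c4 + 6 * c5 + 7 * c6)
      (RC 7 (copies c1 (Rp 3) + copies c2 (Rp 5) + copies c3 (RC 5 (copies 1 (Rp 3))) +
        copies c4 (RC 5 (copies 2 (Rp 3))) + copies c5 (RC 5 (copies 3 (Rp 3))) +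
        copies c6 (RC 5 (copies 4 (Rp 3)))))"
  unfolding multiplicity_list_7_def using listed_RC7 by (simp add: add_mset_commute)

text \<open>
  The multiplicities of \<open>R\<^sub>3\<close>, \<open>R\<^sub>5\<close>, \<open>(R\<^sub>5 : R\<^sub>3)\<close>, \<open>(R\<^sub>5 : 2 R\<^sub>3)\<close> and \<open>R\<^sub>7\<close> for the top prime
  \<open>11\<close>.
\<close>
definition multiplicity_list_11 :: "(nat \<times> nat \<times> nat \<times> nat \<times> nat) list" where
  "multiplicity_list_11 = [
    (1, 0, 0, 0, 0), (2, 0, 0, 0, 0), (0, 1, 0, 0, 0), (3, 0, 0, 0, 0), (0, 0, 1, 0, 0), (1, 1, 0, 0, 0),
    (4, 0, 0, 0, 0), (0, 0, 0, 0, 1), (0, 0, 0, 1, 0), (1, 0, 1, 0, 0), (2, 1, 0, 0, 0), (5, 0, 0, 0, 0)]"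

lemma multiplicities_11:
  "\<forall>c5\<in>set [0..<2]. \<forall>c4\<in>set [0..<2]. \<forall>c3\<in>set [0..<2]. \<forall>c2\<in>set [0..<2]. \<forall>c1\<in>set [0..<6].
    0 < c1 + c2 + c3 + c4 + c5 \<and> c1 + 3 * c2 + 4 * c3 + 5 * c4 + 5 * c5 \<le> 5 \<longrightarrow>
    (c1, c2, c3, c4, c5) \<in> set multiplicity_list_11"
  by code_simp

lemma listed_multiplicities_11:
  "\<forall>(c1, c2, c3, c4, c5)\<in>set multiplicity_list_11.
    listed (11 + c1 + 3 * c2 + 4 * c3 + 5 * c4 + 5 * c5)
      (RC 11 (copies c1 (Rp 3) + copies c2 (Rp 5) + copies c3 (RC 5 (copies 1 (Rp 3))) +
        copies c4 (RC 5 (copies 2 (Rp 3))) + copies c5 (Rp 7)))"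
  unfolding multiplicity_list_11_def using listed_RC11 by (simp add: add_mset_commute)

lemma listed_7:
  assumes n: "n = 7 + c1 + 3 * c2 + 4 * c3 + 5 * c4 + 6 * c5 + 7 * c6" "n \<le> 16"
    and c: "0 < c1 + c2 + c3 + c4 + c5 + c6" "c1 + c2 + c3 + c4 + c5 + c6 < 7"
  shows "listed n (RC 7 (copies c1 (Rp 3) + copies c2 (Rp 5) + copies c3 (RC 5 (copies 1 (Rp 3))) +
    copies c4 (RC 5 (copies 2 (Rp 3))) + copies c5 (RC 5 (copies 3 (Rp 3))) + copies c6 (RC 5 (copies 4
      (Rp 3)))))"
proof -
  have e: "c1 + 3 * c2 + 4 * c3 + 5 * c4 + 6 * c5 + 7 * c6 \<le> 9" using n by linarith
  have b: "c6 \<in> set [0..<2]" "c5 \<in> set [0..<2]" "c4 \<in> set [0..<2]" "c3 \<in> set [0..<3]"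
    "c2 \<in> set [0..<4]" "c1 \<in> set [0..<7]"
    unfolding set_upt atLeastLessThan_iff using e c by linarith+
  show ?thesis
    using bspec[OF listed_multiplicities_7 multiplicities_7[rule_format, OF b conjI[OF c(1) conjI[OF c(2)
      e]]]]
    unfolding n(1) prod.case .
qed

lemma listed_11:
  assumes n: "n = 11 + c1 + 3 * c2 + 4 * c3 + 5 * c4 + 5 * c5" "n \<le> 16"
    and c: "0 < c1 + c2 + c3 + c4 + c5"
  shows "listed n (RC 11 (copies c1 (Rp 3) + copies c2 (Rp 5) + copies c3 (RC 5 (copies 1 (Rp 3))) +
    copies c4 (RC 5 (copies 2 (Rp 3))) + copies c5 (Rp 7)))"
proof -
  have e: "c1 + 3 * c2 + 4 * c3 + 5 * c4 + 5 * c5 \<le> 5" using n by linarith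
  have b: "c5 \<in> set [0..<2]" "c4 \<in> set [0..<2]" "c3 \<in> set [0..<2]" "c2 \<in> set [0..<2]" "c1 \<in> set [0..<6]"
    unfolding set_upt atLeastLessThan_iff using e by linarith+
  show ?thesis
    using bspec[OF listed_multiplicities_11 multiplicities_11[rule_format, OF b conjI[OF c e]]]
    unfolding n(1) prod.case .
qed

lemma listed_13:
  assumes n: "n = 13 + c1 + 3 * c2" "n \<le> 16" and c: "0 < c1 + c2"
  shows "listed n (RC 13 (copies c1 (Rp 3) + copies c2 (Rp 5)))"
proof -
  have "c1 = 1 \<and> c2 = 0 \<or> c1 = 2 \<and> c2 = 0 \<or> c1 = 3 \<and> c2 = 0 \<or> c1 = 0 \<and> c2 = 1"
    using n c by presburger
  then show ?thesis unfolding n(1) using listed_RC13 by (elim disjE conjE) simp_all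
qed

text \<open>
  This brings a multiset of types into the form with explicit multiplicities that the table uses.
\<close>
lemma mset_eq_sum_copies:
  assumes "distinct Xs" "set_mset Ts \<subseteq> set Xs"
  shows "Ts = (\<Sum>X\<leftarrow>Xs. replicate_mset (count Ts X) X)"
  using assms
proof (induction Xs arbitrary: Ts)
  case (Cons X Xs)
  let ?Ts = "{#Y \<in># Ts. Y \<noteq> X#}"
  have "?Ts = (\<Sum>Y\<leftarrow>Xs. replicate_mset (count ?Ts Y) Y)"
    by (rule Cons.IH) (use Cons.prems in auto)
  also have "\<dots> = (\<Sum>Y\<leftarrow>Xs. replicate_mset (count Ts Y) Y)"
    using Cons.prems(1) by (intro arg_cong[of _ _ sum_list] map_cong refl) auto
  finally have "replicate_mset (count Ts X) X + ?Ts = (\<Sum>Y\<leftarrow>X # Xs. replicate_mset (count Ts Y) Y)" by simp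
  moreover have "Ts = replicate_mset (count Ts X) X + ?Ts" by (rule multiset_eqI) simp
  ultimately show ?case by simp
qed simp

lemma small_types_cases:
  assumes "T \<in> small_types"
  shows "T = Rp 2 \<or> T = Rp 3 \<or> T = Rp 5 \<or> T = RC 5 (copies 1 (Rp 3)) \<or> T = RC 5 (copies 2 (Rp 3)) \<or>
    T = RC 5 (copies 3 (Rp 3)) \<or> T = RC 5 (copies 4 (Rp 3))"
proof (cases "T \<in> {Rp 2, Rp 3, Rp 5}")
  case False
  then obtain k where k: "k \<in> {1..4}" "T = RC 5 (copies k (Rp 3))"
    using assms unfolding small_types_def by blast
  then have "k = 1 \<or> k = 2 \<or> k = 3 \<or> k = 4" by auto
  then show ?thesis unfolding k(2) by blast
qed blast

lemma RC_in_table: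
  assumes h: "has_type h (RC p Ts)" and s: "size h \<le> 16" and Ts: "Ts \<noteq> {#}" "size Ts < p"
    and L: "\<And>X. X \<in># Ts \<Longrightarrow> X \<in> (\<lambda>T. {#T#}) ` (L - {Rp 2})"
    and p: "p = 7 \<and> L = small_types \<or> p = 11 \<and> L = {T \<in> small_types. type_size T \<le> 7} \<union> {Rp 7} \<or>
      p = 13 \<and> L = {T \<in> small_types. type_size T \<le> 5}"
  shows "listed (size h) (RC p Ts)"
proof -
  have n: "size h = type_size (RC p Ts)" using has_type_size(1)[OF h] .
  note sizes = type_size_RC5[of 1] type_size_RC5[of 2] type_size_RC5[of 3] type_size_RC5[of 4]
  have Ts_pos: "0 < size Ts" using Ts(1) nonempty_has_size by blast
  from p show ?thesis
  proof (elim disjE conjE)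
    assume p: "p = 7" and L7: "L = small_types"
    define Xs where "Xs = [{#Rp 3#}, {#Rp 5#}, {#RC 5 (copies 1 (Rp 3))#}, {#RC 5 (copies 2 (Rp 3))#},
      {#RC 5 (copies 3 (Rp 3))#}, {#RC 5 (copies 4 (Rp 3))#}]"
    have "distinct Xs" by (simp add: Xs_def replicate_mset_numeral)
    moreover have "set_mset Ts \<subseteq> set Xs" using L small_types_cases unfolding L7 Xs_def by fastforce
    ultimately obtain c where Ts_sum: "Ts = (\<Sum>X\<leftarrow>Xs. replicate_mset (c X) X)" using mset_eq_sum_copies
      by blast
    obtain c1 c2 c3 c4 c5 c6 where Ts_eq: "Ts = copies c1 (Rp 3) + copies c2 (Rp 5) +
        copies c3 (RC 5 (copies 1 (Rp 3))) + copies c4 (RC 5 (copies 2 (Rp 3))) +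
        copies c5 (RC 5 (copies 3 (Rp 3))) + copies c6 (RC 5 (copies 4 (Rp 3)))"
      using Ts_sum unfolding Xs_def list.map sum_list.Cons sum_list.Nil add_0_right add.assoc by blast
    have sz: "size Ts = c1 + c2 + c3 + c4 + c5 + c6" by (simp add: Ts_eq)
    have "size h = 7 + c1 + 3 * c2 + 4 * c3 + 5 * c4 + 6 * c5 + 7 * c6"
      unfolding n type_size.simps(2) sz using Ts(2) sz p by (simp add: Ts_eq)
    then show ?thesis unfolding p Ts_eq using s Ts(2) Ts_pos sz p by (intro listed_7) auto
  next
    assume p: "p = 11" and L11: "L = {T \<in> small_types. type_size T \<le> 7} \<union> {Rp 7}"
    define Xs where "Xs = [{#Rp 3#}, {#Rp 5#}, {#RC 5 (copies 1 (Rp 3))#}, {#RC 5 (copies 2 (Rp 3))#},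
        {#Rp 7#}]"
    have "distinct Xs" by (simp add: Xs_def replicate_mset_numeral)
    moreover have "{#T#} \<in> set Xs" if T: "T \<in> L - {Rp 2}" for T
    proof (cases "T = Rp 7")
      case False
      then have "T \<in> small_types" "type_size T \<le> 7" "T \<noteq> Rp 2" using T by (auto simp: L11)
      then show ?thesis using small_types_cases[of T] sizes by (auto simp: Xs_def simp del: type_size.simps)
    qed (simp add: Xs_def)
    then have "set_mset Ts \<subseteq> set Xs" using L by blast
    ultimately obtain c where Ts_sum: "Ts = (\<Sum>X\<leftarrow>Xs. replicate_mset (c X) X)" using mset_eq_sum_copies
      by blast
    obtain c1 c2 c3 c4 c5 where Ts_eq: "Ts = copies c1 (Rp 3) + copies c2 (Rp 5) +
        copies c3 (RC 5 (copies 1 (Rp 3))) + copies c4 (RC 5 (copies 2 (Rp 3))) + copies c5 (Rp 7)"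
      using Ts_sum unfolding Xs_def list.map sum_list.Cons sum_list.Nil add_0_right add.assoc by blast
    have sz: "size Ts = c1 + c2 + c3 + c4 + c5" by (simp add: Ts_eq)
    have "size h = 11 + c1 + 3 * c2 + 4 * c3 + 5 * c4 + 5 * c5"
      unfolding n type_size.simps(2) sz using Ts(2) sz p by (simp add: Ts_eq)
    then show ?thesis unfolding p Ts_eq using s Ts_pos sz by (intro listed_11) auto
  next
    assume p: "p = 13" and L13: "L = {T \<in> small_types. type_size T \<le> 5}"
    define Xs where "Xs = [{#Rp 3#}, {#Rp 5#}]"
    have "distinct Xs" by (simp add: Xs_def)
    moreover have "{#T#} \<in> set Xs" if T: "T \<in> L - {Rp 2}" for T
    proof -
      have "T \<in> small_types" "type_size T \<le> 5" "T \<noteq> Rp 2" using T by (auto simp: L13)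
      then show ?thesis using small_types_cases[of T] sizes by (auto simp: Xs_def simp del: type_size.simps)
    qed
    then have "set_mset Ts \<subseteq> set Xs" using L by blast
    ultimately obtain c where Ts_sum: "Ts = (\<Sum>X\<leftarrow>Xs. replicate_mset (c X) X)" using mset_eq_sum_copies
      by blast
    obtain c1 c2 where Ts_eq: "Ts = copies c1 (Rp 3) + copies c2 (Rp 5)"
      using Ts_sum unfolding Xs_def list.map sum_list.Cons sum_list.Nil add_0_right by blast
    have sz: "size Ts = c1 + c2" by (simp add: Ts_eq)
    have "size h = 13 + c1 + 3 * c2"
      unfolding n type_size.simps(2) sz using Ts(2) sz p by (simp add: Ts_eq)
    then show ?thesis unfolding p Ts_eq using s Ts_pos sz by (intro listed_13) auto
  qed
qed

lemma top_prime_le_weight: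
  assumes h: "minimal_vanishing h" shows "top_prime h \<le> size h"
proof -
  obtain f where d: "top_decomp h (top_prime h) f" using top_decomp_exists[OF h] by blast
  have "f 0 \<noteq> {#}" using one_in_base[OF d] by auto
  then have "1 \<le> size (f 0)" by (simp add: Suc_le_eq nonempty_has_size[symmetric])
  then have "top_prime h * 1 \<le> top_prime h * size (f 0)" by (intro mult_le_mono2)
  then show ?thesis using top_prime_le_size[OF h d] by linarith
qed

lemma unit_base_listed:
  assumes h: "minimal_vanishing h" and d: "top_decomp h p f" and f0: "f 0 = {#1#}"
    and p: "p \<in> {7, 11, 13}" and s: "size h \<le> 16"
  shows "\<exists>T. has_type h T \<and> listed (size h) T \<and> simple_type T"
proof -
  define L where "L = (if p = 7 then small_types
    else if p = 11 then {T \<in> small_types. type_size T \<le> 7} \<union> {Rp 7}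
    else {T \<in> small_types. type_size T \<le> 5})"
  have "\<exists>T\<in>L. has_type v T"
    if v: "minimal_vanishing v" "top_prime v < p" "size v + p \<le> size h + 2" for v
  proof (cases "top_prime v < 7")
    case True
    then obtain T where T: "T \<in> small_types" "has_type v T" using classify_small[OF v(1)] by blast
    then show ?thesis using has_type_size(1)[OF T(2)] v(3) s p by (auto simp: L_def)
  next
    case False
    have le: "top_prime v \<le> size v" using top_prime_le_weight[OF v(1)] .
    then have "p = 11" "size v = top_prime v" "top_prime v = 7" using False v(2,3) s p by auto
    then show ?thesis using size_eq_top_prime[OF v(1)] by (auto simp: L_def)
  qed
  then consider "has_type h (Rp p)" | Ts where "Ts \<noteq> {#}" "size Ts < p"
      "\<forall>X\<in>#Ts. \<exists>T\<in>L - {Rp 2}. X = {#T#}" "has_type h (RC p Ts)"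
    using RC_of_unit_base[OF h d f0, of L] p by auto
  then show ?thesis
  proof cases
    case 1
    have "size h = p" using has_type_size(1)[OF 1] by simp
    then have "listed (size h) (Rp p)" using p listed_Rp by auto
    then show ?thesis using 1 simple_type_Rp by blast
  next
    case 2
    have "listed (size h) (RC p Ts)"
    proof (rule RC_in_table[OF 2(4) s 2(1,2)])
      show "X \<in> (\<lambda>T. {#T#}) ` (L - {Rp 2})" if "X \<in># Ts" for X using 2(3) that by blast
      show "p = 7 \<and> L = small_types \<or> p = 11 \<and> L = {T \<in> small_types. type_size T \<le> 7} \<union> {Rp 7} \<or>
          p = 13 \<and> L = {T \<in> small_types. type_size T \<le> 5}" using p by (auto simp: L_def)
    qed
    moreover have "simple_type (RC p Ts)"
      using 2(3) simple_type_small simple_type_Rp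
      by (intro simple_type_RC) (auto simp: L_def split: if_splits)
    ultimately show ?thesis using 2(4) by blast
  qed
qed

lemma nu_5_inverse: "y \<le> 5 \<Longrightarrow> 1 / nu 5 ^ y = nu 5 ^ (5 - y)"
proof -
  assume "y \<le> 5"
  then have "nu 5 ^ y * nu 5 ^ (5 - y) = 1" by (simp flip: power_add)
  then show ?thesis by (simp add: divide_eq_eq mult.commute)
qed

lemma fifth_root_or_inverse:
  assumes "a ^ 5 = 1" "a \<noteq> 1"
  obtains y where "y \<in> {1, 2}" "a = nu 5 ^ y" | y where "y \<in> {1, 2}" "1 / a = nu 5 ^ y"
proof -
  obtain y where y: "y < 5" "a = nu 5 ^ y" using fifth_roots[OF assms(1)] .
  then have "y \<in> {1, 2} \<or> 5 - y \<in> {1, 2}" using assms(2) by (cases "y = 0") auto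
  then show ?thesis using that y nu_5_inverse[of y] by auto
qed

text \<open>
  The ratios \<open>a\<close> of the bases \<open>1 + a\<close> in the table: of \<open>a\<close> and \<open>1 / a\<close> only one is listed.
\<close>
definition normal_ratio :: "complex \<Rightarrow> bool" where
  "normal_ratio b \<longleftrightarrow> b = nu 3 \<or> (\<exists>k\<in>{1, 2}. b = nu 5 ^ k) \<or> (\<exists>k\<in>{1, 2, 3, 4}. b = - (nu 3 * nu 5 ^ k))"

lemma normal_fifth_root:
  assumes "a ^ 5 = 1" "a \<noteq> 1" shows "normal_ratio a \<or> normal_ratio (1 / a)"
  using fifth_root_or_inverse[OF assms] by (metis normal_ratio_def)

lemma six_sum_member_cases:
  assumes "w \<in># six_sum"
  obtains i where "i \<in> {1, 2, 3, 4}" "w = nu 5 ^ i" | "w = - nu 3" | "w = - (nu 3 ^ 2)"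
proof -
  note five = that(1)[of 1] that(1)[of 2] that(1)[of 3] that(1)[of 4]
  from six_sum_members[OF assms] show ?thesis
    by (elim disjE) (use five that(2,3) in simp_all)
qed

lemma normal_mixed_ratio:
  assumes i: "i \<in> {1, 2, 3, 4}"
  shows "normal_ratio (- nu 3 / nu 5 ^ i)" and "normal_ratio (nu 5 ^ i / - (nu 3 ^ 2))"
proof -
  have "- nu 3 / nu 5 ^ i = - (nu 3 * nu 5 ^ (5 - i))"
  proof -
    have "- nu 3 / nu 5 ^ i = - nu 3 * (1 / nu 5 ^ i)" by simp
    also have "1 / nu 5 ^ i = nu 5 ^ (5 - i)" using i by (intro nu_5_inverse) auto
    finally show ?thesis by simp
  qed
  moreover have "5 - i \<in> {1, 2, 3, 4}" using i by auto
  ultimately show "normal_ratio (- nu 3 / nu 5 ^ i)" by (auto simp: normal_ratio_def)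
  have "nu 3 ^ 2 * nu 3 = 1" using nu_3_cube by (simp add: power2_eq_square power3_eq_cube)
  then have "nu 5 ^ i / - (nu 3 ^ 2) = - (nu 3 * nu 5 ^ i)" by (simp add: field_simps)
  then show "normal_ratio (nu 5 ^ i / - (nu 3 ^ 2))" using i by (auto simp: normal_ratio_def)
qed

lemma six_sum_ratio:
  assumes xy: "{#x, y#} \<subseteq># six_sum" and a: "a = y / x"
  shows "normal_ratio a \<or> normal_ratio (1 / a)"
proof -
  have in6: "x \<in># six_sum" "y \<in># six_sum" using pair_subset_members[OF xy] by blast+
  have ne: "x \<noteq> y"
  proof
    assume "x = y"
    then have "2 \<le> count six_sum x" using mset_subset_eq_count[OF xy, of x] by simp
    moreover have "simple_type (RC 5 (copies 1 (Rp 3)))"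
      unfolding small_types_def
        by (intro simple_type_small[unfolded small_types_def] UnI2 image_eqI[of _ _ 1]) simp_all
    then have "count six_sum x \<le> 1" using has_type_six_sum by (simp add: simple_type_def)
    ultimately show False by simp
  qed
  have x0: "x \<noteq> 0" "y \<noteq> 0" using six_sum_order in6 by fastforce+
  have w: "nu 3 ^ 2 / nu 3 = nu 3" by (simp add: power2_eq_square)
  show ?thesis
    using in6(1)
  proof (cases rule: six_sum_member_cases)
    case (1 i)
    show ?thesis
      using in6(2)
    proof (cases rule: six_sum_member_cases)
      case (1 j)
      have "(nu 5 ^ k) ^ 5 = 1" for k by (metis nu_5_fifth power_mult mult.commute power_one)
      then have "a ^ 5 = 1" using \<open>x = nu 5 ^ i\<close> \<open>y = nu 5 ^ j\<close> a by (simp only: power_divide) simp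
      moreover have "a \<noteq> 1" using a ne x0 by simp
      ultimately show ?thesis by (rule normal_fifth_root)
    next
      case 2
      then show ?thesis using normal_mixed_ratio(1)[OF 1(1)] a 1(2) by simp
    next
      case 3
      then show ?thesis using normal_mixed_ratio(2)[OF 1(1)] a 1(2) by simp
    qed
  next
    case 2
    show ?thesis
      using in6(2)
    proof (cases rule: six_sum_member_cases)
      case (1 j)
      then show ?thesis using normal_mixed_ratio(1)[OF 1(1)] a 2 by simp
    next
      case 3
      then have "a = nu 3" using a 2 w by simp
      then show ?thesis by (simp add: normal_ratio_def)
    qed (use 2 ne in simp)
  next
    case 3
    show ?thesis
      using in6(2)
    proof (cases rule: six_sum_member_cases)
      case (1 j)
      then show ?thesis using normal_mixed_ratio(2)[OF 1(1)] a 3 by simp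
    next
      case 2
      then have "1 / a = nu 3" using a 3 w by simp
      then show ?thesis by (simp add: normal_ratio_def)
    qed (use 3 ne in simp)
  qed
qed

text \<open>
  Rotating the base \<open>1 + a\<close> by \<open>1 / a\<close> replaces \<open>a\<close> by \<open>1 / a\<close>, so the ratio can be assumed normal.
\<close>
lemma pair_base_listed:
  assumes h: "minimal_vanishing h" and d: "top_decomp h 7 f" and s: "size h \<le> 16"
    and f0: "size (f 0) = 2"
  shows "(\<exists>T. has_type h T \<and> listed (size h) T) \<and> (\<forall>x. count h x \<le> 1)"
proof -
  have normal: "\<exists>T. has_type h T \<and> listed (size h) T"
    if d: "top_decomp h 7 f" and f0: "f 0 = {#1, a#}" and a: "normal_ratio a" for f a
  proof -
    note c = conjunct2[OF pair_base[OF h d s f0]]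
    have five: "\<exists>k\<in>{1, 2}. a = nu 5 ^ k" if "a ^ 5 = 1"
    proof -
      have "odd_root a" using that by (intro odd_rootI[of 5]) auto
      moreover have "\<not> odd_root (- (nu 3 * nu 5 ^ k))" for k
        by (intro not_odd_root_minus odd_root_mult) auto
      moreover have "a \<noteq> nu 3" using that nu_3_fifth by auto
      ultimately show ?thesis using a unfolding normal_ratio_def by blast
    qed
    from c show ?thesis
    proof (elim disjE conjE exE)
      assume "size h = 15" "a ^ 5 = 1" "has_type h (Comp 7 {#1, a#} (copies 1 (Rp 5)))"
      then show ?thesis using five listed_pairs(1) by metis
    next
      assume "size h = 16" "a ^ 5 = 1" "has_type h (Comp 7 {#1, a#} (copies 2 (Rp 5)))"
      then show ?thesis using five listed_pairs(2) by metis
    next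
      assume "size h = 16" "a ^ 5 = 1" "has_type h (Comp 7 {#1, a#} ({#{#Rp 2, Rp 3#}#} + copies 1 (Rp 5)))"
      then show ?thesis using five listed_pairs(3) by metis
    next
      assume *: "size h = 16" "has_type h (Comp 7 {#1, a#} (copies 1 (RC 5 (copies 1 (Rp 3)))))"
      have "listed 16 (Comp 7 {#1, a#} (copies 1 (RC 5 (copies 1 (Rp 3)))))"
        using a unfolding normal_ratio_def
      proof (elim disjE bexE)
        assume "a = nu 3"
        then show ?thesis using listed_pair_nu_3 by simp
      next
        fix k :: nat assume "k \<in> {1, 2}" "a = nu 5 ^ k"
        then show ?thesis using listed_pairs(4) by blast
      next
        fix k :: nat assume "k \<in> {1, 2, 3, 4}" "a = - (nu 3 * nu 5 ^ k)"
        then show ?thesis using listed_pairs(5) by blast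
      qed
      then show ?thesis using * by metis
    qed
  qed
  obtain g where g: "f 0 = add_mset 1 g" using one_in_base[OF d] by (metis multi_member_split)
  then have "size g = 1" using f0 by simp
  then obtain a where "g = {#a#}" using size_1_singleton_mset by blast
  then have fa: "f 0 = {#1, a#}" using g by simp
  have a0: "a \<noteq> 0"
    using top_decomp_props(8)[OF h d refl, of 0] fa root_of_unity_ne_0 by (auto simp: sorou_def)
  note c = pair_base[OF h d s fa]
  have "normal_ratio a \<or> normal_ratio (1 / a)"
    using conjunct2[OF c] normal_fifth_root six_sum_ratio by blast
  then have "\<exists>T. has_type h T \<and> listed (size h) T"
  proof
    assume "normal_ratio a"
    then show ?thesis using normal[OF d fa] by blast
  next
    assume n: "normal_ratio (1 / a)"
    have "top_decomp h 7 (\<lambda>j. rot (1 / a) (f j))" using fa by (intro top_decomp_rebase[OF h d]) simp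
    moreover have "rot (1 / a) (f 0) = {#1, 1 / a#}" using fa a0 by (simp add: add_mset_commute)
    ultimately show ?thesis using normal n by blast
  qed
  then show ?thesis using c by blast
qed

text \<open>
  From \<open>p \<cdot> size (f 0) \<le> 16\<close> it follows that the base is a single term for \<open>p \<ge> 11\<close> and has at
  most two terms for \<open>p = 7\<close>; smaller top primes allow a complete classification without regard to
  weight.
\<close>
theorem minimal_vanishing_listed:
  assumes h: "minimal_vanishing h" and s: "size h \<le> 16"
  shows "(\<exists>T. has_type h T \<and> listed (size h) T) \<and> (\<forall>x. count h x \<le> 1)"
proof -
  define p where "p = top_prime h"
  obtain f where d: "top_decomp h p f" using top_decomp_exists[OF h] p_def by blast
  have ps: "p * size (f 0) \<le> 16" using top_prime_le_size[OF h d] s by simp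
  have f1: "1 \<in># f 0" using one_in_base[OF d] .
  have p: "p \<in> {2, 3, 5, 7, 11, 13}"
  proof (rule primes_below(5))
    show "prime p" using top_prime_props(1)[OF h] by (simp add: p_def)
    show "p < 17" using top_prime_le_weight[OF h] s by (simp add: p_def)
  qed
  have single: "f 0 = {#1#}" if "size (f 0) = 1"
    using that f1 size_1_singleton_mset by fastforce
  have ne: "size (f 0) \<noteq> 0" using f1 by auto
  have large: "size (f 0) \<le> 1" if "p > 8"
  proof (rule ccontr)
    assume "\<not> size (f 0) \<le> 1"
    then have "9 * 2 \<le> p * size (f 0)" using that by (intro mult_le_mono) auto
    then show False using ps by simp
  qed
  have seven: "size (f 0) = 1 \<or> size (f 0) = 2" if "p = 7"
  proof -
    have "7 * size (f 0) \<le> 16" using ps that by simp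
    then show ?thesis using ne by linarith
  qed
  consider "p < 7" | "p = 7" | "p \<in> {11, 13}" using p by auto
  then consider "p < 7" | "p \<in> {7, 11, 13}" "size (f 0) = 1" | "p = 7" "size (f 0) = 2"
  proof cases
    case 2
    then show ?thesis using seven that by blast
  next
    case 3
    then have "p > 8" by auto
    then have "size (f 0) = 1" using large ne by linarith
    then show ?thesis using 3 that(2) by blast
  qed blast
  then show ?thesis
  proof cases
    case 1
    then obtain T where T: "T \<in> small_types" "has_type h T" using classify_small[OF h] by (auto simp: p_def)
    have "listed (type_size T) T"
    proof -
      have "listed (type_size (RC 5 (copies k (Rp 3)))) (RC 5 (copies k (Rp 3)))" if "k \<in> {1, 2, 3, 4}"
        for k
      proof -
        have "listed (5 + k) (RC 5 (copies k (Rp 3)))" using that listed_RC5 by auto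
        then show ?thesis using that type_size_RC5[of k] by auto
      qed
      moreover have "listed (type_size (Rp q)) (Rp q)" if "q \<in> {2, 3, 5}" for q
        using that listed_Rp by auto
      ultimately show ?thesis using small_types_cases[OF T(1)] by blast
    qed
    then show ?thesis
      using T has_type_size(1)[OF T(2)] simple_type_small[OF T(1)] by (auto simp: simple_type_def)
  next
    case 2
    then show ?thesis using unit_base_listed[OF h d single _ s] by (auto simp: simple_type_def)
  next
    case 3
    then show ?thesis using pair_base_listed[OF h _ s, of f] d by blast
  qed
qed

theorem theorem3p3:
  shows
    "(\<forall>h. minimal_vanishing h \<and> size h \<le> 16 \<longrightarrow>
        (\<exists>(T, W, Ps) \<in> type_table (size h). has_type h T) \<and> height h = 1) \<and>
     (\<forall>n\<le>16. \<forall>(T, W, Ps) \<in> type_table n.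
        (\<exists>h. minimal_vanishing h \<and> size h = n \<and> has_type h T) \<and>
        (\<forall>h. minimal_vanishing h \<and> has_type h T \<longrightarrow>
           top_prime h = leading_index T \<and>
           (\<forall>W'. has_weight_partition h W' \<longleftrightarrow> W' = W) \<and>
           (\<exists>P\<in>Ps. \<forall>P'. has_parity h P' \<longleftrightarrow> P' = P)) \<and>
        (\<forall>P\<in>Ps. \<exists>h. minimal_vanishing h \<and> has_type h T \<and> has_parity h P))"
proof (intro conjI allI impI)
  fix h assume h: "minimal_vanishing h \<and> size h \<le> 16"
  then show "\<exists>(T, W, Ps)\<in>type_table (size h). has_type h T"
    using minimal_vanishing_listed unfolding listed_def by blast
  have "h \<noteq> {#}" using h vanishing_sorou sorou_def by blast
  then show "height h = 1" using h minimal_vanishing_listed by (intro height_eq_1) blast+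
next
  fix n :: nat assume "n \<le> 16"
  from valid_entries[OF this] show "\<forall>(T, W, Ps)\<in>type_table n.
        (\<exists>h. minimal_vanishing h \<and> size h = n \<and> has_type h T) \<and>
        (\<forall>h. minimal_vanishing h \<and> has_type h T \<longrightarrow>
           top_prime h = leading_index T \<and>
           (\<forall>W'. has_weight_partition h W' \<longleftrightarrow> W' = W) \<and>
           (\<exists>P\<in>Ps. \<forall>P'. has_parity h P' \<longleftrightarrow> P' = P)) \<and>
        (\<forall>P\<in>Ps. \<exists>h. minimal_vanishing h \<and> has_type h T \<and> has_parity h P)"
    unfolding valid_entry_def .
qed

end
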